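(* Let $(B_i)_{i\in\mathbb{N}}$ be a uniformly computable enumeration of all (partial) computable normed linear spaces over $\mathbb{Q}$ (all countable $\mathbb{Q}$-vector spaces with computable operations together with all partial computable norms on them), and let $\overline{B_i}$ denote the completion of $B_i$. Then the index set $\{i\in\mathbb{N} : \overline{B_i}$ is linearly isometrically isomorphic to $(C[0,1],\|\cdot\|_{\sup})\}$ is arithmetical.
   Context: $C[0,1]$ is the Banach space of continuous real-valued functions on $[0,1]$ with the supremum norm and pointwise addition and scalar multiplication. *)

theory Defs
  imports "HOL-Analysis.Analysis"
begin

text \<open>
  Kleene's partial recursive functions of arity \<open>k\<close>, with \<^const>\<open>None\<close> for ``undefined''.
  Only the values on lists of length \<open>k\<close> are meaningful.
\<close>

inductive partrec :: "nat \<Rightarrow> (nat list \<Rightarrow> nat option) \<Rightarrow> bool" where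
  zero: "partrec k (\<lambda>xs. Some 0)"
| succ: "partrec 1 (\<lambda>xs. Some (Suc (hd xs)))"
| proj: "i < k \<Longrightarrow> partrec k (\<lambda>xs. Some (xs ! i))"
| comp: "partrec (length gs) f \<Longrightarrow> \<forall>g\<in>set gs. partrec k g \<Longrightarrow>
    partrec k (\<lambda>xs. Option.bind (those (map (\<lambda>g. g xs) gs)) f)"
| prim_rec: "partrec k f \<Longrightarrow> partrec (k + 2) g \<Longrightarrow>
    partrec (k + 1) (\<lambda>xs. rec_nat (f (tl xs))
      (\<lambda>n r. Option.bind r (\<lambda>v. g (n # v # tl xs))) (hd xs))"
| minim: "partrec (k + 1) f \<Longrightarrow>
    partrec k (\<lambda>xs.
      if \<exists>n. f (n # xs) = Some 0 \<and> (\<forall>m<n. f (m # xs) \<noteq> None)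
      then Some (LEAST n. f (n # xs) = Some 0)
      else None)"

definition partrec1 :: "(nat \<Rightarrow> nat option) \<Rightarrow> bool" where
  "partrec1 f \<longleftrightarrow> (\<exists>F. partrec 1 F \<and> (\<forall>x. F [x] = f x))"

definition partrec2 :: "(nat \<Rightarrow> nat \<Rightarrow> nat option) \<Rightarrow> bool" where
  "partrec2 f \<longleftrightarrow> (\<exists>F. partrec 2 F \<and> (\<forall>x y. F [x, y] = f x y))"

definition partrec3 :: "(nat \<Rightarrow> nat \<Rightarrow> nat \<Rightarrow> nat option) \<Rightarrow> bool" where
  "partrec3 f \<longleftrightarrow> (\<exists>F. partrec 3 F \<and> (\<forall>x y z. F [x, y, z] = f x y z))"

definition computable_rel :: "nat \<Rightarrow> (nat list \<Rightarrow> bool) \<Rightarrow> bool" where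
  "computable_rel k R \<longleftrightarrow>
    (\<exists>F. partrec k F \<and> (\<forall>xs. length xs = k \<longrightarrow> F xs = Some (if R xs then 1 else 0)))"

text \<open>
  \<open>alternating b n R xs\<close> prefixes \<open>R\<close> with \<open>n\<close> alternating number quantifiers, the outermost
  being existential iff \<open>b\<close>.
\<close>

fun alternating :: "bool \<Rightarrow> nat \<Rightarrow> (nat list \<Rightarrow> bool) \<Rightarrow> nat list \<Rightarrow> bool" where
  "alternating b 0 R xs = R xs"
| "alternating True (Suc n) R xs = (\<exists>y. alternating False n R (xs @ [y]))"
| "alternating False (Suc n) R xs = (\<forall>y. alternating True n R (xs @ [y]))"

definition Sigma_set :: "nat \<Rightarrow> nat set \<Rightarrow> bool" where
  "Sigma_set n A \<longleftrightarrow>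
    (\<exists>R. computable_rel (Suc n) R \<and> (\<forall>x. x \<in> A \<longleftrightarrow> alternating True n R [x]))"

definition Pi_set :: "nat \<Rightarrow> nat set \<Rightarrow> bool" where
  "Pi_set n A \<longleftrightarrow>
    (\<exists>R. computable_rel (Suc n) R \<and> (\<forall>x. x \<in> A \<longleftrightarrow> alternating False n R [x]))"

definition arithmetical :: "nat set \<Rightarrow> bool" where
  "arithmetical A \<longleftrightarrow> (\<exists>n. Sigma_set n A \<or> Pi_set n A)"

locale rat_vector_space =
  fixes V :: "'a set"
    and add :: "'a \<Rightarrow> 'a \<Rightarrow> 'a"
    and scale :: "rat \<Rightarrow> 'a \<Rightarrow> 'a"
    and zero :: 'a
  assumes zero_closed: "zero \<in> V"
    and add_closed: "x \<in> V \<Longrightarrow> y \<in> V \<Longrightarrow> add x y \<in> V"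
    and scale_closed: "x \<in> V \<Longrightarrow> scale q x \<in> V"
    and add_assoc: "x \<in> V \<Longrightarrow> y \<in> V \<Longrightarrow> z \<in> V \<Longrightarrow> add (add x y) z = add x (add y z)"
    and add_commute: "x \<in> V \<Longrightarrow> y \<in> V \<Longrightarrow> add x y = add y x"
    and add_zero: "x \<in> V \<Longrightarrow> add x zero = x"
    and add_inverse: "x \<in> V \<Longrightarrow> \<exists>y\<in>V. add x y = zero"
    and scale_add_right: "x \<in> V \<Longrightarrow> y \<in> V \<Longrightarrow> scale q (add x y) = add (scale q x) (scale q y)"
    and scale_add_left: "x \<in> V \<Longrightarrow> scale (p + q) x = add (scale p x) (scale q x)"
    and scale_scale: "x \<in> V \<Longrightarrow> scale p (scale q x) = scale (p * q) x"
    and scale_one: "x \<in> V \<Longrightarrow> scale 1 x = x"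

locale rat_normed_space = rat_vector_space V add scale zero
  for V :: "'a set"
    and add :: "'a \<Rightarrow> 'a \<Rightarrow> 'a"
    and scale :: "rat \<Rightarrow> 'a \<Rightarrow> 'a"
    and zero :: 'a +
  fixes nrm :: "'a \<Rightarrow> real"
  assumes norm_nonneg: "x \<in> V \<Longrightarrow> 0 \<le> nrm x"
    and norm_eq_zero: "x \<in> V \<Longrightarrow> nrm x = 0 \<longleftrightarrow> x = zero"
    and norm_scale: "x \<in> V \<Longrightarrow> nrm (scale q x) = \<bar>real_of_rat q\<bar> * nrm x"
    and norm_triangle: "x \<in> V \<Longrightarrow> y \<in> V \<Longrightarrow> nrm (add x y) \<le> nrm x + nrm y"

text \<open>
  The data of a (possibly partial) presentation with domain a subset of the natural numbers:
  a 0/1-valued characteristic function of the domain, addition, multiplication of a vector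
  (second argument) by the rational with code given by the first argument, and a function
  taking a vector \<open>x\<close> and a precision \<open>n\<close> to the code of a rational approximating the norm
  of \<open>x\<close> up to \<open>2\<^sup>-\<^sup>n\<close>.  Rationals are coded by the (effective, non-injective) library
  numbering \<^const>\<open>nat_to_rat_surj\<close>.
\<close>

record presentation =
  dom_char :: "nat \<Rightarrow> nat option"
  add_fun :: "nat \<Rightarrow> nat \<Rightarrow> nat option"
  scale_fun :: "nat \<Rightarrow> nat \<Rightarrow> nat option"
  norm_fun :: "nat \<Rightarrow> nat \<Rightarrow> nat option"

definition points :: "presentation \<Rightarrow> nat set" where
  "points P = {x. dom_char P x = Some 1}"

definition padd :: "presentation \<Rightarrow> nat \<Rightarrow> nat \<Rightarrow> nat" where
  "padd P x y = the (add_fun P x y)"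

definition pscale :: "presentation \<Rightarrow> rat \<Rightarrow> nat \<Rightarrow> nat" where
  "pscale P q x = the (scale_fun P (inv nat_to_rat_surj q) x)"

definition pnorm :: "presentation \<Rightarrow> nat \<Rightarrow> real" where
  "pnorm P x = lim (\<lambda>n. real_of_rat (nat_to_rat_surj (the (norm_fun P x n))))"

definition pdist :: "presentation \<Rightarrow> nat \<Rightarrow> nat \<Rightarrow> real" where
  "pdist P x y = pnorm P (padd P x (pscale P (-1) y))"

definition ops_total :: "presentation \<Rightarrow> bool" where
  "ops_total P \<longleftrightarrow>
    (\<forall>x. dom_char P x \<in> {Some 0, Some 1}) \<and>
    (\<forall>x\<in>points P. \<forall>y\<in>points P. add_fun P x y \<noteq> None) \<and>
    (\<forall>c. \<forall>x\<in>points P. scale_fun P c x = Some (pscale P (nat_to_rat_surj c) x))"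

definition norm_total :: "presentation \<Rightarrow> bool" where
  "norm_total P \<longleftrightarrow>
    (\<forall>x\<in>points P. \<forall>n. \<exists>c. norm_fun P x n = Some c \<and>
      \<bar>real_of_rat (nat_to_rat_surj c) - pnorm P x\<bar> \<le> 1 / 2 ^ n)"

definition presents_vector_space :: "presentation \<Rightarrow> bool" where
  "presents_vector_space P \<longleftrightarrow>
    ops_total P \<and> (\<exists>z. rat_vector_space (points P) (padd P) (pscale P) z)"

definition presents_normed_space :: "presentation \<Rightarrow> bool" where
  "presents_normed_space P \<longleftrightarrow>
    ops_total P \<and> norm_total P \<and>
    (\<exists>z. rat_normed_space (points P) (padd P) (pscale P) z (pnorm P))"

definition same_space :: "presentation \<Rightarrow> presentation \<Rightarrow> bool" where
  "same_space P Q \<longleftrightarrow>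
    dom_char P = dom_char Q \<and>
    (\<forall>x\<in>points P. \<forall>y\<in>points P. add_fun P x y = add_fun Q x y) \<and>
    (\<forall>c. \<forall>x\<in>points P. scale_fun P c x = scale_fun Q c x) \<and>
    (\<forall>x\<in>points P. \<forall>n. norm_fun P x n = norm_fun Q x n)"

definition partial_computable :: "presentation \<Rightarrow> bool" where
  "partial_computable P \<longleftrightarrow>
    partrec1 (dom_char P) \<and> partrec2 (add_fun P) \<and>
    partrec2 (scale_fun P) \<and> partrec2 (norm_fun P)"

definition uniformly_computable :: "(nat \<Rightarrow> presentation) \<Rightarrow> bool" where
  "uniformly_computable B \<longleftrightarrow>
    partrec2 (\<lambda>i. dom_char (B i)) \<and> partrec3 (\<lambda>i. add_fun (B i)) \<and>
    partrec3 (\<lambda>i. scale_fun (B i)) \<and> partrec3 (\<lambda>i. norm_fun (B i))"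

text \<open>
  Every computable rational vector space equipped with every partial computable function in
  the role of the norm is listed.  The members of the list themselves may be partial or
  violate the axioms: by diagonalisation no uniformly computable list consists of exactly
  the presentations satisfying \<^const>\<open>presents_vector_space\<close>.
\<close>

definition enumerates_all :: "(nat \<Rightarrow> presentation) \<Rightarrow> bool" where
  "enumerates_all B \<longleftrightarrow>
    (\<forall>P. partial_computable P \<and> presents_vector_space P \<longrightarrow> (\<exists>i. same_space P (B i)))"

record 'a nspace =
  ncarrier :: "'a set"
  nadd :: "'a \<Rightarrow> 'a \<Rightarrow> 'a"
  nscale :: "real \<Rightarrow> 'a \<Rightarrow> 'a"
  nnorm :: "'a \<Rightarrow> real"

definition isometrically_isomorphic :: "'a nspace \<Rightarrow> 'b nspace \<Rightarrow> bool" where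
  "isometrically_isomorphic X Y \<longleftrightarrow>
    (\<exists>T. bij_betw T (ncarrier X) (ncarrier Y) \<and>
      (\<forall>x\<in>ncarrier X. \<forall>y\<in>ncarrier X. T (nadd X x y) = nadd Y (T x) (T y)) \<and>
      (\<forall>r. \<forall>x\<in>ncarrier X. T (nscale X r x) = nscale Y r (T x)) \<and>
      (\<forall>x\<in>ncarrier X. nnorm Y (T x) = nnorm X x))"

definition cauchy_seqs :: "presentation \<Rightarrow> (nat \<Rightarrow> nat) set" where
  "cauchy_seqs P = {s. range s \<subseteq> points P \<and>
    (\<forall>e>0. \<exists>M. \<forall>m\<ge>M. \<forall>n\<ge>M. pdist P (s m) (s n) < e)}"

definition null_rel :: "presentation \<Rightarrow> ((nat \<Rightarrow> nat) \<times> (nat \<Rightarrow> nat)) set" where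
  "null_rel P = {(s, t). s \<in> cauchy_seqs P \<and> t \<in> cauchy_seqs P \<and>
    (\<lambda>n. pdist P (s n) (t n)) \<longlonglongrightarrow> 0}"

text \<open>
  The completion as the space of Cauchy sequences modulo null sequences.  A real multiple
  \<open>r [s]\<close> is the class of the sequences \<open>q\<^sub>n s\<^sub>n\<close> for rationals \<open>q\<^sub>n\<close> converging to \<open>r\<close>.
\<close>

definition banach_completion :: "presentation \<Rightarrow> (nat \<Rightarrow> nat) set nspace" where
  "banach_completion P = \<lparr>
    ncarrier = cauchy_seqs P // null_rel P,
    nadd = (\<lambda>X Y. \<Union>s\<in>X. \<Union>t\<in>Y. null_rel P `` {\<lambda>n. padd P (s n) (t n)}),
    nscale = (\<lambda>r X. \<Union>s\<in>X. \<Union>q\<in>{q. (\<lambda>n. real_of_rat (q n)) \<longlonglongrightarrow> r}.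
      null_rel P `` {\<lambda>n. pscale P (q n) (s n)}),
    nnorm = (\<lambda>X. lim (\<lambda>n. pnorm P ((SOME s. s \<in> X) n)))\<rparr>"

definition C01 :: "(real \<Rightarrow> real) nspace" where
  "C01 = \<lparr>
    ncarrier = {f \<in> extensional {0..1}. continuous_on {0..1} f},
    nadd = (\<lambda>f g. \<lambda>x\<in>{0..1}. f x + g x),
    nscale = (\<lambda>r f. \<lambda>x\<in>{0..1}. r * f x),
    nnorm = (\<lambda>f. SUP x\<in>{0..1}. \<bar>f x\<bar>)\<rparr>"

end

theory Submission
  imports Defs "HOL-Number_Theory.Cong"
begin

text \<open>
  The completion is isometric to C[0,1] iff the space embeds rationally linearly, isometrically and
  densely into C[0,1].  Quantifying over such embeddings is not arithmetical; the point is that one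
  of them is definable, by number quantifiers only, from three parameters.

  Write \<open>{u > 0}\<close> for the set where a function is positive.  The norm sees where functions vanish:
  \<open>\<bar>f\<bar> \<ge> \<delta>\<close> everywhere iff \<open>max \<parallel>f + y\<parallel> \<parallel>f - y\<parallel> \<ge> \<delta> + \<parallel>y\<parallel>\<close> for all \<open>y\<close> (test with high narrow
  bumps \<open>y\<close>).  Relative to a positive parameter \<open>e\<close> this defines \<open>f > 0\<close>, hence whether \<open>{u > 0}\<close> and
  \<open>{v > 0}\<close> meet, hence betweenness: a point of \<open>{u > 0}\<close> lies between points of \<open>{v > 0}\<close> and
  \<open>{w > 0}\<close> iff some \<open>k\<close> is positive at the one, negative at the other, and vanishes only inside
  \<open>{u > 0}\<close>.  Two parameters \<open>l\<close>, \<open>r\<close> with \<open>{l > 0}\<close> to the left of \<open>{r > 0}\<close> orient the interval.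
  Now each \<open>u\<close> with \<open>{u > 0}\<close> nonempty names the point \<open>sup {u > 0}\<close>; these points are dense, and the
  value of \<open>f / e\<close> at such a point is definable.

  Conversely, evaluations indexed by a linear order that satisfy the evident first-order properties
  of this family come from an embedding: a weighted sum of the running maxima of all vectors maps the
  index set monotonically onto a dense subset of an interval, the evaluations extend continuously to
  it, their span is dense by Stone--Weierstrass, and dividing by the supremum over the unit ball
  restores the norm.
\<close>

section \<open>Computable functions and prenex formulas\<close>

text \<open>Only a countable dense subspace is at hand, so the constant 1, the coordinate function
  and products exist in it only approximately. Hence the axioms carry rational slacks, and a
  positive vector \<open>e\<close> replaces 1. In place of the coordinate function there is, for
  each vector \<open>f\<close> and each error, a vector \<open>p\<close> that is increasing up to
  \<delta> and whose values control those of \<open>f\<close>; running maxima turn these almost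
  monotone vectors into monotone functions, and summing over all vectors makes one map serve all
  \<open>f\<close>.

  Betweenness is invariant under reflection of the interval, which is why \<open>l\<close> and
  \<open>r\<close> appear. Several bumps may name the same point, so the points form a linear
  preorder.

  Since \<open>e\<close> is only positive, the evaluations recover \<open>f / e\<close>, and the
  norm of C[0,1] becomes a weighted one. The weight is itself definable: the supremum of the
  evaluations over the unit ball, which is \<open>1 / e\<close> in C[0,1].

  In the converse direction the formulas are read only through their outer shape: \<open>lt\<close>
  is a failure of inclusion between lower sets, and \<open>ge\<close> is a closed lower cut of
  rationals.\<close>

definition computable_fun :: "nat \<Rightarrow> (nat list \<Rightarrow> nat) \<Rightarrow> bool" where
  "computable_fun k f \<longleftrightarrow> (\<exists>F. partrec k F \<and> (\<forall>xs. length xs = k \<longrightarrow> F xs = Some (f xs)))"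

lemma computable_rel_iff:
  "computable_rel k R \<longleftrightarrow> computable_fun k (\<lambda>xs. if R xs then 1 else 0)"
  by (simp add: computable_rel_def computable_fun_def)

lemma computable_fun_cong:
  "computable_fun k f \<Longrightarrow> (\<And>xs. length xs = k \<Longrightarrow> f xs = g xs) \<Longrightarrow> computable_fun k g"
  unfolding computable_fun_def by metis

lemma those_map_Some:
  "(\<And>x. x \<in> set xs \<Longrightarrow> h x = Some (h' x)) \<Longrightarrow> those (map h xs) = Some (map h' xs)"
  by (induction xs) auto

lemma computable_fun_comp:
  assumes f: "computable_fun (length gs) f" and gs: "\<And>g. g \<in> set gs \<Longrightarrow> computable_fun k g"
  shows "computable_fun k (\<lambda>xs. f (map (\<lambda>g. g xs) gs))"
proof -
  obtain F where F: "partrec (length gs) F" "\<And>xs. length xs = length gs \<Longrightarrow> F xs = Some (f xs)"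
    using f by (auto simp: computable_fun_def)
  obtain H where H: "\<And>g. g \<in> set gs \<Longrightarrow> partrec k (H g)"
    "\<And>g xs. g \<in> set gs \<Longrightarrow> length xs = k \<Longrightarrow> H g xs = Some (g xs)"
    using gs unfolding computable_fun_def by metis
  have "partrec k (\<lambda>xs. Option.bind (those (map (\<lambda>g. g xs) (map H gs))) F)"
    using F(1) H(1) by (intro partrec.comp) auto
  moreover have "Option.bind (those (map (\<lambda>g. g xs) (map H gs))) F = Some (f (map (\<lambda>g. g xs) gs))"
    if "length xs = k" for xs
    using those_map_Some[of gs "\<lambda>g. H g xs" "\<lambda>g. g xs"] H(2) F(2) that by (simp add: comp_def)
  ultimately show ?thesis unfolding computable_fun_def by blast
qed

lemma computable_fun_nth: "i < k \<Longrightarrow> computable_fun k (\<lambda>xs. xs ! i)"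
  unfolding computable_fun_def using partrec.proj by blast

lemma computable_fun_Suc_hd: "computable_fun 1 (\<lambda>xs. Suc (hd xs))"
  unfolding computable_fun_def using partrec.succ by blast

lemma computable_fun_zero: "computable_fun k (\<lambda>xs. 0)"
  unfolding computable_fun_def using partrec.zero by blast

lemma computable_fun_prim_rec:
  assumes "computable_fun k f" and "computable_fun (k + 2) g"
  shows "computable_fun (k + 1) (\<lambda>xs. rec_nat (f (tl xs)) (\<lambda>n v. g (n # v # tl xs)) (hd xs))"
proof -
  obtain F where F: "partrec k F" "\<And>xs. length xs = k \<Longrightarrow> F xs = Some (f xs)"
    using assms(1) by (auto simp: computable_fun_def)
  obtain H where H: "partrec (k + 2) H" "\<And>xs. length xs = k + 2 \<Longrightarrow> H xs = Some (g xs)"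
    using assms(2) by (auto simp: computable_fun_def)
  have "rec_nat (F ys) (\<lambda>n r. Option.bind r (\<lambda>v. H (n # v # ys))) m
      = Some (rec_nat (f ys) (\<lambda>n v. g (n # v # ys)) m)" if "length ys = k" for m ys
    using F(2) H(2) that by (induction m) auto
  then have "length xs = k + 1 \<Longrightarrow>
      rec_nat (F (tl xs)) (\<lambda>n r. Option.bind r (\<lambda>v. H (n # v # tl xs))) (hd xs)
      = Some (rec_nat (f (tl xs)) (\<lambda>n v. g (n # v # tl xs)) (hd xs))" for xs
    by simp
  with partrec.prim_rec[OF F(1) H(1)] show ?thesis unfolding computable_fun_def by blast
qed

lemma computable_fun_comp1:
  assumes "computable_fun 1 (\<lambda>xs. f (xs ! 0))" "computable_fun k g"
  shows "computable_fun k (\<lambda>xs. f (g xs))"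
  using computable_fun_comp[of "[g]" "\<lambda>xs. f (xs ! 0)" k] assms by simp

lemma computable_fun_comp2:
  assumes "computable_fun 2 (\<lambda>xs. f (xs ! 0) (xs ! 1))" "computable_fun k g" "computable_fun k h"
  shows "computable_fun k (\<lambda>xs. f (g xs) (h xs))"
  using computable_fun_comp[of "[g, h]" "\<lambda>xs. f (xs ! 0) (xs ! 1)" k] assms
  by (auto simp: numeral_2_eq_2)

lemma computable_fun_Suc: "computable_fun k f \<Longrightarrow> computable_fun k (\<lambda>xs. Suc (f xs))"
  by (rule computable_fun_comp1[where f = Suc])
    (rule computable_fun_cong[OF computable_fun_Suc_hd], auto simp: length_Suc_conv)

lemma computable_fun_const: "computable_fun k (\<lambda>xs. c)"
  by (induction c) (auto intro: computable_fun_zero computable_fun_Suc)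

text \<open>All arithmetic below comes from this scheme: recursion on the value of \<open>h\<close>,
  with the value of \<open>h'\<close> carried along as a parameter.\<close>

lemma computable_fun_recursion2:
  assumes f: "computable_fun 1 (\<lambda>xs. f (xs ! 0))"
    and g: "computable_fun 3 (\<lambda>xs. g (xs ! 0) (xs ! 1) (xs ! 2))"
    and h: "computable_fun k h" and h': "computable_fun k h'"
  shows "computable_fun k (\<lambda>xs. rec_nat (f (h' xs)) (\<lambda>n v. g n v (h' xs)) (h xs))"
proof -
  have "computable_fun (1 + 1)
      (\<lambda>xs. rec_nat (f (tl xs ! 0))
        (\<lambda>n v. g ((n # v # tl xs) ! 0) ((n # v # tl xs) ! 1) ((n # v # tl xs) ! 2)) (hd xs))"
    using computable_fun_prim_rec[OF f, of "\<lambda>xs. g (xs ! 0) (xs ! 1) (xs ! 2)"] g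
    by (simp add: numeral_3_eq_3)
  then have "computable_fun 2 (\<lambda>xs. rec_nat (f (xs ! 1)) (\<lambda>n v. g n v (xs ! 1)) (xs ! 0))"
    unfolding one_add_one
    by (rule computable_fun_cong) (auto simp: numeral_2_eq_2 length_Suc_conv)
  from computable_fun_comp2[OF this h h'] show ?thesis .
qed

lemma computable_fun_add:
  assumes "computable_fun k f" "computable_fun k g"
  shows "computable_fun k (\<lambda>xs. f xs + g xs)"
proof -
  have eq: "rec_nat y (\<lambda>n v. Suc v) x = x + y" for x y :: nat by (induction x) auto
  show ?thesis
    using computable_fun_recursion2[of "\<lambda>y. y" "\<lambda>n v y. Suc v" k f g] assms
    by (simp add: eq computable_fun_nth computable_fun_Suc)
qed

lemma computable_fun_mult:
  assumes "computable_fun k f" "computable_fun k g"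
  shows "computable_fun k (\<lambda>xs. f xs * g xs)"
proof -
  have eq: "rec_nat 0 (\<lambda>n v. v + y) x = x * y" for x y :: nat by (induction x) auto
  show ?thesis
    using computable_fun_recursion2[of "\<lambda>y. 0" "\<lambda>n v y. v + y" k f g] assms
    by (simp add: eq computable_fun_nth computable_fun_add computable_fun_const)
qed

lemma computable_fun_diff:
  assumes "computable_fun k f" "computable_fun k g"
  shows "computable_fun k (\<lambda>xs. f xs - g xs)"
proof -
  have "rec_nat 0 (\<lambda>n v. n) x = x - 1" for x :: nat by (cases x) auto
  then have pred: "computable_fun k f \<Longrightarrow> computable_fun k (\<lambda>xs. f xs - 1)" for k f
    using computable_fun_recursion2[of "\<lambda>y. 0" "\<lambda>n v y. n" k f f]
    by (simp add: computable_fun_nth computable_fun_const)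
  have eq: "rec_nat x (\<lambda>n v. v - 1) y = x - y" for x y :: nat by (induction y) auto
  show ?thesis
    using computable_fun_recursion2[of "\<lambda>y. y" "\<lambda>n v y. v - 1" k g f] assms pred
    by (simp add: eq computable_fun_nth del: One_nat_def)
qed

lemma computable_fun_power2:
  assumes "computable_fun k f"
  shows "computable_fun k (\<lambda>xs. 2 ^ f xs)"
proof -
  have eq: "rec_nat 1 (\<lambda>n v. v + v) x = (2::nat) ^ x" for x :: nat by (induction x) auto
  show ?thesis
    using computable_fun_recursion2[of "\<lambda>y. 1" "\<lambda>n v y. v + v" k f f] assms
    by (simp add: eq[simplified] computable_fun_nth computable_fun_const computable_fun_add)
qed

text \<open>\<open>prod_encode (x, y)\<close> is \<open>triangle (x + y) + x\<close>, so this makes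
  pairing computable.\<close>

lemma computable_fun_triangle:
  assumes "computable_fun k f"
  shows "computable_fun k (\<lambda>xs. triangle (f xs))"
proof -
  have eq: "rec_nat 0 (\<lambda>n v. v + Suc n) x = triangle x" for x :: nat by (induction x) auto
  show ?thesis
    using computable_fun_recursion2[of "\<lambda>y. 0" "\<lambda>n v y. v + Suc n" k f f] assms
    by (simp add: eq[simplified] computable_fun_nth computable_fun_const computable_fun_add
        computable_fun_Suc)
qed

lemma computable_rel_eq:
  assumes "computable_fun k f" "computable_fun k g"
  shows "computable_rel k (\<lambda>xs. f xs = g xs)"
proof -
  \<comment> \<open>Subtraction is truncated: the sum of both differences vanishes exactly when the
    values agree.\<close>
  have "computable_fun k (\<lambda>xs. 1 - ((f xs - g xs) + (g xs - f xs)))"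
    using assms by (intro computable_fun_diff computable_fun_add computable_fun_const)
  then show ?thesis unfolding computable_rel_iff
    by (rule computable_fun_cong) auto
qed

lemma computable_rel_comp:
  assumes f: "computable_rel (length gs) R" and gs: "\<And>g. g \<in> set gs \<Longrightarrow> computable_fun k g"
  shows "computable_rel k (\<lambda>xs. R (map (\<lambda>g. g xs) gs))"
  using computable_fun_comp[OF f[unfolded computable_rel_iff] gs]
  by (simp add: computable_rel_iff)

lemma computable_rel_cong:
  "computable_rel k R \<Longrightarrow> (\<And>xs. length xs = k \<Longrightarrow> R xs = S xs) \<Longrightarrow> computable_rel k S"
  unfolding computable_rel_def by metis

lemma computable_rel_not: "computable_rel k R \<Longrightarrow> computable_rel k (\<lambda>xs. \<not> R xs)"
  unfolding computable_rel_iff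
  by (rule computable_fun_cong[OF computable_fun_diff[OF computable_fun_const[of k 1]]]) auto

lemma computable_rel_conj:
  "computable_rel k R \<Longrightarrow> computable_rel k S \<Longrightarrow> computable_rel k (\<lambda>xs. R xs \<and> S xs)"
  unfolding computable_rel_iff
  by (drule (1) computable_fun_mult, erule computable_fun_cong) simp

section \<open>Quantifier prefixes and prenex form\<close>

lemma alternating_cong:
  assumes "\<And>zs. length zs = n \<Longrightarrow> S (xs @ zs) = S' (xs' @ zs)"
  shows "alternating b n S xs = alternating b n S' xs'"
  using assms
proof (induction n arbitrary: b xs xs')
  case 0
  then show ?case using "0"[of "[]"] by simp
next
  case (Suc n)
  have "alternating c n S (xs @ [y]) = alternating c n S' (xs' @ [y])" for c y
    by (rule Suc.IH) (use Suc.prems in auto)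
  then show ?case by (cases b) auto
qed

lemma alternating_not: "alternating (\<not> b) n (\<lambda>xs. \<not> S xs) xs \<longleftrightarrow> \<not> alternating b n S xs"
proof (induction n arbitrary: b xs)
  case (Suc n)
  then show ?case using Suc[of "\<not> b"] by (cases b) auto
qed simp

lemma alternating_conj_const: "alternating b n (\<lambda>xs. c \<and> S xs) xs \<longleftrightarrow> c \<and> alternating b n S xs"
proof (induction n arbitrary: b xs)
  case (Suc n)
  then show ?case by (cases b) auto
qed simp

text \<open>Length and leading quantifier are left open, so that each connective may lengthen the
  prefix freely; no level of the hierarchy is tracked.\<close>

definition AR :: "nat \<Rightarrow> (nat list \<Rightarrow> bool) \<Rightarrow> bool" where
  "AR k R \<longleftrightarrow> (\<exists>b n S. computable_rel (k + n) S \<and>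
     (\<forall>xs. length xs = k \<longrightarrow> (R xs \<longleftrightarrow> alternating b n S xs)))"

lemma AR_cong: "AR k R \<Longrightarrow> (\<And>xs. length xs = k \<Longrightarrow> R xs = R' xs) \<Longrightarrow> AR k R'"
  unfolding AR_def by metis

lemma AR_computable: "computable_rel k R \<Longrightarrow> AR k R"
  unfolding AR_def by (rule exI[of _ True], rule exI[of _ 0]) auto

lemma AR_not: "AR k R \<Longrightarrow> AR k (\<lambda>xs. \<not> R xs)"
  unfolding AR_def by (metis alternating_not computable_rel_not)

lemma AR_subst:
  assumes R: "AR (length gs) R" and gs: "\<And>g. g \<in> set gs \<Longrightarrow> computable_fun k g"
  shows "AR k (\<lambda>xs. R (map (\<lambda>g. g xs) gs))"
proof -
  obtain b n S where S: "computable_rel (length gs + n) S"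
    and RS: "\<And>xs. length xs = length gs \<Longrightarrow> R xs \<longleftrightarrow> alternating b n S xs"
    using R by (auto simp: AR_def)
  \<comment> \<open>The first \<open>k\<close> entries are the free variables, replaced by the
    values of \<open>gs\<close>; the quantified ones behind them pass through unchanged.\<close>
  define S' where "S' = (\<lambda>ys. S (map (\<lambda>g. g (take k ys)) gs @ drop k ys))"
  define hs where "hs = map (\<lambda>g ys. g (take k ys)) gs @ map (\<lambda>j ys. ys ! (k + j)) [0..<n]"
  have "computable_fun (k + n) (\<lambda>ys. g (take k ys))" if "g \<in> set gs" for g
  proof -
    have "computable_fun (k + n) (\<lambda>ys. g (map (\<lambda>h. h ys) (map (\<lambda>i ys. ys ! i) [0..<k])))"
      using gs[OF that] by (intro computable_fun_comp) (auto intro: computable_fun_nth)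
    then show ?thesis
      by (rule computable_fun_cong) (auto intro!: arg_cong[of _ _ g] nth_equalityI)
  qed
  then have "computable_fun (k + n) h" if "h \<in> set hs" for h
    using that by (auto simp: hs_def intro: computable_fun_nth)
  then have "computable_rel (k + n) (\<lambda>ys. S (map (\<lambda>h. h ys) hs))"
    using S by (intro computable_rel_comp) (auto simp: hs_def)
  then have "computable_rel (k + n) S'"
    by (rule computable_rel_cong)
      (auto simp: S'_def hs_def nth_append intro!: arg_cong[of _ _ S] nth_equalityI)
  moreover have "R (map (\<lambda>g. g xs) gs) \<longleftrightarrow> alternating b n S' xs" if "length xs = k" for xs
    using RS that by (auto simp: S'_def intro!: alternating_cong)
  ultimately show ?thesis unfolding AR_def by blast
qed

lemma AR_reindex:
  assumes "AR (length js) R" and "\<forall>j\<in>set js. j < k"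
  shows "AR k (\<lambda>xs. R (map (\<lambda>j. xs ! j) js))"
  using AR_subst[of "map (\<lambda>j xs. xs ! j) js" R k] assms
  by (auto simp: comp_def intro: computable_fun_nth)

lemma AR_weaken: "AR k R \<Longrightarrow> AR (Suc k) (\<lambda>xs. R (butlast xs))"
  by (rule AR_cong[OF AR_reindex[of "[0..<k]"]])
    (auto intro!: arg_cong[of _ _ R] nth_equalityI simp: nth_butlast)

text \<open>\<open>b\<close> is arbitrary: a prefix that begins with the wrong quantifier is
  preceded by one over a dummy variable.\<close>

lemma AR_outer_quantifier:
  assumes "AR k R"
  obtains n S where "computable_rel (k + n) S"
    "\<And>xs. length xs = k \<Longrightarrow> R xs \<longleftrightarrow> alternating b n S xs"
proof -
  obtain c n S where S: "computable_rel (k + n) S"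
    "\<And>xs. length xs = k \<Longrightarrow> R xs \<longleftrightarrow> alternating c n S xs"
    using assms by (auto simp: AR_def)
  show ?thesis
  proof (cases "c = b")
    case True then show ?thesis using S that by blast
  next
    case False
    \<comment> \<open>Skips entry \<open>k\<close>, which holds the dummy variable.\<close>
    define S' where "S' = (\<lambda>ys. S (take k ys @ drop (Suc k) ys))"
    have "computable_rel (k + Suc n) (\<lambda>ys. S (map (\<lambda>h. h ys)
        (map (\<lambda>i ys. ys ! i) [0..<k] @ map (\<lambda>j ys. ys ! (Suc k + j)) [0..<n])))"
      using S(1) by (intro computable_rel_comp) (auto intro: computable_fun_nth)
    then have "computable_rel (k + Suc n) S'"
      by (rule computable_rel_cong)
        (auto simp: S'_def intro!: arg_cong[of _ _ S] nth_equalityI simp: nth_append)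
    moreover have "R xs \<longleftrightarrow> alternating b (Suc n) S' xs" if "length xs = k" for xs
    proof -
      have "alternating c n S' (xs @ [y]) = alternating c n S xs" for y
        using that by (intro alternating_cong) (auto simp: S'_def)
      then show ?thesis using S(2)[OF that] False by (cases b) auto
    qed
    ultimately show ?thesis using that by blast
  qed
qed

text \<open>Prefixes alternate strictly, hence the old one is first made to begin with a universal
  quantifier.\<close>

lemma AR_ex:
  assumes "AR (Suc k) R"
  shows "AR k (\<lambda>xs. \<exists>y. R (xs @ [y]))"
proof -
  obtain n S where "computable_rel (Suc k + n) S"
    "\<And>xs. length xs = Suc k \<Longrightarrow> R xs \<longleftrightarrow> alternating False n S xs"
    using AR_outer_quantifier[OF assms] by blast
  then show ?thesis unfolding AR_def
    by (intro exI[of _ True] exI[of _ "Suc n"] exI[of _ S]) auto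
qed

lemma AR_all: "AR (Suc k) R \<Longrightarrow> AR k (\<lambda>xs. \<forall>y. R (xs @ [y]))"
  using AR_not[OF AR_ex[OF AR_not]] by simp

lemma AR_conj_computable:
  assumes "computable_rel k R" "AR k R'"
  shows "AR k (\<lambda>xs. R xs \<and> R' xs)"
proof -
  obtain b n S where S: "computable_rel (k + n) S"
    "\<And>xs. length xs = k \<Longrightarrow> R' xs \<longleftrightarrow> alternating b n S xs"
    using assms by (auto simp: AR_def)
  have "computable_rel (k + n) (\<lambda>ys. R (map (\<lambda>h. h ys) (map (\<lambda>i ys. ys ! i) [0..<k])))"
    using assms(1) by (intro computable_rel_comp) (auto intro: computable_fun_nth)
  then have "computable_rel (k + n) (\<lambda>ys. R (take k ys))"
    by (rule computable_rel_cong) (auto intro!: arg_cong[of _ _ R] nth_equalityI)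
  then have "computable_rel (k + n) (\<lambda>ys. R (take k ys) \<and> S ys)"
    using S(1) by (rule computable_rel_conj)
  moreover have "R xs \<and> R' xs \<longleftrightarrow> alternating b n (\<lambda>ys. R (take k ys) \<and> S ys) xs"
    if "length xs = k" for xs
    unfolding S(2)[OF that] alternating_conj_const[symmetric]
    using that by (intro alternating_cong) auto
  ultimately show ?thesis unfolding AR_def by blast
qed

lemma AR_conj:
  assumes "AR k R" "AR k R'"
  shows "AR k (\<lambda>xs. R xs \<and> R' xs)"
proof -
  \<comment> \<open>The quantifiers of the first conjunct move out one by one. Each adds a last
    variable, which the second conjunct ignores, so \<open>R'\<close> and \<open>k\<close> vary in
    the induction; once none are left, the first conjunct is computable.\<close>
  have prenex: "AR k (\<lambda>xs. alternating b n S xs \<and> R' xs)" if "computable_rel (k + n) S" "AR k R'"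
    for b n S k R'
    using that
  proof (induction n arbitrary: b k R')
    case 0
    then show ?case using AR_conj_computable by simp
  next
    case (Suc n)
    have *: "AR (Suc k) (\<lambda>xs. alternating (\<not> b) n S xs \<and> R' (butlast xs))"
      using Suc.prems AR_weaken by (intro Suc.IH) auto
    show ?case
      using AR_ex[OF *] AR_all[OF *] by (cases b) auto
  qed
  obtain b n S where S: "computable_rel (k + n) S"
    "\<And>xs. length xs = k \<Longrightarrow> R xs \<longleftrightarrow> alternating b n S xs"
    using assms(1) by (auto simp: AR_def)
  from prenex[OF S(1) assms(2)] show ?thesis
    by (rule AR_cong) (simp add: S(2))
qed

section \<open>Predicates and functions of one coded argument\<close>

definition p1 :: "nat \<Rightarrow> nat" where "p1 z = fst (prod_decode z)"
definition p2 :: "nat \<Rightarrow> nat" where "p2 z = snd (prod_decode z)"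
definition pr :: "nat \<Rightarrow> nat \<Rightarrow> nat" where "pr x y = prod_encode (x, y)"

lemma p1_pr [simp]: "p1 (pr x y) = x" and p2_pr [simp]: "p2 (pr x y) = y"
  and pr_p1_p2 [simp]: "pr (p1 z) (p2 z) = z"
  by (simp_all add: p1_def p2_def pr_def)

lemma computable_fun_pr:
  "computable_fun k f \<Longrightarrow> computable_fun k g \<Longrightarrow> computable_fun k (\<lambda>xs. pr (f xs) (g xs))"
  by (simp add: pr_def prod_encode_def computable_fun_add computable_fun_triangle)

text \<open>One variable stands for a whole context coded by \<open>pr\<close>. A quantifier pairs
  the context with its variable: below it \<open>p1\<close> retrieves the old context and
  \<open>p2\<close> the bound variable, so nested projections act like de Bruijn indices.\<close>

definition Ar :: "(nat \<Rightarrow> bool) \<Rightarrow> bool" where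
  "Ar P \<longleftrightarrow> AR 1 (\<lambda>xs. P (xs ! 0))"

text \<open>Only the graph has to be arithmetical. This admits functions that are not computable,
  such as \<open>the\<close> applied to the values of a partial one.\<close>

definition ArF :: "(nat \<Rightarrow> nat) \<Rightarrow> bool" where
  "ArF f \<longleftrightarrow> AR 2 (\<lambda>xs. f (xs ! 0) = xs ! 1)"

lemma arithmetical_if_Ar:
  assumes "Ar (\<lambda>i. i \<in> A)"
  shows "arithmetical A"
proof -
  obtain b n S where "computable_rel (1 + n) S"
    "\<And>xs. length xs = 1 \<Longrightarrow> xs ! 0 \<in> A \<longleftrightarrow> alternating b n S xs"
    using assms by (auto simp: Ar_def AR_def)
  then have "computable_rel (Suc n) S" "\<And>x. x \<in> A \<longleftrightarrow> alternating b n S [x]"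
    by (auto dest: meta_spec[of _ "[_]"])
  then show ?thesis
    unfolding arithmetical_def Sigma_set_def Pi_set_def
    by (intro exI[of _ n]) (cases b; auto)
qed

lemma AR_exI:
  "AR (Suc k) R \<Longrightarrow> (\<And>xs. length xs = k \<Longrightarrow> R' xs \<longleftrightarrow> (\<exists>y. R (xs @ [y]))) \<Longrightarrow> AR k R'"
  by (rule AR_cong[OF AR_ex]) auto

lemma Ar_of_pair:
  assumes "Ar (\<lambda>z. P (p1 z) (p2 z))"
  shows "AR 2 (\<lambda>xs. P (xs ! 0) (xs ! 1))"
  using AR_subst[of "[\<lambda>xs. pr (xs ! 0) (xs ! 1)]" "\<lambda>xs. P (p1 (xs ! 0)) (p2 (xs ! 0))" 2] assms
  by (simp add: Ar_def computable_fun_pr computable_fun_nth)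

lemma ArF_graphI: "Ar (\<lambda>z. f (p1 z) = p2 z) \<Longrightarrow> ArF f"
  unfolding ArF_def by (rule Ar_of_pair)

lemma Ar_not: "Ar P \<Longrightarrow> Ar (\<lambda>z. \<not> P z)"
  unfolding Ar_def by (rule AR_not)

lemma Ar_conj: "Ar P \<Longrightarrow> Ar P' \<Longrightarrow> Ar (\<lambda>z. P z \<and> P' z)"
  unfolding Ar_def by (rule AR_conj)

lemma Ar_disj: "Ar P \<Longrightarrow> Ar P' \<Longrightarrow> Ar (\<lambda>z. P z \<or> P' z)"
  using Ar_not[OF Ar_conj[OF Ar_not Ar_not], of P P'] by simp

lemma Ar_imp: "Ar P \<Longrightarrow> Ar P' \<Longrightarrow> Ar (\<lambda>z. P z \<longrightarrow> P' z)"
  unfolding imp_conv_disj by (intro Ar_disj Ar_not)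

lemma Ar_iff:
  assumes "Ar P" "Ar P'"
  shows "Ar (\<lambda>z. P z \<longleftrightarrow> P' z)"
proof -
  have "(\<lambda>z. P z \<longleftrightarrow> P' z) = (\<lambda>z. (P z \<longrightarrow> P' z) \<and> (P' z \<longrightarrow> P z))" by blast
  with assms show ?thesis by (metis Ar_conj Ar_imp)
qed

lemma Ar_ex:
  assumes "Ar (\<lambda>z. P (p1 z) (p2 z))"
  shows "Ar (\<lambda>x. \<exists>y. P x y)"
proof -
  have "AR (Suc 1) (\<lambda>xs. P (xs ! 0) (xs ! 1))"
    using Ar_of_pair[of P] assms by (simp add: numeral_2_eq_2)
  then show ?thesis unfolding Ar_def
    by (rule AR_exI) (auto simp: length_Suc_conv)
qed

lemma Ar_all: "Ar (\<lambda>z. P (p1 z) (p2 z)) \<Longrightarrow> Ar (\<lambda>x. \<forall>y. P x y)"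
  using Ar_not[OF Ar_ex[OF Ar_not], of P] by simp

lemma Ar_ball: "Ar (\<lambda>z. p2 z \<in> S (p1 z)) \<Longrightarrow> Ar (\<lambda>z. P (p1 z) (p2 z)) \<Longrightarrow> Ar (\<lambda>x. \<forall>y\<in>S x. P x y)"
  unfolding Ball_def by (intro Ar_all Ar_imp)

lemma Ar_bex: "Ar (\<lambda>z. p2 z \<in> S (p1 z)) \<Longrightarrow> Ar (\<lambda>z. P (p1 z) (p2 z)) \<Longrightarrow> Ar (\<lambda>x. \<exists>y\<in>S x. P x y)"
  unfolding Bex_def by (intro Ar_ex Ar_conj)

text \<open>The values of \<open>f\<close> and \<open>g\<close> are eliminated by quantifying
  existentially over candidates for them.\<close>

lemma Ar_rel2:
  assumes R: "AR 2 (\<lambda>xs. R (xs ! 0) (xs ! 1))" and f: "ArF f" and g: "ArF g"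
  shows "Ar (\<lambda>z. R (f z) (g z))"
proof -
  have "AR 3 (\<lambda>xs. f (xs ! 0) = xs ! 1)"
    using AR_reindex[of "[0, 1]" "\<lambda>xs. f (xs ! 0) = xs ! 1" 3] f
    by (simp add: numeral_2_eq_2 ArF_def)
  moreover have "AR 3 (\<lambda>xs. g (xs ! 0) = xs ! 2)"
    using AR_reindex[of "[0, 2]" "\<lambda>xs. g (xs ! 0) = xs ! 1" 3] g
    by (simp add: numeral_2_eq_2 ArF_def)
  moreover have "AR 3 (\<lambda>xs. R (xs ! 1) (xs ! 2))"
    using AR_reindex[of "[1, 2]" "\<lambda>xs. R (xs ! 0) (xs ! 1)" 3] R by (simp add: numeral_2_eq_2)
  ultimately have "AR (Suc 2) (\<lambda>xs. f (xs ! 0) = xs ! 1 \<and> g (xs ! 0) = xs ! 2 \<and> R (xs ! 1) (xs ! 2))"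
    using AR_conj by simp
  then have "AR (Suc 1) (\<lambda>xs. \<exists>y. f (xs ! 0) = xs ! 1 \<and> g (xs ! 0) = y \<and> R (xs ! 1) y)"
    unfolding Suc_1 by (rule AR_exI) (auto simp: numeral_2_eq_2 length_Suc_conv nth_append)
  then show ?thesis unfolding Ar_def
    by (rule AR_exI) (auto simp: length_Suc_conv)
qed

lemma ArF_op2:
  assumes h: "computable_fun 2 (\<lambda>xs. h (xs ! 0) (xs ! 1))" and f: "ArF f" and g: "ArF g"
  shows "ArF (\<lambda>z. h (f z) (g z))"
proof -
  have "AR 4 (\<lambda>xs. f (xs ! 0) = xs ! 2)"
    using AR_reindex[of "[0, 2]" "\<lambda>xs. f (xs ! 0) = xs ! 1" 4] f
    by (simp add: numeral_2_eq_2 ArF_def)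
  moreover have "AR 4 (\<lambda>xs. g (xs ! 0) = xs ! 3)"
    using AR_reindex[of "[0, 3]" "\<lambda>xs. g (xs ! 0) = xs ! 1" 4] g
    by (simp add: numeral_2_eq_2 ArF_def)
  moreover have "AR 4 (\<lambda>xs. h (xs ! 2) (xs ! 3) = xs ! 1)"
    by (intro AR_computable computable_rel_eq computable_fun_nth computable_fun_comp2[OF h]) auto
  ultimately have "AR (Suc 3)
      (\<lambda>xs. f (xs ! 0) = xs ! 2 \<and> g (xs ! 0) = xs ! 3 \<and> h (xs ! 2) (xs ! 3) = xs ! 1)"
    using AR_conj by simp
  then have "AR 3 (\<lambda>xs. \<exists>y. f (xs ! 0) = xs ! 2 \<and> g (xs ! 0) = y \<and> h (xs ! 2) y = xs ! 1)"
    by (rule AR_exI) (auto simp: eval_nat_numeral length_Suc_conv)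
  then have "AR (Suc 2) (\<lambda>xs. \<exists>y. f (xs ! 0) = xs ! 2 \<and> g (xs ! 0) = y \<and> h (xs ! 2) y = xs ! 1)"
    by simp
  then show ?thesis unfolding ArF_def
    by (rule AR_exI) (auto simp: length_Suc_conv numeral_2_eq_2)
qed

lemma ArF_id: "ArF (\<lambda>z. z)"
  unfolding ArF_def by (intro AR_computable computable_rel_eq computable_fun_nth) auto

lemma ArF_computable: "computable_fun 1 (\<lambda>xs. h (xs ! 0)) \<Longrightarrow> ArF f \<Longrightarrow> ArF (\<lambda>z. h (f z))"
  by (rule ArF_op2[of "\<lambda>x y. h x" f f])
    (auto intro!: computable_fun_comp1[of h "2::nat" "\<lambda>xs. xs ! 0", simplified] computable_fun_nth)

lemma ArF_const: "ArF (\<lambda>z. c)"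
  by (rule ArF_computable[OF _ ArF_id]) (rule computable_fun_const)

lemma ArF_Suc: "ArF f \<Longrightarrow> ArF (\<lambda>z. Suc (f z))"
  by (rule ArF_computable) (auto intro: computable_fun_Suc computable_fun_nth)

lemma ArF_power2: "ArF f \<Longrightarrow> ArF (\<lambda>z. 2 ^ f z)"
  by (rule ArF_computable) (auto intro: computable_fun_power2 computable_fun_nth)

lemma ArF_add: "ArF f \<Longrightarrow> ArF g \<Longrightarrow> ArF (\<lambda>z. f z + g z)"
  by (rule ArF_op2[of "(+)"]) (simp_all add: computable_fun_add computable_fun_nth)

lemma ArF_mult: "ArF f \<Longrightarrow> ArF g \<Longrightarrow> ArF (\<lambda>z. f z * g z)"
  by (rule ArF_op2[of "(*)"]) (simp_all add: computable_fun_mult computable_fun_nth)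

lemma ArF_diff: "ArF f \<Longrightarrow> ArF g \<Longrightarrow> ArF (\<lambda>z. f z - g z)"
  by (rule ArF_op2[of "(-)"]) (simp_all add: computable_fun_diff computable_fun_nth)

lemma ArF_pr: "ArF f \<Longrightarrow> ArF g \<Longrightarrow> ArF (\<lambda>z. pr (f z) (g z))"
  by (rule ArF_op2[of "pr"]) (simp_all add: computable_fun_pr computable_fun_nth)

lemma Ar_eq: "ArF f \<Longrightarrow> ArF g \<Longrightarrow> Ar (\<lambda>z. f z = g z)"
  by (rule Ar_rel2) (auto intro!: AR_computable computable_rel_eq computable_fun_nth)

lemma Ar_subst: "Ar Q \<Longrightarrow> ArF f \<Longrightarrow> Ar (\<lambda>z. Q (f z))"
  by (rule Ar_rel2[of "\<lambda>x y. Q x" f f])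
    (use AR_reindex[of "[0]" "\<lambda>xs. Q (xs ! 0)" 2] in \<open>auto simp: Ar_def\<close>)

lemma ArF_comp: "ArF f \<Longrightarrow> ArF g \<Longrightarrow> ArF (\<lambda>z. f (g z))"
proof -
  assume f: "ArF f" and g: "ArF g"
  have "AR (Suc 2) (\<lambda>xs. f (xs ! 2) = xs ! 1 \<and> g (xs ! 0) = xs ! 2)"
    using AR_conj[of 3, OF AR_reindex[of "[2, 1]" "\<lambda>xs. f (xs ! 0) = xs ! 1" 3]
        AR_reindex[of "[0, 2]" "\<lambda>xs. g (xs ! 0) = xs ! 1" 3]] f g
    by (simp add: ArF_def numeral_2_eq_2 numeral_3_eq_3)
  then show ?thesis unfolding ArF_def
    by (rule AR_exI) (auto simp: length_Suc_conv numeral_2_eq_2)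
qed

text \<open>Decoding gets an arithmetical graph from the computability of encoding: the other
  component is quantified away.\<close>

lemma p1_eq_iff: "p1 z = x \<longleftrightarrow> (\<exists>y. z = pr x y)" and p2_eq_iff: "p2 z = y \<longleftrightarrow> (\<exists>x. z = pr x y)"
  by (metis p1_pr p2_pr pr_p1_p2)+

lemma ArF_p1': "ArF p1" and ArF_p2': "ArF p2"
proof -
  have "AR (Suc 2) (\<lambda>xs. xs ! 0 = pr (xs ! 1) (xs ! 2))"
    by (auto intro!: AR_computable computable_rel_eq computable_fun_pr computable_fun_nth)
  then show "ArF p1" unfolding ArF_def
    by (rule AR_exI) (auto simp: length_Suc_conv numeral_2_eq_2 p1_eq_iff)
  have "AR (Suc 2) (\<lambda>xs. xs ! 0 = pr (xs ! 2) (xs ! 1))"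
    by (auto intro!: AR_computable computable_rel_eq computable_fun_pr computable_fun_nth)
  then show "ArF p2" unfolding ArF_def
    by (rule AR_exI) (auto simp: length_Suc_conv numeral_2_eq_2 p2_eq_iff)
qed

lemmas ArF_p1 = ArF_comp[OF ArF_p1'] and ArF_p2 = ArF_comp[OF ArF_p2']

named_theorems ar

lemmas [ar] = ArF_id ArF_const ArF_Suc ArF_power2 ArF_add ArF_mult ArF_diff ArF_pr ArF_p1 ArF_p2
  ArF_p1' ArF_p2' Ar_eq Ar_not Ar_conj Ar_disj Ar_imp Ar_iff Ar_ex Ar_all Ar_ball Ar_bex

lemma Ar_le [ar]: 
  assumes "ArF f" "ArF g" shows "Ar (\<lambda>z. f z \<le> g z)"
proof -
  have "Ar (\<lambda>z. f z - g z = 0)" using assms by (intro ar)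
  then show ?thesis by simp
qed

lemma Ar_less [ar]: "ArF f \<Longrightarrow> ArF g \<Longrightarrow> Ar (\<lambda>z. f z < g z)"
  unfolding Suc_le_eq[symmetric] by (intro ar)

lemma ArF_mod [ar]:
  assumes "ArF f" "ArF g" shows "ArF (\<lambda>z. f z mod g z)"
proof (rule ArF_graphI)
  \<comment> \<open>The disjunct \<open>b = 0\<close> covers the convention that
    \<open>a mod 0\<close> is \<open>a\<close>.\<close>
  have eq: "a mod b = v \<longleftrightarrow> (\<exists>q. a = b * q + v) \<and> (v < b \<or> b = 0)" for a b v :: nat
  proof
    assume "a mod b = v"
    then show "(\<exists>q. a = b * q + v) \<and> (v < b \<or> b = 0)"
      using mult_div_mod_eq[of b a] by (intro conjI exI[of _ "a div b"]) auto
  qed auto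
  have "ArF (\<lambda>z. f (p1 z))" "ArF (\<lambda>z. g (p1 z))"
    using ArF_comp ArF_p1' assms by auto
  then have *: "ArF (\<lambda>z. f (p1 z))" "ArF (\<lambda>z. g (p1 z))" "ArF (\<lambda>z. f (p1 (p1 z)))" "ArF (\<lambda>z. g (p1 (p1 z)))"
    using ArF_comp[OF _ ArF_p1'] by auto
  show "Ar (\<lambda>z. f (p1 z) mod g (p1 z) = p2 z)"
    unfolding eq by (intro ar *)
qed

lemma ArF_div [ar]:
  assumes "ArF f" "ArF g" shows "ArF (\<lambda>z. f z div g z)"
proof (rule ArF_graphI)
  have eq: "a div b = v \<longleftrightarrow> (if b = 0 then v = 0 else b * v \<le> a \<and> a < b * Suc v)" for a b v :: nat
    by (auto intro: div_nat_eqI dividend_less_times_div)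
  have *: "ArF (\<lambda>z. f (p1 z))" "ArF (\<lambda>z. g (p1 z))"
    using ArF_comp ArF_p1' assms by auto
  show "Ar (\<lambda>z. f (p1 z) div g (p1 z) = p2 z)"
    unfolding eq if_bool_eq_conj by (intro ar *)
qed

text \<open>The bound is a fixed number, so the predicates may vary with \<open>i\<close> without
  any uniformity; this serves the finitely many components of a composition.\<close>

lemma Ar_all_less_const:
  fixes n :: nat
  assumes "\<And>i. i < n \<Longrightarrow> Ar (P i)"
  shows "Ar (\<lambda>z. \<forall>i<n. P i z)"
  using assms
proof (induction n)
  case 0
  have "Ar (\<lambda>z. z = z)" by (intro ar)
  then show ?case by simp
next
  case (Suc n)
  then have "Ar (\<lambda>z. P n z \<and> (\<forall>i<n. P i z))" by (intro Ar_conj) auto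
  then show ?case by (simp add: All_less_Suc)
qed

section \<open>Goedel's beta function and graphs of partial recursive functions\<close>

definition goedel_beta :: "nat \<Rightarrow> nat \<Rightarrow> nat" where
  "goedel_beta w i = p1 w mod (1 + Suc i * p2 w)"

lemma ArF_goedel_beta [ar]: "ArF f \<Longrightarrow> ArF g \<Longrightarrow> ArF (\<lambda>z. goedel_beta (f z) (g z))"
  unfolding goedel_beta_def by (intro ar)

lemma goedel_beta_exists: "\<exists>w. \<forall>i\<le>n. goedel_beta w i = s i"
proof -
  \<comment> \<open>\<open>M\<close> bounds the index differences and exceeds all values: the
    differences divide \<open>fact M\<close>, and every modulus exceeds every value, so that
    remainders return the values themselves.\<close>
  define M where "M = Suc n + (\<Sum>i\<le>n. s i)"
  define d where "d = (fact M :: nat)"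
  define m where "m = (\<lambda>i. 1 + Suc i * d)"
  \<comment> \<open>\<open>m i\<close> is coprime to \<open>d\<close>, hence to the divisor
    \<open>j - i\<close> of \<open>d\<close>, hence to the difference \<open>(j - i) * d\<close> of
    the two moduli.\<close>
  have copr: "coprime (m i) (m j)" if "i < j" "j \<le> n" for i j
  proof -
    have "j - i \<le> M" "0 < j - i" using that by (auto simp: M_def)
    then have "(j - i) dvd d" unfolding d_def by (intro dvd_fact) auto
    have cd: "coprime (m i) d"
      using gcd_add_mult[of d "Suc i" 1] unfolding m_def coprime_iff_gcd_eq_1
      by (simp only: add.commute gcd.commute gcd_1_nat gcd_Suc_0 One_nat_def)
    then have "coprime (m i) (j - i)"
      using \<open>(j - i) dvd d\<close> by (meson coprime_divisors dvd_refl)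
    with cd have "coprime (m i) ((j - i) * d)"
      by simp
    moreover have "m j = m i + (j - i) * d"
      using that by (auto simp: m_def algebra_simps diff_mult_distrib2)
    ultimately show ?thesis by (metis coprime_iff_gcd_eq_1 gcd_add2)
  qed
  have "\<exists>x. \<forall>i\<in>{..n}. [x = s i] (mod m i)"
  proof (rule chinese_remainder_nat)
    show "\<forall>i\<in>{..n}. \<forall>j\<in>{..n}. i \<noteq> j \<longrightarrow> coprime (m i) (m j)"
      using copr by (metis atMost_iff coprime_commute linorder_neqE_nat)
  qed auto
  then obtain x where x: "\<And>i. i \<le> n \<Longrightarrow> [x = s i] (mod m i)" by auto
  have "goedel_beta (pr x d) i = s i" if "i \<le> n" for i
  proof -
    have "s i \<le> (\<Sum>i\<le>n. s i)" using that by (intro member_le_sum) auto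
    then have "s i < M" by (simp add: M_def)
    also have "M \<le> d" unfolding d_def by (rule fact_ge_self)
    also have "d \<le> m i" by (simp add: m_def)
    finally have "s i < m i" .
    with x[OF that] show ?thesis by (simp add: goedel_beta_def m_def cong_def)
  qed
  then show ?thesis by blast
qed

lemma those_eq_Some_iff:
  "those xs = Some ys \<longleftrightarrow> length ys = length xs \<and> (\<forall>i<length xs. xs ! i = Some (ys ! i))"
proof (induction xs arbitrary: ys)
  case (Cons x xs)
  show ?case
  proof (cases ys)
    case (Cons y zs)
    then show ?thesis using Cons.IH[of zs]
      by (auto split: option.splits simp: All_less_Suc2)
  qed (auto split: option.splits)
qed auto

text \<open>Arguments and value are arbitrary arithmetical functions of a context, so that the
  induction hypotheses apply below the quantifiers that each clause introduces.\<close>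

lemma Ar_partrec_graph:
  assumes "partrec k F" "length hs = k" "\<And>h. h \<in> set hs \<Longrightarrow> ArF h" "ArF v"
  shows "Ar (\<lambda>z. F (map (\<lambda>h. h z) hs) = Some (v z))"
  using assms
proof (induction arbitrary: hs v rule: partrec.induct)
  case (zero k)
  then show ?case by (auto intro: ar)
next
  case succ
  then obtain h where "hs = [h]" by (auto simp: length_Suc_conv)
  then show ?case using succ by (auto intro!: ar)
next
  case (proj i k)
  then have "ArF (hs ! i)" by auto
  then show ?case using proj by (auto intro!: ar)
next
  case (comp gs f k)
  define n where "n = length gs"
  \<comment> \<open>The intermediate values form a tuple, which a single \<open>w\<close>
    codes.\<close>
  have *: "Option.bind (those (map (\<lambda>g. g xs) gs)) f = Some y \<longleftrightarrow>
    (\<exists>w. (\<forall>i<n. (gs ! i) xs = Some (goedel_beta w i)) \<and> f (map (goedel_beta w) [0..<n]) = Some y)" for xs y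
  proof
    assume "Option.bind (those (map (\<lambda>g. g xs) gs)) f = Some y"
    then obtain ys where ys: "length ys = n" "\<forall>i<n. (gs ! i) xs = Some (ys ! i)" "f ys = Some y"
      by (auto simp: bind_eq_Some_conv those_eq_Some_iff n_def)
    obtain w where "\<forall>i\<le>n. goedel_beta w i = ys ! i" using goedel_beta_exists by metis
    moreover from this have "map (goedel_beta w) [0..<n] = ys"
      using ys(1) by (auto intro!: nth_equalityI)
    ultimately show "\<exists>w. (\<forall>i<n. (gs ! i) xs = Some (goedel_beta w i)) \<and> f (map (goedel_beta w) [0..<n]) = Some y"
      using ys by (intro exI[of _ w]) auto
  next
    assume "\<exists>w. (\<forall>i<n. (gs ! i) xs = Some (goedel_beta w i)) \<and> f (map (goedel_beta w) [0..<n]) = Some y"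
    then obtain w where w: "\<forall>i<n. (gs ! i) xs = Some (goedel_beta w i)" "f (map (goedel_beta w) [0..<n]) = Some y"
      by blast
    then have "those (map (\<lambda>g. g xs) gs) = Some (map (goedel_beta w) [0..<n])"
      by (auto simp: those_eq_Some_iff n_def)
    with w show "Option.bind (those (map (\<lambda>g. g xs) gs)) f = Some y" by simp
  qed
  have hs: "ArF (\<lambda>z. h (p1 z))" if "h \<in> set hs" for h
    using comp.prems(2)[OF that] ArF_comp ArF_p1' by blast
  have v: "ArF (\<lambda>z. v (p1 z))" using comp.prems(3) ArF_comp ArF_p1' by blast
  have "Ar (\<lambda>z. (gs ! i) (map (\<lambda>h. h (p1 z)) hs) = Some (goedel_beta (p2 z) i))" if "i < n" for i
  proof -
    have "gs ! i \<in> set gs" using that by (simp add: n_def)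
    then have IH: "length hs' = k \<Longrightarrow> (\<And>h. h \<in> set hs' \<Longrightarrow> ArF h) \<Longrightarrow> ArF v' \<Longrightarrow>
        Ar (\<lambda>z. (gs ! i) (map (\<lambda>h. h z) hs') = Some (v' z))" for hs' v'
      using comp.IH(2) by blast
    have "Ar (\<lambda>z. (gs ! i) (map (\<lambda>h. h z) (map (\<lambda>h z. h (p1 z)) hs)) = Some (goedel_beta (p2 z) i))"
      using comp.prems(1) hs by (intro IH ar) auto
    then show ?thesis by (simp add: comp_def)
  qed
  moreover have "Ar (\<lambda>z. f (map (\<lambda>h. h z) (map (\<lambda>i z. goedel_beta (p2 z) i) [0..<n])) = Some (v (p1 z)))"
    by (rule comp.IH(1)) (auto simp: n_def intro!: ar v)
  then have "Ar (\<lambda>z. f (map (goedel_beta (p2 z)) [0..<n]) = Some (v (p1 z)))"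
    by (simp add: comp_def)
  ultimately show ?case
    unfolding * by (intro Ar_ex Ar_conj Ar_all_less_const) auto
next
  case (prim_rec k f g)
  then obtain h0 hs' where hs: "hs = h0 # hs'" "length hs' = k" by (cases hs) auto
  \<comment> \<open>A single \<open>w\<close> codes the whole course of values up to
    \<open>m\<close>.\<close>
  have rec: "rec_nat r0 (\<lambda>n r. Option.bind r (step n)) m = Some y \<longleftrightarrow>
     (\<exists>w. r0 = Some (goedel_beta w 0) \<and> (\<forall>n<m. step n (goedel_beta w n) = Some (goedel_beta w (Suc n))) \<and> goedel_beta w m = y)"
    for r0 step m and y :: nat
  proof
    let ?r = "rec_nat r0 (\<lambda>n r. Option.bind r (step n))"
    assume y: "?r m = Some y"
    \<comment> \<open>The recursion is strict: once undefined it stays undefined, so a value at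
      \<open>m\<close> forces all earlier ones to exist.\<close>
    have down: "?r n \<noteq> None" if "n \<le> m" for n
      using that
    proof (induction n rule: inc_induct)
      case base then show ?case using y by simp
    next
      case (step n) then show ?case by (cases "?r n") auto
    qed
    obtain w where w: "\<And>n. n \<le> m \<Longrightarrow> goedel_beta w n = the (?r n)"
      using goedel_beta_exists[of m "\<lambda>n. the (?r n)"] by blast
    have 1: "?r n = Some (goedel_beta w n)" if "n \<le> m" for n using w[OF that] down[OF that] by simp
    have "step n (goedel_beta w n) = Some (goedel_beta w (Suc n))" if "n < m" for n
      using 1[of n] 1[of "Suc n"] that by simp
    then show "\<exists>w. r0 = Some (goedel_beta w 0) \<and> (\<forall>n<m. step n (goedel_beta w n) = Some (goedel_beta w (Suc n))) \<and> goedel_beta w m = y"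
      using 1[of 0] 1[of m] y by (intro exI[of _ w]) auto
  next
    assume "\<exists>w. r0 = Some (goedel_beta w 0) \<and> (\<forall>n<m. step n (goedel_beta w n) = Some (goedel_beta w (Suc n))) \<and> goedel_beta w m = y"
    then obtain w where w: "r0 = Some (goedel_beta w 0)" "\<And>n. n < m \<Longrightarrow> step n (goedel_beta w n) = Some (goedel_beta w (Suc n))"
      "goedel_beta w m = y" by blast
    have "n \<le> m \<Longrightarrow> rec_nat r0 (\<lambda>n r. Option.bind r (step n)) n = Some (goedel_beta w n)" for n
      by (induction n) (auto simp: w)
    then show "rec_nat r0 (\<lambda>n r. Option.bind r (step n)) m = Some y" using w by simp
  qed
  have hs'1: "ArF (\<lambda>z. h (p1 z))" if "h \<in> set hs" for h
    using prim_rec.prems(2)[OF that] ArF_comp ArF_p1' by blast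
  have hs'2: "ArF (\<lambda>z. h (p1 (p1 z)))" if "h \<in> set hs" for h
    using ArF_comp[OF hs'1[OF that] ArF_p1'] .
  have v: "ArF (\<lambda>z. v (p1 z))" using prim_rec.prems(3) ArF_comp ArF_p1' by blast
  have h0: "ArF (\<lambda>z. h0 (p1 z))" "ArF (\<lambda>z. h0 (p1 (p1 z)))" using hs'1 hs'2 hs by auto
  have "Ar (\<lambda>z. f (map (\<lambda>h. h z) (map (\<lambda>h z. h (p1 z)) hs')) = Some (goedel_beta (p2 z) 0))"
    by (rule prim_rec.IH) (auto simp: hs intro!: ar hs'1)
  then have f: "Ar (\<lambda>z. f (map (\<lambda>h. h (p1 z)) hs') = Some (goedel_beta (p2 z) 0))"
    by (simp add: comp_def)
  have "Ar (\<lambda>z. g (map (\<lambda>h. h z) ([p2, \<lambda>z. goedel_beta (p2 (p1 z)) (p2 z)] @ map (\<lambda>h z. h (p1 (p1 z))) hs'))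
      = Some (goedel_beta (p2 (p1 z)) (Suc (p2 z))))"
    by (rule prim_rec.IH) (auto simp: hs intro!: ar hs'2)
  then have g: "Ar (\<lambda>z. g (p2 z # goedel_beta (p2 (p1 z)) (p2 z) # map (\<lambda>h. h (p1 (p1 z))) hs')
      = Some (goedel_beta (p2 (p1 z)) (Suc (p2 z))))"
    by (simp add: comp_def)
  show ?case
    unfolding hs list.map list.sel rec by (intro ar f g v h0)
next
  case (minim k f)
  \<comment> \<open>Being defined below some zero \<open>n\<close> includes being defined below the
    least zero, so it is enough to describe the least zero.\<close>
  have *: "(if \<exists>n. f (n # xs) = Some 0 \<and> (\<forall>m<n. f (m # xs) \<noteq> None)
      then Some (LEAST n. f (n # xs) = Some 0) else None) = Some y \<longleftrightarrow>
    f (y # xs) = Some 0 \<and> (\<forall>m<y. \<exists>u. f (m # xs) = Some u \<and> u \<noteq> 0)" (is "?L \<longleftrightarrow> ?R") for xs y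
  proof
    assume ?L
    then obtain n where n: "f (n # xs) = Some 0" "\<forall>m<n. f (m # xs) \<noteq> None"
      and y: "y = (LEAST n. f (n # xs) = Some 0)" by (auto split: if_splits)
    have "y \<le> n" unfolding y using n(1) by (rule Least_le)
    moreover have "f (y # xs) = Some 0" unfolding y using n(1) by (rule LeastI)
    moreover have "f (m # xs) \<noteq> Some 0" if "m < y" for m using that not_less_Least unfolding y by blast
    ultimately show ?R using n(2)
      by (metis less_le_trans option.exhaust)
  next
    assume R: ?R
    then have "(LEAST n. f (n # xs) = Some 0) = y"
      by (intro Least_equality) (blast, metis linorder_not_less option.inject)
    moreover have "\<exists>n. f (n # xs) = Some 0 \<and> (\<forall>m<n. f (m # xs) \<noteq> None)"
      using R by (intro exI[of _ y]) auto
    ultimately show ?L by simp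
  qed
  have hs1: "ArF (\<lambda>z. h (p1 z))" if "h \<in> set hs" for h
    using minim.prems(2)[OF that] ArF_comp ArF_p1' by blast
  have hs2: "ArF (\<lambda>z. h (p1 (p1 z)))" if "h \<in> set hs" for h
    using ArF_comp[OF hs1[OF that] ArF_p1'] .
  have v: "ArF (\<lambda>z. v (p1 z))" using minim.prems(3) ArF_comp ArF_p1' by blast
  have "Ar (\<lambda>z. f (map (\<lambda>h. h z) (v # hs)) = Some 0)"
    by (rule minim.IH) (use minim.prems in \<open>auto intro: ar\<close>)
  moreover have "Ar (\<lambda>z. f (map (\<lambda>h. h z) ((\<lambda>z. p2 (p1 z)) # map (\<lambda>h z. h (p1 (p1 z))) hs)) = Some (p2 z))"
    by (rule minim.IH) (use minim.prems in \<open>auto intro!: ar hs2\<close>)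
  ultimately have "Ar (\<lambda>z. f (v z # map (\<lambda>h. h z) hs) = Some 0)"
    "Ar (\<lambda>z. f (p2 (p1 z) # map (\<lambda>h. h (p1 (p1 z))) hs) = Some (p2 z))"
    by (simp_all add: comp_def)
  then show ?case unfolding * by (intro ar v)
qed

section \<open>Arithmetical functions with rational values\<close>

abbreviation Q :: "nat \<Rightarrow> rat" where "Q \<equiv> nat_to_rat_surj"

text \<open>A difference of naturals over a positive natural, not reduced: order and arithmetic of
  rationals become sums and products of naturals.\<close>

definition ArQ :: "(nat \<Rightarrow> rat) \<Rightarrow> bool" where
  "ArQ q \<longleftrightarrow> (\<exists>f g h. ArF f \<and> ArF g \<and> ArF h \<and>
     (\<forall>z. q z = (of_nat (f z) - of_nat (g z)) / of_nat (Suc (h z))))"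

lemma ArQI:
  assumes "ArF f" "ArF g" "ArF h" "\<And>z. q z = (of_nat (f z) - of_nat (g z)) / of_nat (Suc (h z))"
  shows "ArQ q"
  using assms unfolding ArQ_def by blast

lemma ArQE:
  assumes "ArQ q"
  obtains f g h where "ArF f" "ArF g" "ArF h"
    "\<And>z. q z = (of_nat (f z) - of_nat (g z)) / of_nat (Suc (h z))"
  using assms unfolding ArQ_def by blast

lemma ArQ_comp: "ArQ q \<Longrightarrow> ArF f \<Longrightarrow> ArQ (\<lambda>z. q (f z))"
  by (elim ArQE, rule ArQI, (erule (1) ArF_comp)+) simp

lemma ArQ_add [ar]:
  assumes "ArQ q" "ArQ r" shows "ArQ (\<lambda>z. q z + r z)"
proof -
  obtain f g h where q: "ArF f" "ArF g" "ArF h"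
    "\<And>z. q z = (of_nat (f z) - of_nat (g z)) / of_nat (Suc (h z))" using ArQE[OF assms(1)] by blast
  obtain f' g' h' where r: "ArF f'" "ArF g'" "ArF h'"
    "\<And>z. r z = (of_nat (f' z) - of_nat (g' z)) / of_nat (Suc (h' z))" using ArQE[OF assms(2)] by blast
  show ?thesis
  proof (rule ArQI)
    \<comment> \<open>The new last argument is \<open>Suc (h z) * Suc (h' z) - 1\<close>.\<close>
    show "q z + r z = (of_nat (f z * Suc (h' z) + f' z * Suc (h z)) - of_nat (g z * Suc (h' z) + g' z * Suc (h z)))
      / of_nat (Suc (h z * h' z + h z + h' z))" for z
    proof -
      have "(of_nat (Suc (h z * h' z + h z + h' z)) :: rat) = of_nat (Suc (h z)) * of_nat (Suc (h' z))"
        by (simp add: algebra_simps)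
      then show ?thesis
        unfolding q r of_nat_add of_nat_mult by (simp add: divide_simps del: of_nat_Suc) (simp add: algebra_simps)
    qed
  qed (intro ar q r)+
qed

lemma ArQ_mult [ar]:
  assumes "ArQ q" "ArQ r" shows "ArQ (\<lambda>z. q z * r z)"
proof -
  obtain f g h where q: "ArF f" "ArF g" "ArF h"
    "\<And>z. q z = (of_nat (f z) - of_nat (g z)) / of_nat (Suc (h z))" using ArQE[OF assms(1)] by blast
  obtain f' g' h' where r: "ArF f'" "ArF g'" "ArF h'"
    "\<And>z. r z = (of_nat (f' z) - of_nat (g' z)) / of_nat (Suc (h' z))" using ArQE[OF assms(2)] by blast
  show ?thesis
  proof (rule ArQI)
    show "q z * r z = (of_nat (f z * f' z + g z * g' z) - of_nat (f z * g' z + g z * f' z))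
      / of_nat (Suc (h z * h' z + h z + h' z))" for z
    proof -
      have "(of_nat (Suc (h z * h' z + h z + h' z)) :: rat) = of_nat (Suc (h z)) * of_nat (Suc (h' z))"
        by (simp add: algebra_simps)
      then show ?thesis
        unfolding q r of_nat_add of_nat_mult by (simp add: divide_simps del: of_nat_Suc) (simp add: algebra_simps)
    qed
  qed (intro ar q r)+
qed

lemma ArQ_uminus [ar]: "ArQ q \<Longrightarrow> ArQ (\<lambda>z. - q z)"
  by (erule ArQE, rule ArQI, assumption, assumption, assumption) (simp add: minus_divide_left)

lemma ArQ_diff [ar]: "ArQ q \<Longrightarrow> ArQ r \<Longrightarrow> ArQ (\<lambda>z. q z - r z)"
  using ArQ_add[OF _ ArQ_uminus, of q r] by simp

lemma ArQ_abs [ar]: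
  assumes "ArQ q" shows "ArQ (\<lambda>z. \<bar>q z\<bar>)"
proof -
  obtain f g h where q: "ArF f" "ArF g" "ArF h"
    "\<And>z. q z = (of_nat (f z) - of_nat (g z)) / of_nat (Suc (h z))" using ArQE[OF assms(1)] by blast
  show ?thesis
  proof (rule ArQI)
    \<comment> \<open>At most one of the two truncated differences is nonzero.\<close>
    show "\<bar>q z\<bar> = (of_nat ((f z - g z) + (g z - f z)) - of_nat 0) / of_nat (Suc (h z))" for z
      unfolding q abs_divide by (cases "f z \<le> g z") (auto simp: of_nat_diff)
  qed (intro ar q)+
qed

lemma ArQ_inverse_power2 [ar]: "ArF f \<Longrightarrow> ArQ (\<lambda>z. 1 / 2 ^ f z)"
  by (rule ArQI[of "\<lambda>z. 1" "\<lambda>z. 0" "\<lambda>z. 2 ^ f z - 1"]) (auto intro: ar simp: of_nat_diff)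

text \<open>Even codes \<open>a\<close> stand for \<open>a div 2\<close>, odd ones for
  \<open>- Suc (a div 2)\<close>; the remainder modulo 2 selects the case.\<close>

lemma of_int_int_decode:
  "(of_int (int_decode a) :: 'a :: ring_1)
    = of_nat ((1 - a mod 2) * (a div 2)) - of_nat (a mod 2 * Suc (a div 2))"
proof (cases "even a")
  case True
  then show ?thesis by (simp add: int_decode_def sum_decode_def)
next
  case False
  then have "a mod 2 = 1" by presburger
  with False show ?thesis by (simp add: int_decode_def sum_decode_def)
qed

lemma ArQ_nat_to_rat_surj [ar]:
  assumes c: "ArF c"
  shows "ArQ (\<lambda>z. Q (c z))"
proof -
  define A A' B B' where "A = (\<lambda>z. (1 - p1 (c z) mod 2) * (p1 (c z) div 2))"
    and "A' = (\<lambda>z. p1 (c z) mod 2 * Suc (p1 (c z) div 2))"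
    and "B = (\<lambda>z. (1 - p2 (c z) mod 2) * (p2 (c z) div 2))"
    and "B' = (\<lambda>z. p2 (c z) mod 2 * Suc (p2 (c z) div 2))"
  note ABdefs = this
  have AB: "ArF A" "ArF A'" "ArF B" "ArF B'" unfolding ABdefs by (intro ar c)+
  have zero: "B z = 0 \<or> B' z = 0" for z unfolding ABdefs by (cases "even (p2 (c z))") auto
  show ?thesis
  proof (rule ArQI)
    \<comment> \<open>The fraction is expanded by \<open>B z - B' z\<close>. As one of
      \<open>B z\<close>, \<open>B' z\<close> is zero, the new denominator is the square of their
      sum. If both vanish, each side is zero, since division by zero yields zero.\<close>
    show "Q (c z) = (of_nat (A z * B z + A' z * B' z) - of_nat (A z * B' z + A' z * B z))
      / of_nat (Suc ((B z + B' z) * (B z + B' z) - 1))" for z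
    proof -
      have "Q (c z) = of_int (int_decode (p1 (c z))) / of_int (int_decode (p2 (c z)))"
        by (simp add: nat_to_rat_surj_def p1_def p2_def case_prod_unfold Fract_of_int_quotient Let_def)
      also have "\<dots> = (of_nat (A z) - of_nat (A' z)) / (of_nat (B z) - of_nat (B' z))"
        unfolding of_int_int_decode ABdefs ..
      also have "\<dots> = (of_nat (A z * B z + A' z * B' z) - of_nat (A z * B' z + A' z * B z))
        / of_nat (Suc ((B z + B' z) * (B z + B' z) - 1))"
      proof (cases "B z = 0 \<and> B' z = 0")
        case False
        then have "Suc ((B z + B' z) * (B z + B' z) - 1) = (B z + B' z) * (B z + B' z)" by simp
        then show ?thesis using False zero[of z]
          by (auto simp: divide_simps simp del: of_nat_Suc) (simp_all add: algebra_simps)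
      qed simp
      finally show ?thesis .
    qed
  qed (intro ar AB)+
qed

lemma ex_code: "\<exists>c. Q c = q"
  using surj_nat_to_rat_surj by (metis surjD)

lemma ArQ_const [ar]: "ArQ (\<lambda>z. q)"
proof -
  obtain c where "Q c = q" using ex_code by blast
  with ArQ_nat_to_rat_surj[OF ArF_const[of c]] show ?thesis by simp
qed

lemma Ar_rat_le [ar]:
  assumes "ArQ q" "ArQ r" shows "Ar (\<lambda>z. q z \<le> r z)"
proof -
  obtain f g h where q: "ArF f" "ArF g" "ArF h"
    "\<And>z. q z = (of_nat (f z) - of_nat (g z)) / of_nat (Suc (h z))" using ArQE[OF assms(1)] by blast
  obtain f' g' h' where r: "ArF f'" "ArF g'" "ArF h'"
    "\<And>z. r z = (of_nat (f' z) - of_nat (g' z)) / of_nat (Suc (h' z))" using ArQE[OF assms(2)] by blast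
  have "q z \<le> r z \<longleftrightarrow> f z * Suc (h' z) + g' z * Suc (h z) \<le> f' z * Suc (h z) + g z * Suc (h' z)" for z
  proof -
    have "q z \<le> r z \<longleftrightarrow> (of_nat (f z) - of_nat (g z)) * (of_nat (Suc (h' z)) :: rat)
        \<le> (of_nat (f' z) - of_nat (g' z)) * of_nat (Suc (h z))"
      unfolding q r by (simp add: divide_simps del: of_nat_Suc)
    also have "\<dots> \<longleftrightarrow> (of_nat (f z * Suc (h' z) + g' z * Suc (h z)) :: rat)
        \<le> of_nat (f' z * Suc (h z) + g z * Suc (h' z))"
      unfolding of_nat_add of_nat_mult left_diff_distrib by linarith
    finally show ?thesis unfolding of_nat_le_iff .
  qed
  then show ?thesis by (simp only:) (intro ar q r)
qed

lemma Ar_rat_less [ar]: "ArQ q \<Longrightarrow> ArQ r \<Longrightarrow> Ar (\<lambda>z. q z < r z)"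
  unfolding not_le[symmetric] by (intro ar)

lemma Ar_rat_eq [ar]: "ArQ q \<Longrightarrow> ArQ r \<Longrightarrow> Ar (\<lambda>z. q z = r z)"
  using Ar_conj[OF Ar_rat_le Ar_rat_le, of q r r q] by (simp add: order.eq_iff[symmetric])

text \<open>A formula is analysed once, with projections as its arguments, and then instantiated in
  any context.\<close>

lemma Ar_subst3:
  assumes "Ar (\<lambda>z. R (p1 z) (p1 (p2 z)) (p2 (p2 z)))" "ArF f" "ArF g" "ArF h"
  shows "Ar (\<lambda>z. R (f z) (g z) (h z))"
  using Ar_subst[OF assms(1) ArF_pr[OF assms(2) ArF_pr[OF assms(3,4)]]] by simp

lemma Ar_subst4:
  assumes "Ar (\<lambda>z. R (p1 z) (p1 (p2 z)) (p1 (p2 (p2 z))) (p2 (p2 (p2 z))))" "ArF f" "ArF g" "ArF h" "ArF k"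
  shows "Ar (\<lambda>z. R (f z) (g z) (h z) (k z))"
  using Ar_subst[OF assms(1) ArF_pr[OF assms(2) ArF_pr[OF assms(3) ArF_pr[OF assms(4,5)]]]] by simp

section \<open>The defining formula\<close>

text \<open>
  \<^const>\<open>pscale\<close> picks the code of a rational by Hilbert choice, which need not be arithmetical;
  hence vectors are scaled by codes.
\<close>

definition sc :: "presentation \<Rightarrow> nat \<Rightarrow> nat \<Rightarrow> nat" where
  "sc P c x = the (scale_fun P c x)"

text \<open>The choice does no harm here: it fixes one number, and constants are arithmetical
  whatever their value.\<close>

definition code_minus_one :: nat where
  "code_minus_one = (SOME c. Q c = -1)"

definition neg :: "presentation \<Rightarrow> nat \<Rightarrow> nat" where
  "neg P x = sc P code_minus_one x"

definition sub :: "presentation \<Rightarrow> nat \<Rightarrow> nat \<Rightarrow> nat" where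
  "sub P x y = padd P x (neg P y)"

text \<open>Strict rational upper bounds of the norm; the formulas describing C[0,1] reach the
  real-valued norm only through them.\<close>

definition nlt :: "presentation \<Rightarrow> nat \<Rightarrow> rat \<Rightarrow> bool" where
  "nlt P x q \<longleftrightarrow> (\<exists>n. Q (the (norm_fun P x n)) + 1 / 2 ^ n < q)"

text \<open>The last clause makes all codes of a rational act alike, so that \<open>sc\<close> can
  stand in for \<open>pscale\<close>.\<close>

definition valid_ops :: "presentation \<Rightarrow> bool" where
  "valid_ops P \<longleftrightarrow>
    (\<forall>x. dom_char P x = Some 0 \<or> dom_char P x = Some 1) \<and>
    (\<forall>x\<in>points P. \<forall>y\<in>points P. \<exists>v. add_fun P x y = Some v) \<and>
    (\<forall>c. \<forall>x\<in>points P. \<exists>v. scale_fun P c x = Some v) \<and>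
    (\<forall>c c'. Q c = Q c' \<longrightarrow> (\<forall>x\<in>points P. sc P c x = sc P c' x))"

text \<open>The limit, a real number, is avoided: the approximations are compared with each other,
  at the rate that convergence with error \<open>1 / 2 ^ n\<close> imposes.\<close>

definition valid_norm :: "presentation \<Rightarrow> bool" where
  "valid_norm P \<longleftrightarrow>
    (\<forall>x\<in>points P. \<forall>n. \<exists>v. norm_fun P x n = Some v) \<and>
    (\<forall>x\<in>points P. \<forall>m n.
      \<bar>Q (the (norm_fun P x m)) - Q (the (norm_fun P x n))\<bar> \<le> 1 / 2 ^ m + 1 / 2 ^ n)"

text \<open>Statements about norms become statements about the rationals above them. Homogeneity is
  split because multiplying \<open>N x < a\<close> by zero would give the false
  \<open>0 < 0\<close>.\<close>

definition valid_axioms :: "presentation \<Rightarrow> nat \<Rightarrow> bool" where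
  "valid_axioms P z \<longleftrightarrow>
    z \<in> points P \<and>
    (\<forall>x\<in>points P. \<forall>y\<in>points P. padd P x y \<in> points P) \<and>
    (\<forall>x\<in>points P. \<forall>c. sc P c x \<in> points P) \<and>
    (\<forall>x\<in>points P. \<forall>y\<in>points P. \<forall>w\<in>points P. padd P (padd P x y) w = padd P x (padd P y w)) \<and>
    (\<forall>x\<in>points P. \<forall>y\<in>points P. padd P x y = padd P y x) \<and>
    (\<forall>x\<in>points P. padd P x z = x) \<and>
    (\<forall>x\<in>points P. \<exists>y\<in>points P. padd P x y = z) \<and>
    (\<forall>c. \<forall>x\<in>points P. \<forall>y\<in>points P. sc P c (padd P x y) = padd P (sc P c x) (sc P c y)) \<and>
    (\<forall>a b c. Q c = Q a + Q b \<longrightarrow> (\<forall>x\<in>points P. sc P c x = padd P (sc P a x) (sc P b x))) \<and>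
    (\<forall>a b c. Q c = Q a * Q b \<longrightarrow> (\<forall>x\<in>points P. sc P a (sc P b x) = sc P c x)) \<and>
    (\<forall>c. Q c = 1 \<longrightarrow> (\<forall>x\<in>points P. sc P c x = x)) \<and>
    (\<forall>x\<in>points P. \<forall>a. nlt P x (Q a) \<longrightarrow> 0 < Q a) \<and>
    (\<forall>x\<in>points P. (\<forall>a. 0 < Q a \<longrightarrow> nlt P x (Q a)) \<longleftrightarrow> x = z) \<and>
    (\<forall>x\<in>points P. \<forall>c. Q c = 0 \<longrightarrow> (\<forall>a. 0 < Q a \<longrightarrow> nlt P (sc P c x) (Q a))) \<and>
    (\<forall>x\<in>points P. \<forall>c. Q c \<noteq> 0 \<longrightarrow> (\<forall>a. nlt P (sc P c x) (\<bar>Q c\<bar> * Q a) \<longleftrightarrow> nlt P x (Q a))) \<and>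
    (\<forall>x\<in>points P. \<forall>y\<in>points P. \<forall>a b. nlt P x (Q a) \<and> nlt P y (Q b) \<longrightarrow> nlt P (padd P x y) (Q a + Q b))"

definition valid :: "presentation \<Rightarrow> bool" where
  "valid P \<longleftrightarrow> valid_ops P \<and> valid_norm P \<and> (\<exists>z. valid_axioms P z)"

text \<open>
  In C[0,1] with \<open>e > 0\<close>, \<open>Pos\<close> says \<open>f > 0\<close>: no \<open>f + c e\<close> with \<open>c \<ge> 0\<close> comes close to zero.
\<close>

definition Pos :: "presentation \<Rightarrow> nat \<Rightarrow> nat \<Rightarrow> bool" where
  "Pos P e f \<longleftrightarrow> (\<exists>d. 0 < Q d \<and> (\<forall>c. 0 \<le> Q c \<longrightarrow> (\<forall>y\<in>points P. \<forall>a.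
     nlt P (padd P (padd P f (sc P c e)) y) (Q a) \<and> nlt P (sub P (padd P f (sc P c e)) y) (Q a)
     \<longrightarrow> nlt P y (Q a - Q d))))"

definition Gt :: "presentation \<Rightarrow> nat \<Rightarrow> nat \<Rightarrow> nat \<Rightarrow> bool" where
  "Gt P e f g \<longleftrightarrow> Pos P e (sub P f g)"

text \<open>
  For the open sets \<open>{u > 0}\<close>, \<open>{v > 0}\<close>, \<open>{w > 0}\<close> of C[0,1]: \<open>Meet\<close> says that the first two
  intersect, \<open>Zeros_in\<close> that \<open>k\<close> has all its zeros in the first, \<open>Btw\<close> that some point of the first lies
  strictly between a point of the second and a point of the third.
\<close>

definition Meet :: "presentation \<Rightarrow> nat \<Rightarrow> nat \<Rightarrow> nat \<Rightarrow> bool" where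
  "Meet P e u v \<longleftrightarrow> (\<exists>w\<in>points P. \<exists>c. 0 < Q c \<and> Gt P e u w \<and> Gt P e v w \<and> \<not> Gt P e (sc P c e) w)"

definition Zeros_in :: "presentation \<Rightarrow> nat \<Rightarrow> nat \<Rightarrow> nat \<Rightarrow> bool" where
  "Zeros_in P e k u \<longleftrightarrow> (\<exists>c. 0 < Q c \<and> (\<forall>z\<in>points P.
     Gt P e z k \<and> Gt P e z (neg P k) \<and> Gt P e z u \<longrightarrow> Gt P e z (sc P c e)))"

definition Btw :: "presentation \<Rightarrow> nat \<Rightarrow> nat \<Rightarrow> nat \<Rightarrow> nat \<Rightarrow> bool" where
  "Btw P e u v w \<longleftrightarrow> (\<exists>k\<in>points P. Meet P e k v \<and> Meet P e (neg P k) w \<and> Zeros_in P e k u)"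

text \<open>
  \<open>LT\<close> says that some point of \<open>{v > 0}\<close> is less than some point of \<open>{u > 0}\<close>.  With \<open>{l > 0}\<close> to the left
  of \<open>{r > 0}\<close>, \<open>Btw r l u'\<close> holds iff \<open>u'\<close> reaches to the right of some point of \<open>{r > 0}\<close>, and
  \<open>Btw l v' r\<close> iff \<open>v'\<close> reaches to the left of some point of \<open>{l > 0}\<close>.
\<close>

definition LT :: "presentation \<Rightarrow> nat \<Rightarrow> nat \<Rightarrow> nat \<Rightarrow> nat \<Rightarrow> nat \<Rightarrow> bool" where
  "LT P e l r v u \<longleftrightarrow> (\<exists>v'\<in>points P. \<exists>u'\<in>points P. Gt P e v v' \<and> Gt P e u u' \<and>
     (\<not> Btw P e r l u' \<and> Btw P e u' v' r \<or>
      \<not> Btw P e l v' r \<and> Btw P e v' l u' \<or>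
      Btw P e l v' r \<and> Btw P e r l u'))"

text \<open>
  A bump \<open>u\<close> stands for the point \<open>sup {u > 0}\<close>.  In C[0,1], \<open>lt\<close> compares two such points, \<open>ge\<close> says that
  \<open>f / e\<close> is at least \<open>q\<close> at the point \<open>u\<close>, and \<open>close\<close> that \<open>f / e\<close> at \<open>x\<close> exceeds its value at \<open>y\<close> by
  at most \<open>s\<close>.
\<close>

definition bumps :: "presentation \<Rightarrow> nat \<Rightarrow> nat set" where
  "bumps P e = {u \<in> points P. Meet P e u u}"

definition lt :: "presentation \<Rightarrow> nat \<Rightarrow> nat \<Rightarrow> nat \<Rightarrow> nat \<Rightarrow> nat \<Rightarrow> bool" where
  "lt P e l r x y \<longleftrightarrow> (\<exists>w\<in>bumps P e. LT P e l r w y \<and> \<not> LT P e l r w x)"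

text \<open>Lies between two inequalities: it follows from \<open>f > c e\<close> at the point
  \<open>u\<close> and implies \<open>f \<ge> c e\<close> there. \<open>ge\<close> closes the gap by
  quantifying over all smaller rationals.\<close>

definition near :: "presentation \<Rightarrow> nat \<Rightarrow> nat \<Rightarrow> nat \<Rightarrow> nat \<Rightarrow> nat \<Rightarrow> nat \<Rightarrow> bool" where
  "near P e l r f u c \<longleftrightarrow> (\<exists>w\<in>bumps P e. lt P e l r w u \<and>
     (\<forall>v\<in>bumps P e. lt P e l r w v \<and> \<not> lt P e l r u v \<longrightarrow> Meet P e v (sub P f (sc P c e))))"

definition ge :: "presentation \<Rightarrow> nat \<Rightarrow> nat \<Rightarrow> nat \<Rightarrow> nat \<Rightarrow> nat \<Rightarrow> rat \<Rightarrow> bool" where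
  "ge P e l r f u q \<longleftrightarrow> (\<forall>c. Q c < q \<longrightarrow> near P e l r f u c)"

definition close :: "presentation \<Rightarrow> nat \<Rightarrow> nat \<Rightarrow> nat \<Rightarrow> nat \<Rightarrow> nat \<Rightarrow> nat \<Rightarrow> rat \<Rightarrow> bool" where
  "close P e l r f x y s \<longleftrightarrow> (\<forall>b. ge P e l r f x (Q b) \<longrightarrow> ge P e l r f y (Q b - s))"

text \<open>Mostly one-sided rules for lower bounds. Linearity of the evaluations follows by
  applying them to the inverse operations as well.\<close>

definition eval_axioms :: "presentation \<Rightarrow> nat \<Rightarrow> nat \<Rightarrow> nat \<Rightarrow> bool" where
  "eval_axioms P e l r \<longleftrightarrow>
    (\<forall>f\<in>points P. \<exists>a. \<forall>u\<in>bumps P e. ge P e l r f u (- Q a) \<and> \<not> ge P e l r f u (Q a)) \<and>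
    (\<forall>f\<in>points P. \<forall>g\<in>points P. \<forall>u\<in>bumps P e. \<forall>a b.
      ge P e l r f u (Q a) \<and> ge P e l r g u (Q b) \<longrightarrow> ge P e l r (padd P f g) u (Q a + Q b)) \<and>
    (\<forall>f\<in>points P. \<forall>u\<in>bumps P e. \<forall>a c.
      0 < Q c \<and> ge P e l r f u (Q a) \<longrightarrow> ge P e l r (sc P c f) u (Q c * Q a)) \<and>
    (\<forall>f\<in>points P. \<forall>u\<in>bumps P e. \<forall>a.
      \<not> ge P e l r f u (Q a) \<longrightarrow> ge P e l r (neg P f) u (- Q a)) \<and>
    (\<forall>u\<in>bumps P e. ge P e l r e u 1 \<and> ge P e l r (neg P e) u (- 1))"

text \<open>The third clause is the substitute for a coordinate function: \<open>p\<close> increases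
  up to \<open>d\<close>, and \<open>5 * d\<close> is what the converse can guarantee for
  \<open>p\<close>, namely \<open>4 * d\<close> for the change of its running maximum plus
  \<open>d\<close> for the distance of \<open>p\<close> from that maximum. The fourth clause
  expresses connectedness, the fifth separates distinct points with a margin.\<close>

definition order_axioms :: "presentation \<Rightarrow> nat \<Rightarrow> nat \<Rightarrow> nat \<Rightarrow> bool" where
  "order_axioms P e l r \<longleftrightarrow>
    (\<forall>x\<in>bumps P e. \<forall>y\<in>bumps P e. \<not> (lt P e l r x y \<and> lt P e l r y x)) \<and>
    (\<exists>x\<in>bumps P e. \<exists>y\<in>bumps P e. lt P e l r x y) \<and>
    (\<forall>f\<in>points P. \<forall>a. 0 < Q a \<longrightarrow> (\<exists>p\<in>points P. \<exists>d. 0 < Q d \<and>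
      (\<forall>x\<in>bumps P e. \<forall>y\<in>bumps P e. \<not> lt P e l r y x \<longrightarrow> close P e l r p x y (Q d)) \<and>
      (\<forall>x\<in>bumps P e. \<forall>y\<in>bumps P e.
        close P e l r p x y (5 * Q d) \<and> close P e l r p y x (5 * Q d)
        \<longrightarrow> close P e l r f x y (Q a)))) \<and>
    (\<forall>f\<in>points P. \<forall>x\<in>bumps P e. \<forall>y\<in>bumps P e. \<forall>a b.
      Q a < Q b \<and> \<not> ge P e l r f x (Q a) \<and> ge P e l r f y (Q b)
      \<longrightarrow> (\<exists>z\<in>bumps P e. ge P e l r f z (Q a) \<and> \<not> ge P e l r f z (Q b))) \<and>
    (\<forall>x\<in>bumps P e. \<forall>y\<in>bumps P e. lt P e l r x y \<longrightarrow> (\<exists>f\<in>points P. \<forall>u\<in>bumps P e.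
      (\<not> lt P e l r x u \<longrightarrow> \<not> ge P e l r f u 0) \<and> (\<not> lt P e l r u y \<longrightarrow> ge P e l r f u 1)))"

text \<open>The first clause provides approximate squares, tested through \<bar>f\<bar> \<ge> b and
  \<bar>f\<bar> < b; products follow by polarisation. The second says that the open unit ball has an
  almost largest element, uniformly in the point, the third that pointwise domination passes to
  norms.\<close>

definition norm_axioms :: "presentation \<Rightarrow> nat \<Rightarrow> nat \<Rightarrow> nat \<Rightarrow> bool" where
  "norm_axioms P e l r \<longleftrightarrow>
    (\<forall>f\<in>points P. \<forall>a. 0 < Q a \<longrightarrow> (\<exists>k\<in>points P. \<forall>u\<in>bumps P e. \<forall>b. 0 \<le> Q b \<longrightarrow>
      (ge P e l r f u (Q b) \<or> ge P e l r (neg P f) u (Q b) \<longrightarrow> ge P e l r k u (Q b * Q b - Q a)) \<and>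
      (\<not> ge P e l r f u (Q b) \<and> \<not> ge P e l r (neg P f) u (Q b) \<longrightarrow> \<not> ge P e l r k u (Q b * Q b + Q a)))) \<and>
    (\<forall>a. 0 < Q a \<longrightarrow> (\<exists>h\<in>points P. nlt P h 1 \<and> (\<forall>f\<in>points P. nlt P f 1 \<longrightarrow>
      (\<forall>u\<in>bumps P e. \<forall>b. ge P e l r f u (Q b) \<longrightarrow> ge P e l r h u (Q b - Q a))))) \<and>
    (\<forall>f\<in>points P. \<forall>h\<in>points P.
      (\<forall>u\<in>bumps P e. \<forall>a. ge P e l r f u (Q a) \<or> ge P e l r (neg P f) u (Q a) \<longrightarrow> ge P e l r h u (Q a))
      \<longrightarrow> (\<forall>b. nlt P h (Q b) \<longrightarrow> nlt P f (Q b)))"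

definition looks_like_C01 :: "presentation \<Rightarrow> bool" where
  "looks_like_C01 P \<longleftrightarrow> (\<exists>e\<in>points P. \<exists>l\<in>points P. \<exists>r\<in>points P.
    eval_axioms P e l r \<and> order_axioms P e l r \<and> norm_axioms P e l r)"

section \<open>Arithmeticity of the formula, uniformly in the index\<close>

lemma Ar_subst5:
  assumes "Ar (\<lambda>z. R (p1 z) (p1 (p2 z)) (p1 (p2 (p2 z))) (p1 (p2 (p2 (p2 z)))) (p2 (p2 (p2 (p2 z)))))"
    "ArF f1" "ArF f2" "ArF f3" "ArF f4" "ArF f5"
  shows "Ar (\<lambda>z. R (f1 z) (f2 z) (f3 z) (f4 z) (f5 z))"
  using Ar_subst[OF assms(1), of "\<lambda>z. pr (f1 z) (pr (f2 z) (pr (f3 z) (pr (f4 z) (f5 z))))"] assms(2-)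
  by (simp add: ArF_pr)

lemma Ar_subst6:
  assumes "Ar (\<lambda>z. R (p1 z) (p1 (p2 z)) (p1 (p2 (p2 z))) (p1 (p2 (p2 (p2 z))))
      (p1 (p2 (p2 (p2 (p2 z))))) (p2 (p2 (p2 (p2 (p2 z))))))"
    "ArF f1" "ArF f2" "ArF f3" "ArF f4" "ArF f5" "ArF f6"
  shows "Ar (\<lambda>z. R (f1 z) (f2 z) (f3 z) (f4 z) (f5 z) (f6 z))"
  using Ar_subst[OF assms(1), of "\<lambda>z. pr (f1 z) (pr (f2 z) (pr (f3 z) (pr (f4 z) (pr (f5 z) (f6 z)))))"] assms(2-)
  by (simp add: ArF_pr)

lemma Ar_subst7:
  assumes "Ar (\<lambda>z. R (p1 z) (p1 (p2 z)) (p1 (p2 (p2 z))) (p1 (p2 (p2 (p2 z))))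
      (p1 (p2 (p2 (p2 (p2 z))))) (p1 (p2 (p2 (p2 (p2 (p2 z)))))) (p2 (p2 (p2 (p2 (p2 (p2 z)))))))"
    "ArF f1" "ArF f2" "ArF f3" "ArF f4" "ArF f5" "ArF f6" "ArF f7"
  shows "Ar (\<lambda>z. R (f1 z) (f2 z) (f3 z) (f4 z) (f5 z) (f6 z) (f7 z))"
  using Ar_subst[OF assms(1), of "\<lambda>z. pr (f1 z) (pr (f2 z) (pr (f3 z) (pr (f4 z) (pr (f5 z) (pr (f6 z) (f7 z))))))"] assms(2-)
  by (simp add: ArF_pr)

lemma ArF_the:
  assumes "\<And>v. ArF v \<Longrightarrow> Ar (\<lambda>w. F (p1 w) = Some (v w))"
    "\<And>v. ArF v \<Longrightarrow> Ar (\<lambda>w. F (p1 (p1 w)) = Some (v w))"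
  shows "ArF (\<lambda>z. the (F z))"
proof (rule ArF_graphI)
  \<comment> \<open>Where nothing is defined, \<open>the\<close> has the unknown but fixed value
    \<open>the None\<close>, which can appear as a constant.\<close>
  have eq: "the x = v \<longleftrightarrow> x = Some v \<or> (\<forall>u. x \<noteq> Some u) \<and> v = the None" for x and v :: nat
    by (cases x) auto
  show "Ar (\<lambda>z. the (F (p1 z)) = p2 z)"
    unfolding eq by (intro ar assms)
qed

locale uniform_presentation =
  fixes B :: "nat \<Rightarrow> presentation"
  assumes uniform: "uniformly_computable B"
begin

lemma Ar_dom_char [ar]:
  assumes "ArF i" "ArF x" "ArF v"
  shows "Ar (\<lambda>z. dom_char (B (i z)) (x z) = Some (v z))"
proof -
  obtain F where F: "partrec 2 F" "\<And>x y. F [x, y] = dom_char (B x) y"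
    using uniform by (auto simp: uniformly_computable_def partrec2_def)
  show ?thesis
    using Ar_partrec_graph[OF F(1), of "[i, x]" v] assms by (auto simp: F(2))
qed

lemma Ar_points [ar]:
  assumes "ArF i" "ArF x"
  shows "Ar (\<lambda>z. x z \<in> points (B (i z)))"
  unfolding points_def mem_Collect_eq by (intro ar assms)

lemma Ar_add_fun [ar]:
  assumes "ArF i" "ArF x" "ArF y" "ArF v"
  shows "Ar (\<lambda>z. add_fun (B (i z)) (x z) (y z) = Some (v z))"
proof -
  obtain F where F: "partrec 3 F" "\<And>x y z. F [x, y, z] = add_fun (B x) y z"
    using uniform by (auto simp: uniformly_computable_def partrec3_def)
  show ?thesis
    using Ar_partrec_graph[OF F(1), of "[i, x, y]" v] assms by (auto simp: F(2))
qed

lemma Ar_scale_fun [ar]: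
  assumes "ArF i" "ArF x" "ArF y" "ArF v"
  shows "Ar (\<lambda>z. scale_fun (B (i z)) (x z) (y z) = Some (v z))"
proof -
  obtain F where F: "partrec 3 F" "\<And>x y z. F [x, y, z] = scale_fun (B x) y z"
    using uniform by (auto simp: uniformly_computable_def partrec3_def)
  show ?thesis
    using Ar_partrec_graph[OF F(1), of "[i, x, y]" v] assms by (auto simp: F(2))
qed

lemma Ar_norm_fun [ar]:
  assumes "ArF i" "ArF x" "ArF y" "ArF v"
  shows "Ar (\<lambda>z. norm_fun (B (i z)) (x z) (y z) = Some (v z))"
proof -
  obtain F where F: "partrec 3 F" "\<And>x y z. F [x, y, z] = norm_fun (B x) y z"
    using uniform by (auto simp: uniformly_computable_def partrec3_def)
  show ?thesis
    using Ar_partrec_graph[OF F(1), of "[i, x, y]" v] assms by (auto simp: F(2))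
qed

lemma ArF_padd [ar]:
  assumes "ArF i" "ArF x" "ArF y"
  shows "ArF (\<lambda>z. padd (B (i z)) (x z) (y z))"
  unfolding padd_def
  by (rule ArF_the) (intro ar assms[THEN ArF_comp], assumption)+

lemma ArF_sc [ar]:
  assumes "ArF i" "ArF x" "ArF y"
  shows "ArF (\<lambda>z. sc (B (i z)) (x z) (y z))"
  unfolding sc_def
  by (rule ArF_the) (intro ar assms[THEN ArF_comp], assumption)+

lemma ArF_norm_fun [ar]:
  assumes "ArF i" "ArF x" "ArF y"
  shows "ArF (\<lambda>z. the (norm_fun (B (i z)) (x z) (y z)))"
  by (rule ArF_the) (intro ar assms[THEN ArF_comp], assumption)+

lemma ArF_neg [ar]: "ArF i \<Longrightarrow> ArF x \<Longrightarrow> ArF (\<lambda>z. neg (B (i z)) (x z))"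
  unfolding neg_def by (intro ar)

lemma ArF_sub [ar]: "ArF i \<Longrightarrow> ArF x \<Longrightarrow> ArF y \<Longrightarrow> ArF (\<lambda>z. sub (B (i z)) (x z) (y z))"
  unfolding sub_def by (intro ar)

lemma Ar_nlt [ar]:
  assumes "ArF i" "ArF x" "ArQ q"
  shows "Ar (\<lambda>z. nlt (B (i z)) (x z) (q z))"
  unfolding nlt_def by (intro ar assms(1,2)[THEN ArF_comp] assms(3)[THEN ArQ_comp])

lemma Ar_valid: "Ar (\<lambda>i. valid (B i))"
  unfolding valid_def valid_ops_def valid_norm_def valid_axioms_def by (intro ar)

lemma Ar_Pos [ar]: "ArF i \<Longrightarrow> ArF e \<Longrightarrow> ArF f \<Longrightarrow> Ar (\<lambda>z. Pos (B (i z)) (e z) (f z))"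
  by (rule Ar_subst3[of "\<lambda>i. Pos (B i)"]) (unfold Pos_def, intro ar)

lemma Ar_Gt [ar]: "ArF i \<Longrightarrow> ArF e \<Longrightarrow> ArF f \<Longrightarrow> ArF g \<Longrightarrow> Ar (\<lambda>z. Gt (B (i z)) (e z) (f z) (g z))"
  unfolding Gt_def by (intro ar)

lemma Ar_Meet [ar]: "ArF i \<Longrightarrow> ArF e \<Longrightarrow> ArF u \<Longrightarrow> ArF v \<Longrightarrow> Ar (\<lambda>z. Meet (B (i z)) (e z) (u z) (v z))"
  by (rule Ar_subst4[of "\<lambda>i. Meet (B i)"]) (unfold Meet_def, intro ar)

lemma Ar_Zeros_in [ar]:
  "ArF i \<Longrightarrow> ArF e \<Longrightarrow> ArF u \<Longrightarrow> ArF v \<Longrightarrow> Ar (\<lambda>z. Zeros_in (B (i z)) (e z) (u z) (v z))"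
  by (rule Ar_subst4[of "\<lambda>i. Zeros_in (B i)"]) (unfold Zeros_in_def, intro ar)

lemma Ar_Btw [ar]:
  "ArF i \<Longrightarrow> ArF e \<Longrightarrow> ArF u \<Longrightarrow> ArF v \<Longrightarrow> ArF w \<Longrightarrow> Ar (\<lambda>z. Btw (B (i z)) (e z) (u z) (v z) (w z))"
  by (rule Ar_subst5[of "\<lambda>i. Btw (B i)"]) (unfold Btw_def, intro ar)

lemma Ar_LT [ar]:
  "ArF i \<Longrightarrow> ArF e \<Longrightarrow> ArF l \<Longrightarrow> ArF r \<Longrightarrow> ArF u \<Longrightarrow> ArF v \<Longrightarrow>
    Ar (\<lambda>z. LT (B (i z)) (e z) (l z) (r z) (u z) (v z))"
  by (rule Ar_subst6[of "\<lambda>i. LT (B i)"]) (unfold LT_def, intro ar)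

lemma Ar_bumps [ar]: "ArF i \<Longrightarrow> ArF e \<Longrightarrow> ArF u \<Longrightarrow> Ar (\<lambda>z. u z \<in> bumps (B (i z)) (e z))"
  unfolding bumps_def mem_Collect_eq by (intro ar)

lemma Ar_lt [ar]:
  "ArF i \<Longrightarrow> ArF e \<Longrightarrow> ArF l \<Longrightarrow> ArF r \<Longrightarrow> ArF u \<Longrightarrow> ArF v \<Longrightarrow>
    Ar (\<lambda>z. lt (B (i z)) (e z) (l z) (r z) (u z) (v z))"
  by (rule Ar_subst6[of "\<lambda>i. lt (B i)"]) (unfold lt_def, intro ar)

lemma Ar_near [ar]:
  "ArF i \<Longrightarrow> ArF e \<Longrightarrow> ArF l \<Longrightarrow> ArF r \<Longrightarrow> ArF u \<Longrightarrow> ArF v \<Longrightarrow> ArF c \<Longrightarrow>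
    Ar (\<lambda>z. near (B (i z)) (e z) (l z) (r z) (u z) (v z) (c z))"
  by (rule Ar_subst7[of "\<lambda>i. near (B i)"]) (unfold near_def, intro ar)

lemma Ar_ge [ar]:
  assumes "ArF i" "ArF e" "ArF l" "ArF r" "ArF u" "ArF v" "ArQ q"
  shows "Ar (\<lambda>z. ge (B (i z)) (e z) (l z) (r z) (u z) (v z) (q z))"
  unfolding ge_def by (intro ar assms(1-6)[THEN ArF_comp] assms(7)[THEN ArQ_comp])

lemma Ar_close [ar]:
  assumes "ArF i" "ArF e" "ArF l" "ArF r" "ArF f" "ArF x" "ArF y" "ArQ q"
  shows "Ar (\<lambda>z. close (B (i z)) (e z) (l z) (r z) (f z) (x z) (y z) (q z))"
  unfolding close_def by (intro ar assms(1-7)[THEN ArF_comp] assms(8)[THEN ArQ_comp])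

lemma Ar_eval_axioms [ar]:
  "ArF i \<Longrightarrow> ArF e \<Longrightarrow> ArF l \<Longrightarrow> ArF r \<Longrightarrow> Ar (\<lambda>z. eval_axioms (B (i z)) (e z) (l z) (r z))"
  by (rule Ar_subst4[of "\<lambda>i. eval_axioms (B i)"]) (unfold eval_axioms_def, intro ar)

lemma Ar_order_axioms [ar]:
  "ArF i \<Longrightarrow> ArF e \<Longrightarrow> ArF l \<Longrightarrow> ArF r \<Longrightarrow> Ar (\<lambda>z. order_axioms (B (i z)) (e z) (l z) (r z))"
  by (rule Ar_subst4[of "\<lambda>i. order_axioms (B i)"]) (unfold order_axioms_def, intro ar)

lemma Ar_norm_axioms [ar]:
  "ArF i \<Longrightarrow> ArF e \<Longrightarrow> ArF l \<Longrightarrow> ArF r \<Longrightarrow> Ar (\<lambda>z. norm_axioms (B (i z)) (e z) (l z) (r z))"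
  by (rule Ar_subst4[of "\<lambda>i. norm_axioms (B i)"]) (unfold norm_axioms_def, intro ar)

lemma Ar_looks_like_C01: "Ar (\<lambda>i. looks_like_C01 (B i))"
  unfolding looks_like_C01_def by (intro ar)

end

section \<open>Arithmetical form of the normed space axioms\<close>

lemma ops_total_iff: "ops_total P \<longleftrightarrow> valid_ops P"
proof
  assume L: "ops_total P"
  then have "sc P c x = pscale P (Q c) x" if "x \<in> points P" for c x
    using that by (simp add: ops_total_def sc_def)
  then show "valid_ops P" using L unfolding ops_total_def valid_ops_def by auto
next
  assume R: "valid_ops P"
  have "scale_fun P c x = Some (pscale P (Q c) x)" if x: "x \<in> points P" for c x
  proof -
    \<comment> \<open>\<open>pscale\<close> uses the code chosen by \<open>inv\<close>; it acts like
      \<open>c\<close> because both denote the same rational.\<close>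
    have "Q (inv Q (Q c)) = Q c" by (simp add: surj_nat_to_rat_surj surj_f_inv_f)
    then have "sc P (inv Q (Q c)) x = sc P c x" using R x unfolding valid_ops_def by blast
    moreover obtain v where "scale_fun P c x = Some v" using R x unfolding valid_ops_def by blast
    ultimately show ?thesis by (simp add: pscale_def sc_def)
  qed
  then show "ops_total P" using R unfolding ops_total_def valid_ops_def by auto
qed

lemma sc_eq_pscale: "ops_total P \<Longrightarrow> x \<in> points P \<Longrightarrow> sc P c x = pscale P (Q c) x"
  by (simp add: ops_total_def sc_def)

definition norm_approx :: "presentation \<Rightarrow> nat \<Rightarrow> nat \<Rightarrow> real" where
  "norm_approx P x n = real_of_rat (Q (the (norm_fun P x n)))"

lemma of_rat_inverse_power2: "real_of_rat (1 / 2 ^ n) = 1 / 2 ^ n"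
  by (simp add: of_rat_divide of_rat_power)

lemma real_of_rat_abs: "real_of_rat \<bar>q\<bar> = \<bar>real_of_rat q\<bar>"
  by (simp add: abs_if of_rat_minus)

lemma norm_total_iff: "norm_total P \<longleftrightarrow> valid_norm P"
proof
  assume L: "norm_total P"
  have *: "\<bar>norm_approx P x n - pnorm P x\<bar> \<le> 1 / 2 ^ n" if "x \<in> points P" for x n
    using L that unfolding norm_total_def norm_approx_def by (metis option.sel)
  have "\<bar>Q (the (norm_fun P x m)) - Q (the (norm_fun P x n))\<bar> \<le> 1 / 2 ^ m + 1 / 2 ^ n"
    if "x \<in> points P" for x m n
  proof -
    have "\<bar>norm_approx P x m - norm_approx P x n\<bar> \<le> 1 / 2 ^ m + 1 / 2 ^ n"
      using *[OF that, of m] *[OF that, of n] by linarith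
    then have "real_of_rat \<bar>Q (the (norm_fun P x m)) - Q (the (norm_fun P x n))\<bar>
        \<le> real_of_rat (1 / 2 ^ m + 1 / 2 ^ n)"
      by (simp add: norm_approx_def real_of_rat_abs of_rat_diff of_rat_add of_rat_inverse_power2)
    then show ?thesis unfolding of_rat_less_eq .
  qed
  then show "valid_norm P" using L unfolding valid_norm_def norm_total_def by blast
next
  assume R: "valid_norm P"
  have "\<bar>norm_approx P x n - pnorm P x\<bar> \<le> 1 / 2 ^ n" if "x \<in> points P" for x n
  proof -
    have d: "\<bar>norm_approx P x m - norm_approx P x n\<bar> \<le> 1 / 2 ^ m + 1 / 2 ^ n" for m n
    proof -
      have "real_of_rat \<bar>Q (the (norm_fun P x m)) - Q (the (norm_fun P x n))\<bar>
        \<le> real_of_rat (1 / 2 ^ m + 1 / 2 ^ n)"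
        unfolding of_rat_less_eq using R that unfolding valid_norm_def by blast
      then show ?thesis
        by (simp add: norm_approx_def real_of_rat_abs of_rat_diff of_rat_add of_rat_inverse_power2)
    qed
    have z: "(\<lambda>n. 1 / 2 ^ n :: real) \<longlonglongrightarrow> 0"
      using LIMSEQ_realpow_zero[of "1/2::real"] by (simp add: power_one_over)
    have "Cauchy (norm_approx P x)"
    proof (rule metric_CauchyI)
      fix \<epsilon> :: real assume "\<epsilon> > 0"
      then obtain M where M: "\<And>n. n \<ge> M \<Longrightarrow> 1 / 2 ^ n < \<epsilon> / 2"
        using z[THEN order_tendstoD(2), of "\<epsilon>/2"] by (auto simp: eventually_sequentially)
      have "dist (norm_approx P x m) (norm_approx P x n) < \<epsilon>" if "m \<ge> M" "n \<ge> M" for m n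
        using d[of m n] M[OF that(1)] M[OF that(2)] unfolding dist_real_def by linarith
      then show "\<exists>M. \<forall>m\<ge>M. \<forall>n\<ge>M. dist (norm_approx P x m) (norm_approx P x n) < \<epsilon>" by blast
    qed
    then have "norm_approx P x \<longlonglongrightarrow> lim (norm_approx P x)"
      by (simp add: Cauchy_convergent_iff convergent_LIMSEQ_iff)
    then have lim: "norm_approx P x \<longlonglongrightarrow> pnorm P x"
      by (simp add: norm_approx_def[abs_def] pnorm_def)
    \<comment> \<open>Letting \<open>m\<close> tend to infinity in \<open>d\<close> replaces the
      approximation at \<open>m\<close> by the norm and removes its error.\<close>
    have "(\<lambda>m. \<bar>norm_approx P x m - norm_approx P x n\<bar>) \<longlonglongrightarrow> \<bar>pnorm P x - norm_approx P x n\<bar>"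
      by (intro tendsto_intros lim)
    moreover have "(\<lambda>m. 1 / 2 ^ m + 1 / 2 ^ n :: real) \<longlonglongrightarrow> 0 + 1 / 2 ^ n"
      by (intro tendsto_intros z)
    ultimately have "\<bar>pnorm P x - norm_approx P x n\<bar> \<le> 0 + 1 / 2 ^ n"
      by (rule LIMSEQ_le) (use d in auto)
    then show ?thesis by (simp add: abs_minus_commute)
  qed
  then show "norm_total P" using R unfolding norm_total_def valid_norm_def norm_approx_def
    by (metis option.sel)
qed

lemma nlt_iff:
  assumes "norm_total P" "x \<in> points P"
  shows "nlt P x q \<longleftrightarrow> pnorm P x < real_of_rat q"
proof -
  have *: "\<bar>norm_approx P x n - pnorm P x\<bar> \<le> 1 / 2 ^ n" for n
    using assms unfolding norm_total_def norm_approx_def by (metis option.sel)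
  have nlt: "nlt P x q \<longleftrightarrow> (\<exists>n. norm_approx P x n + 1 / 2 ^ n < real_of_rat q)"
    unfolding nlt_def norm_approx_def of_rat_inverse_power2[symmetric] of_rat_add[symmetric] of_rat_less ..
  show ?thesis
  proof
    assume "nlt P x q"
    then obtain n where "norm_approx P x n + 1 / 2 ^ n < real_of_rat q" using nlt by blast
    with *[of n] show "pnorm P x < real_of_rat q" by linarith
  next
    assume a: "pnorm P x < real_of_rat q"
    \<comment> \<open>Half of the gap, because the error enters twice: in the approximation and in
      the margin that \<open>nlt\<close> adds.\<close>
    obtain n where "(1/2) ^ n < (real_of_rat q - pnorm P x) / 2"
      using real_arch_pow_inv[of "(real_of_rat q - pnorm P x) / 2" "1/2"] a by auto
    then have "1 / 2 ^ n < (real_of_rat q - pnorm P x) / 2" by (simp add: power_one_over)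
    moreover have "norm_approx P x n \<le> pnorm P x + 1 / 2 ^ n" using *[of n] by linarith
    ultimately have "norm_approx P x n + 1 / 2 ^ n < real_of_rat q" by (simp add: field_simps)
    then show "nlt P x q" using nlt by blast
  qed
qed

lemma le_if_less_of_rat:
  assumes "\<And>q. y < real_of_rat q \<Longrightarrow> x \<le> real_of_rat q"
  shows "x \<le> y"
proof (rule ccontr)
  assume "\<not> x \<le> y"
  then obtain q where "y < real_of_rat q" "real_of_rat q < x" using of_rat_dense[of y x] by auto
  with assms[of q] show False by simp
qed

lemma of_rat_le_imp_le:
  assumes "\<And>q. real_of_rat q \<le> x \<Longrightarrow> real_of_rat q \<le> y"
  shows "x \<le> y"
proof (rule ccontr)
  assume "\<not> x \<le> y"
  then obtain q where "y < real_of_rat q" "real_of_rat q < x" using of_rat_dense[of y x] by auto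
  with assms[of q] show False by simp
qed

lemma rat_normed_space_iff:
  assumes ops: "ops_total P" and nt: "norm_total P"
  shows "rat_normed_space (points P) (padd P) (pscale P) z (pnorm P) \<longleftrightarrow> valid_axioms P z"
proof
  assume "rat_normed_space (points P) (padd P) (pscale P) z (pnorm P)"
  then interpret rat_normed_space "points P" "padd P" "pscale P" z "pnorm P" .
  note sc = sc_eq_pscale[OF ops] and nl = nlt_iff[OF nt]
  have nz: "pnorm P z = 0" using norm_eq_zero zero_closed by blast
  have sc0: "pscale P 0 x = z" if "x \<in> points P" for x
  proof -
    have "pnorm P (pscale P 0 x) = 0" using norm_scale[OF that, of 0] by simp
    then show ?thesis using norm_eq_zero scale_closed that by blast
  qed
  have cl: "sc P c x \<in> points P" if "x \<in> points P" for c x using sc scale_closed that by simp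
  have 1: "(\<forall>a. 0 < Q a \<longrightarrow> nlt P x (Q a)) \<longleftrightarrow> x = z" if x: "x \<in> points P" for x
  proof
    assume "\<forall>a. 0 < Q a \<longrightarrow> nlt P x (Q a)"
    then have "\<forall>q. 0 < q \<longrightarrow> nlt P x q" by (metis ex_code)
    then have "pnorm P x \<le> 0"
      using nl[OF x] by - (rule le_if_less_of_rat, auto intro: less_imp_le)
    then show "x = z" using norm_nonneg norm_eq_zero x by fastforce
  qed (use nl[OF x] nz in auto)
  have 2: "nlt P (sc P c x) (\<bar>Q c\<bar> * Q a) \<longleftrightarrow> nlt P x (Q a)" if "x \<in> points P" "Q c \<noteq> 0" for x c a
    unfolding nl[OF scale_closed[OF that(1)]] nl[OF that(1)] sc[OF that(1)] norm_scale[OF that(1)]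
      of_rat_mult real_of_rat_abs
    using that(2) by (simp add: mult_less_cancel_left_pos)
  have 3: "nlt P (padd P x y) (Q a + Q b)"
    if "x \<in> points P" "y \<in> points P" "nlt P x (Q a)" "nlt P y (Q b)" for x y a b
    using that(3,4) norm_triangle[OF that(1,2)]
    unfolding nl[OF that(1)] nl[OF that(2)] nl[OF add_closed[OF that(1,2)]] of_rat_add by linarith
  have 4: "nlt P (sc P c x) (Q a)" if "x \<in> points P" "Q c = 0" "0 < Q a" for x c a
    unfolding sc[OF that(1)] that(2) sc0[OF that(1)] nl[OF zero_closed] nz using that(3) by simp
  have 5: "0 < Q a" if "x \<in> points P" "nlt P x (Q a)" for x a
  proof -
    have "0 < real_of_rat (Q a)" using that nl[of x "Q a"] norm_nonneg[of x] by linarith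
    then show ?thesis by simp
  qed
  show "valid_axioms P z"
    unfolding valid_axioms_def
    using zero_closed add_closed cl add_assoc add_commute add_zero add_inverse 1 2 3 4 5
    by (simp add: sc scale_add_right scale_add_left scale_scale scale_one scale_closed)
next
  assume V: "valid_axioms P z"
  note sc = sc_eq_pscale[OF ops, symmetric] and nl = nlt_iff[OF nt]
  have sca: "pscale P q x = sc P (SOME c. Q c = q) x" if "x \<in> points P" for q x
    using sc[OF that] someI_ex[OF ex_code[of q]] by metis
  note V' = V[unfolded valid_axioms_def]
  note vz = V'[THEN conjunct1]
  note vadd = V'[THEN conjunct2, THEN conjunct1, rule_format]
  note vsc = V'[THEN conjunct2, THEN conjunct2, THEN conjunct1, rule_format]
  note vassoc = V'[THEN conjunct2, THEN conjunct2, THEN conjunct2, THEN conjunct1, rule_format]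
  note vcomm = V'[THEN conjunct2, THEN conjunct2, THEN conjunct2, THEN conjunct2, THEN conjunct1, rule_format]
  note vzero = V'[THEN conjunct2, THEN conjunct2, THEN conjunct2, THEN conjunct2, THEN conjunct2, THEN conjunct1, rule_format]
  note vinv = V'[THEN conjunct2, THEN conjunct2, THEN conjunct2, THEN conjunct2, THEN conjunct2, THEN conjunct2, THEN conjunct1, rule_format]
  note vsadd = V'[THEN conjunct2, THEN conjunct2, THEN conjunct2, THEN conjunct2, THEN conjunct2, THEN conjunct2, THEN conjunct2, THEN conjunct1, rule_format]
  note vadds = V'[THEN conjunct2, THEN conjunct2, THEN conjunct2, THEN conjunct2, THEN conjunct2, THEN conjunct2, THEN conjunct2, THEN conjunct2, THEN conjunct1, rule_format]
  note vss = V'[THEN conjunct2, THEN conjunct2, THEN conjunct2, THEN conjunct2, THEN conjunct2, THEN conjunct2, THEN conjunct2, THEN conjunct2, THEN conjunct2, THEN conjunct1, rule_format]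
  note vone = V'[THEN conjunct2, THEN conjunct2, THEN conjunct2, THEN conjunct2, THEN conjunct2, THEN conjunct2, THEN conjunct2, THEN conjunct2, THEN conjunct2, THEN conjunct2, THEN conjunct1, rule_format]
  note vpos = V'[THEN conjunct2, THEN conjunct2, THEN conjunct2, THEN conjunct2, THEN conjunct2, THEN conjunct2, THEN conjunct2, THEN conjunct2, THEN conjunct2, THEN conjunct2, THEN conjunct2, THEN conjunct1, rule_format]
  note vnz = V'[THEN conjunct2, THEN conjunct2, THEN conjunct2, THEN conjunct2, THEN conjunct2, THEN conjunct2, THEN conjunct2, THEN conjunct2, THEN conjunct2, THEN conjunct2, THEN conjunct2, THEN conjunct2, THEN conjunct1, THEN bspec]
  note vn0 = V'[THEN conjunct2, THEN conjunct2, THEN conjunct2, THEN conjunct2, THEN conjunct2, THEN conjunct2, THEN conjunct2, THEN conjunct2, THEN conjunct2, THEN conjunct2, THEN conjunct2, THEN conjunct2, THEN conjunct2, THEN conjunct1, rule_format]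
  note vns = V'[THEN conjunct2, THEN conjunct2, THEN conjunct2, THEN conjunct2, THEN conjunct2, THEN conjunct2, THEN conjunct2, THEN conjunct2, THEN conjunct2, THEN conjunct2, THEN conjunct2, THEN conjunct2, THEN conjunct2, THEN conjunct2, THEN conjunct1, rule_format]
  note vtri = V'[THEN conjunct2, THEN conjunct2, THEN conjunct2, THEN conjunct2, THEN conjunct2, THEN conjunct2, THEN conjunct2, THEN conjunct2, THEN conjunct2, THEN conjunct2, THEN conjunct2, THEN conjunct2, THEN conjunct2, THEN conjunct2, THEN conjunct2, rule_format]
  have scl: "pscale P q x \<in> points P" if "x \<in> points P" for q x
    using vsc[OF that] sca[OF that] by simp
  have nn: "0 \<le> pnorm P x" if "x \<in> points P" for x
  proof (rule le_if_less_of_rat)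
    fix q assume "pnorm P x < real_of_rat q"
    moreover obtain a where "Q a = q" using ex_code by blast
    ultimately have "0 < q" using vpos[OF that, of a] nl[OF that] by simp
    then show "0 \<le> real_of_rat q" by simp
  qed
  have nz: "pnorm P x = 0 \<longleftrightarrow> x = z" if x: "x \<in> points P" for x
  proof -
    have "(\<forall>a. 0 < Q a \<longrightarrow> nlt P x (Q a)) \<longleftrightarrow> pnorm P x = 0"
    proof
      assume "\<forall>a. 0 < Q a \<longrightarrow> nlt P x (Q a)"
      then have "\<forall>q. 0 < q \<longrightarrow> nlt P x q" by (metis ex_code)
      then have "pnorm P x \<le> 0"
        using nl[OF x] by - (rule le_if_less_of_rat, auto intro: less_imp_le)
      then show "pnorm P x = 0" using nn[OF x] by simp
    qed (use nl[OF x] in auto)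
    then show ?thesis using vnz[OF x] by blast
  qed
  have tri: "pnorm P (padd P x y) \<le> pnorm P x + pnorm P y" if xy: "x \<in> points P" "y \<in> points P" for x y
  proof -
    have a: "padd P x y \<in> points P" using vadd xy by blast
    have sum: "pnorm P (padd P x y) \<le> real_of_rat q + real_of_rat p"
      if "pnorm P x < real_of_rat q" "pnorm P y < real_of_rat p" for p q
    proof -
      obtain c d where cd: "Q c = q" "Q d = p" using ex_code by meson
      have "nlt P (padd P x y) (Q c + Q d)"
        using vtri[OF xy conjI, of c d] that unfolding nl[OF xy(1)] nl[OF xy(2)] cd by simp
      then show ?thesis unfolding cd nl[OF a] of_rat_add by simp
    qed
    \<comment> \<open>The rational bounds are traded for norms one at a time, first \<open>q\<close>
      and then \<open>p\<close>.\<close>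
    have "pnorm P (padd P x y) - real_of_rat p \<le> pnorm P x" if "pnorm P y < real_of_rat p" for p
      by (rule le_if_less_of_rat) (use sum[OF _ that] in \<open>simp add: algebra_simps\<close>)
    then have "pnorm P (padd P x y) - pnorm P x \<le> real_of_rat p" if "pnorm P y < real_of_rat p" for p
      using that by (simp add: algebra_simps)
    then have "pnorm P (padd P x y) - pnorm P x \<le> pnorm P y"
      by (rule le_if_less_of_rat)
    then show ?thesis by simp
  qed
  have nsc: "pnorm P (pscale P q x) = \<bar>real_of_rat q\<bar> * pnorm P x" if x: "x \<in> points P" for q x
  proof -
    obtain c where c: "Q c = q" using ex_code by blast
    have sx: "sc P c x \<in> points P" using vsc x by blast
    show ?thesis
    proof (cases "q = 0")
      case True
      have "\<forall>a. 0 < Q a \<longrightarrow> nlt P (sc P c x) (Q a)" using vn0[OF x] True c by blast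
      then have "sc P c x = z" using vnz[OF sx] by blast
      then have "pnorm P (sc P c x) = 0" using nz sx by blast
      then show ?thesis using True c sc[OF x, of c] by simp
    next
      case False
      \<comment> \<open>Up to the positive factor both norms have the same strict rational upper
        bounds, hence they agree.\<close>
      have key: "pnorm P (sc P c x) < \<bar>real_of_rat q\<bar> * real_of_rat p \<longleftrightarrow> pnorm P x < real_of_rat p" for p
      proof -
        obtain a where a: "Q a = p" using ex_code by blast
        have "nlt P (sc P c x) (\<bar>Q c\<bar> * Q a) \<longleftrightarrow> nlt P x (Q a)" using vns[OF x] False c by blast
        then show ?thesis unfolding nl[OF x] nl[OF sx] a c of_rat_mult real_of_rat_abs .
      qed
      have q: "\<bar>real_of_rat q\<bar> > 0" using False by simp
      have "pnorm P (sc P c x) / \<bar>real_of_rat q\<bar> < real_of_rat p \<longleftrightarrow> pnorm P x < real_of_rat p" for p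
        using key[of p] q by (simp add: pos_divide_less_eq mult.commute)
      then have "pnorm P (sc P c x) / \<bar>real_of_rat q\<bar> = pnorm P x"
        by - (rule antisym; rule le_if_less_of_rat; blast intro: less_imp_le)
      then show ?thesis using q c sc[OF x, of c] by (auto simp: field_simps)
    qed
  qed
  show "rat_normed_space (points P) (padd P) (pscale P) z (pnorm P)"
  proof unfold_locales
    fix x q p assume x: "x \<in> points P"
    obtain a b where ab: "Q a = p" "Q b = q" using ex_code by meson
    obtain c d where cd: "Q c = p + q" "Q d = p * q" using ex_code by meson
    show "pscale P (p + q) x = padd P (pscale P p x) (pscale P q x)"
      using vadds[of c a b x] x sc[OF x] ab cd by metis
    have "sc P b x \<in> points P" using vsc x by blast
    moreover have "sc P a (sc P b x) = sc P d x" using vss x ab cd by simp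
    ultimately show "pscale P p (pscale P q x) = pscale P (p * q) x"
      using sc[OF x] sc ab cd by metis
    show "pscale P 1 x = x" using vone[OF _ x] sc[OF x] ex_code[of 1] by metis
  next
    fix x y q assume xy: "x \<in> points P" "y \<in> points P"
    obtain a where "Q a = q" using ex_code by meson
    moreover have "padd P x y \<in> points P" "sc P a (padd P x y) = padd P (sc P a x) (sc P a y)"
      using vadd vsadd xy by blast+
    ultimately show "pscale P q (padd P x y) = padd P (pscale P q x) (pscale P q y)"
      using sc xy by metis
  qed (rule vz | erule (2) vassoc | erule (1) vadd | erule (1) vcomm | erule vzero | erule scl
      | erule vinv | erule nn | erule nz | erule (1) tri | erule nsc)+
qed

lemma presents_normed_space_iff: "presents_normed_space P \<longleftrightarrow> valid P"
  unfolding presents_normed_space_def valid_def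
  using ops_total_iff norm_total_iff rat_normed_space_iff by blast

section \<open>The completion and dense embeddings into $C[0,1]$\<close>

locale normed_presentation =
  fixes P :: presentation
  assumes pns: "presents_normed_space P"
begin

definition pzero :: nat where
  "pzero = (SOME z. rat_normed_space (points P) (padd P) (pscale P) z (pnorm P))"

sublocale rat_normed_space "points P" "padd P" "pscale P" pzero "pnorm P"
  using pns someI_ex[of "\<lambda>z. rat_normed_space (points P) (padd P) (pscale P) z (pnorm P)"]
  unfolding presents_normed_space_def pzero_def by blast

abbreviation "V \<equiv> points P"
abbreviation "N \<equiv> pnorm P"
abbreviation "d \<equiv> pdist P"
abbreviation mns :: "nat \<Rightarrow> nat" where "mns x \<equiv> pscale P (-1) x"

lemmas closed [simp, intro] = zero_closed add_closed scale_closed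

lemma scale_zero: "x \<in> V \<Longrightarrow> pscale P 0 x = pzero"
  using norm_scale[of x 0] norm_eq_zero scale_closed by simp

lemma add_mns: "x \<in> V \<Longrightarrow> padd P x (mns x) = pzero"
  using scale_add_left[of x 1 "-1"] scale_one scale_zero by simp

lemma mns_mns: "x \<in> V \<Longrightarrow> mns (mns x) = x"
  by (simp add: scale_scale scale_one)

lemma add_left_commute:
  "x \<in> V \<Longrightarrow> y \<in> V \<Longrightarrow> w \<in> V \<Longrightarrow> padd P x (padd P y w) = padd P y (padd P x w)"
  using add_assoc add_commute by metis

lemma zero_add: "x \<in> V \<Longrightarrow> padd P pzero x = x"
  using add_commute add_zero by simp

lemma mns_add: "x \<in> V \<Longrightarrow> padd P (mns x) x = pzero"
  using add_mns add_commute by simp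

lemma dist_self: "x \<in> V \<Longrightarrow> d x x = 0"
  using norm_eq_zero[of pzero] zero_closed by (simp add: pdist_def add_mns)

lemma dist_nonneg: "x \<in> V \<Longrightarrow> y \<in> V \<Longrightarrow> 0 \<le> d x y"
  by (simp add: pdist_def norm_nonneg)

lemma dist_sym:
  assumes "x \<in> V" "y \<in> V" shows "d x y = d y x"
proof -
  have "mns (padd P x (mns y)) = padd P (mns x) (mns (mns y))"
    using assms by (intro scale_add_right) auto
  also have "\<dots> = padd P y (mns x)" using assms by (simp only: mns_mns) (auto intro: add_commute)
  finally have "N (padd P y (mns x)) = N (mns (padd P x (mns y)))" by simp
  also have "\<dots> = N (padd P x (mns y))" using assms norm_scale[of "padd P x (mns y)" "-1"] by simp
  finally show ?thesis by (simp add: pdist_def)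
qed

lemma dist_triangle:
  assumes "x \<in> V" "y \<in> V" "w \<in> V" shows "d x w \<le> d x y + d y w"
proof -
  have "padd P (padd P x (mns y)) (padd P y (mns w)) = padd P x (padd P (mns y) (padd P y (mns w)))"
    using assms by (intro add_assoc) auto
  also have "padd P (mns y) (padd P y (mns w)) = padd P (padd P (mns y) y) (mns w)"
    using assms by (intro add_assoc[symmetric]) auto
  also have "\<dots> = mns w" using assms by (simp add: mns_add zero_add)
  finally show ?thesis
    using norm_triangle[of "padd P x (mns y)" "padd P y (mns w)"] assms by (simp add: pdist_def)
qed

lemma dist_add:
  assumes "x \<in> V" "y \<in> V" "x' \<in> V" "y' \<in> V"
  shows "d (padd P x y) (padd P x' y') \<le> d x x' + d y y'"
proof -
  have "padd P (padd P x y) (mns (padd P x' y')) = padd P (padd P x y) (padd P (mns x') (mns y'))"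
    using assms by (simp add: scale_add_right)
  also have "\<dots> = padd P x (padd P y (padd P (mns x') (mns y')))"
    using assms by (intro add_assoc) auto
  also have "\<dots> = padd P x (padd P (mns x') (padd P y (mns y')))"
    using assms by (simp add: add_left_commute[of y])
  also have "\<dots> = padd P (padd P x (mns x')) (padd P y (mns y'))"
    using assms by (intro add_assoc[symmetric]) auto
  finally show ?thesis
    using norm_triangle[of "padd P x (mns x')" "padd P y (mns y')"] assms by (simp add: pdist_def)
qed

lemma dist_scale:
  assumes "x \<in> V" "y \<in> V" shows "d (pscale P q x) (pscale P q y) = \<bar>real_of_rat q\<bar> * d x y"
proof -
  have "padd P (pscale P q x) (mns (pscale P q y)) = pscale P q (padd P x (mns y))"
    using assms by (simp add: scale_add_right scale_scale)
  then show ?thesis using assms norm_scale[of "padd P x (mns y)" q] by (simp add: pdist_def)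
qed

lemma dist_scale_left:
  assumes "x \<in> V" shows "d (pscale P p x) (pscale P q x) = \<bar>real_of_rat p - real_of_rat q\<bar> * N x"
proof -
  have "padd P (pscale P p x) (mns (pscale P q x)) = pscale P (p - q) x"
    using assms scale_add_left[of x p "-q"] by (simp add: scale_scale)
  then show ?thesis using assms norm_scale[of x "p - q"] by (simp add: pdist_def of_rat_diff)
qed

lemma norm_le_dist:
  assumes "x \<in> V" "y \<in> V" shows "N x \<le> N y + d x y"
proof -
  have "padd P (padd P x (mns y)) y = padd P x (padd P (mns y) y)"
    using assms by (intro add_assoc) auto
  also have "\<dots> = x" using assms by (simp add: mns_add add_zero)
  finally show ?thesis using norm_triangle[of "padd P x (mns y)" y] assms by (simp add: pdist_def)
qed

section \<open>Cauchy sequences modulo null sequences\<close>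

abbreviation "CS \<equiv> cauchy_seqs P"
abbreviation "cls s \<equiv> null_rel P `` {s}"

lemma CS_points: "s \<in> CS \<Longrightarrow> s n \<in> V"
  by (auto simp: cauchy_seqs_def)

lemma CS_cauchy:
  assumes "s \<in> CS" "\<epsilon> > 0"
  obtains M where "\<And>m n. m \<ge> M \<Longrightarrow> n \<ge> M \<Longrightarrow> d (s m) (s n) < \<epsilon>"
proof -
  have "\<exists>M. \<forall>m\<ge>M. \<forall>n\<ge>M. d (s m) (s n) < \<epsilon>" using assms by (simp add: cauchy_seqs_def)
  with that show ?thesis by metis
qed

lemma CS_I:
  assumes "\<And>n. s n \<in> V" "\<And>\<epsilon>. \<epsilon> > 0 \<Longrightarrow> \<exists>M. \<forall>m\<ge>M. \<forall>n\<ge>M. d (s m) (s n) < \<epsilon>"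
  shows "s \<in> CS"
  by (simp add: cauchy_seqs_def image_subset_iff assms)

lemma null_relD:
  assumes "(s, t) \<in> null_rel P"
  shows "s \<in> CS" "t \<in> CS" "(\<lambda>n. d (s n) (t n)) \<longlonglongrightarrow> 0"
  using assms by (auto simp: null_rel_def)

lemma null_relI:
  "s \<in> CS \<Longrightarrow> t \<in> CS \<Longrightarrow> (\<lambda>n. d (s n) (t n)) \<longlonglongrightarrow> 0 \<Longrightarrow> (s, t) \<in> null_rel P"
  by (auto simp: null_rel_def)

lemma equiv_null_rel: "equiv CS (null_rel P)"
proof (rule equivI)
  show "null_rel P \<subseteq> CS \<times> CS" by (auto simp: null_rel_def)
  show "refl_on CS (null_rel P)"
    by (rule refl_onI) (auto simp: null_rel_def dist_self CS_points)
  show "sym (null_rel P)"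
    by (rule symI) (auto simp: null_rel_def dist_sym CS_points)
  show "trans (null_rel P)"
  proof (rule transI)
    fix s t u assume a: "(s, t) \<in> null_rel P" "(t, u) \<in> null_rel P"
    note st = null_relD[OF a(1)] and tu = null_relD[OF a(2)]
    have "(\<lambda>n. d (s n) (t n) + d (t n) (u n)) \<longlonglongrightarrow> 0"
      using tendsto_add[OF st(3) tu(3)] by simp
    then have "(\<lambda>n. d (s n) (u n)) \<longlonglongrightarrow> 0"
      by (rule Lim_null_comparison[rotated])
        (auto intro!: always_eventually dist_triangle simp: dist_nonneg CS_points st tu)
    then show "(s, u) \<in> null_rel P" using st tu by (intro null_relI)
  qed
qed

lemma cls_eq: "(s, t) \<in> null_rel P \<Longrightarrow> cls s = cls t"
  using equiv_class_eq[OF equiv_null_rel] .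

lemma self_in_cls: "s \<in> CS \<Longrightarrow> s \<in> cls s"
  using equiv_class_self[OF equiv_null_rel] .

lemma CS_bounded:
  assumes "s \<in> CS" obtains b where "\<And>n. N (s n) \<le> b" "b > 0"
proof -
  obtain M where M: "\<And>m n. m \<ge> M \<Longrightarrow> n \<ge> M \<Longrightarrow> d (s m) (s n) < 1"
    using CS_cauchy[OF assms, of 1] by auto
  define b where "b = (\<Sum>n\<le>M. N (s n)) + 1"
  have nn: "0 \<le> N (s n)" for n using norm_nonneg CS_points assms by blast
  have "N (s n) \<le> b" for n
  proof (cases "n \<le> M")
    case True
    then have "N (s n) \<le> (\<Sum>n\<le>M. N (s n))" using nn by (intro member_le_sum) auto
    then show ?thesis by (simp add: b_def)
  next
    case False
    have "N (s n) \<le> N (s M) + d (s n) (s M)" using norm_le_dist CS_points assms by blast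
    moreover have "d (s n) (s M) < 1" using M False by simp
    moreover have "N (s M) \<le> (\<Sum>n\<le>M. N (s n))" using nn by (intro member_le_sum) auto
    ultimately show ?thesis by (simp add: b_def)
  qed
  moreover have "b > 0" unfolding b_def using nn by (simp add: add_nonneg_pos sum_nonneg)
  ultimately show ?thesis using that by blast
qed

lemma CS_add:
  assumes s: "s \<in> CS" and t: "t \<in> CS" shows "(\<lambda>n. padd P (s n) (t n)) \<in> CS"
proof (rule CS_I)
  fix \<epsilon> :: real assume "\<epsilon> > 0"
  then have "\<epsilon> / 2 > 0" by simp
  obtain M where M: "\<And>m n. m \<ge> M \<Longrightarrow> n \<ge> M \<Longrightarrow> d (s m) (s n) < \<epsilon> / 2"
    using CS_cauchy[OF s \<open>\<epsilon> / 2 > 0\<close>] by blast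
  obtain M' where M': "\<And>m n. m \<ge> M' \<Longrightarrow> n \<ge> M' \<Longrightarrow> d (t m) (t n) < \<epsilon> / 2"
    using CS_cauchy[OF t \<open>\<epsilon> / 2 > 0\<close>] by blast
  have "d (padd P (s m) (t m)) (padd P (s n) (t n)) < \<epsilon>" if "m \<ge> max M M'" "n \<ge> max M M'" for m n
    using dist_add[of "s m" "t m" "s n" "t n"] M[of m n] M'[of m n] that CS_points[OF s] CS_points[OF t]
    by fastforce
  then show "\<exists>M. \<forall>m\<ge>M. \<forall>n\<ge>M. d (padd P (s m) (t m)) (padd P (s n) (t n)) < \<epsilon>" by blast
qed (use CS_points s t in blast)

lemma null_rel_add:
  assumes "(s, s') \<in> null_rel P" "(t, t') \<in> null_rel P"
  shows "(\<lambda>n. padd P (s n) (t n), \<lambda>n. padd P (s' n) (t' n)) \<in> null_rel P"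
proof (rule null_relI)
  note s = null_relD[OF assms(1)] and t = null_relD[OF assms(2)]
  show "(\<lambda>n. padd P (s n) (t n)) \<in> CS" "(\<lambda>n. padd P (s' n) (t' n)) \<in> CS"
    using s t by (auto intro: CS_add)
  have "(\<lambda>n. d (s n) (s' n) + d (t n) (t' n)) \<longlonglongrightarrow> 0"
    using tendsto_add[OF s(3) t(3)] by simp
  then show "(\<lambda>n. d (padd P (s n) (t n)) (padd P (s' n) (t' n))) \<longlonglongrightarrow> 0"
    by (rule Lim_null_comparison[rotated])
      (auto intro!: always_eventually dist_add simp: dist_nonneg CS_points s t)
qed

text \<open>Triangle inequality through \<open>pscale P p y\<close>, where first the vector and then
  the scalar changes.\<close>

lemma dist_scale_both:
  assumes "x \<in> V" "y \<in> V"
  shows "d (pscale P p x) (pscale P q y) \<le> \<bar>real_of_rat p\<bar> * d x y + \<bar>real_of_rat p - real_of_rat q\<bar> * N y"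
  using dist_triangle[of "pscale P p x" "pscale P p y" "pscale P q y"] assms
  by (simp add: dist_scale dist_scale_left del: abs_of_rat)

lemma CS_scale:
  assumes s: "s \<in> CS" and q: "(\<lambda>n. real_of_rat (q n)) \<longlonglongrightarrow> r"
  shows "(\<lambda>n. pscale P (q n) (s n)) \<in> CS"
proof (rule CS_I)
  fix \<epsilon> :: real assume \<epsilon>: "\<epsilon> > 0"
  obtain b where b: "\<And>n. N (s n) \<le> b" "b > 0" using CS_bounded[OF s] by blast
  obtain a where a: "a > 0" "\<And>n. \<bar>real_of_rat (q n)\<bar> \<le> a"
    using convergent_imp_Bseq[OF convergentI[OF q]] unfolding Bseq_def real_norm_def by blast
  have e2: "\<epsilon> / (2 * a) > 0" "\<epsilon> / (2 * b) > 0" using \<epsilon> a b by simp_all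
  obtain M where M: "\<And>m n. m \<ge> M \<Longrightarrow> n \<ge> M \<Longrightarrow> d (s m) (s n) < \<epsilon> / (2 * a)"
    using CS_cauchy[OF s e2(1)] by blast
  obtain M' where M': "\<And>m n. m \<ge> M' \<Longrightarrow> n \<ge> M' \<Longrightarrow> dist (real_of_rat (q m)) (real_of_rat (q n)) < \<epsilon> / (2 * b)"
    using metric_CauchyD[OF LIMSEQ_imp_Cauchy[OF q] e2(2)] by blast
  have "d (pscale P (q m) (s m)) (pscale P (q n) (s n)) < \<epsilon>" if mn: "m \<ge> max M M'" "n \<ge> max M M'" for m n
  proof -
    have "\<bar>real_of_rat (q m)\<bar> * d (s m) (s n) \<le> a * d (s m) (s n)"
      using a(2)[of m] dist_nonneg CS_points[OF s] by (intro mult_right_mono) auto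
    also have "\<dots> < a * (\<epsilon> / (2 * a))"
      using M[of m n] mn a(1) by (intro mult_strict_left_mono) auto
    finally have 1: "\<bar>real_of_rat (q m)\<bar> * d (s m) (s n) < \<epsilon> / 2" using a(1) by simp
    have "\<bar>real_of_rat (q m) - real_of_rat (q n)\<bar> * N (s n) \<le> \<bar>real_of_rat (q m) - real_of_rat (q n)\<bar> * b"
      using b(1)[of n] by (intro mult_left_mono) auto
    also have "\<dots> \<le> (\<epsilon> / (2 * b)) * b"
      using M'[of m n] mn b(2) by (intro mult_right_mono) (auto simp: dist_real_def)
    finally have 2: "\<bar>real_of_rat (q m) - real_of_rat (q n)\<bar> * N (s n) \<le> \<epsilon> / 2" using b(2) by simp
    show ?thesis
      using dist_scale_both[of "s m" "s n" "q m" "q n"] CS_points[OF s] 1 2 by fastforce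
  qed
  then show "\<exists>M. \<forall>m\<ge>M. \<forall>n\<ge>M. d (pscale P (q m) (s m)) (pscale P (q n) (s n)) < \<epsilon>" by blast
qed (use CS_points s in blast)

lemma null_rel_scale:
  assumes st: "(s, t) \<in> null_rel P" and q: "(\<lambda>n. real_of_rat (q n)) \<longlonglongrightarrow> r"
    and p: "(\<lambda>n. real_of_rat (p n)) \<longlonglongrightarrow> r"
  shows "(\<lambda>n. pscale P (q n) (s n), \<lambda>n. pscale P (p n) (t n)) \<in> null_rel P"
proof (rule null_relI)
  note s = null_relD[OF st]
  show "(\<lambda>n. pscale P (q n) (s n)) \<in> CS" "(\<lambda>n. pscale P (p n) (t n)) \<in> CS"
    using s q p by (auto intro: CS_scale)
  obtain b where b: "\<And>n. N (t n) \<le> b" "b > 0" using CS_bounded[OF s(2)] by blast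
  have "(\<lambda>n. \<bar>real_of_rat (q n)\<bar> * d (s n) (t n) + \<bar>real_of_rat (q n) - real_of_rat (p n)\<bar> * b)
    \<longlonglongrightarrow> \<bar>r\<bar> * 0 + \<bar>r - r\<bar> * b"
    by (intro tendsto_intros s p q)
  then have lim: "(\<lambda>n. \<bar>real_of_rat (q n)\<bar> * d (s n) (t n) + \<bar>real_of_rat (q n) - real_of_rat (p n)\<bar> * b)
    \<longlonglongrightarrow> 0" by simp
  have le: "d (pscale P (q n) (s n)) (pscale P (p n) (t n))
    \<le> \<bar>real_of_rat (q n)\<bar> * d (s n) (t n) + \<bar>real_of_rat (q n) - real_of_rat (p n)\<bar> * b" for n
  proof -
    have "\<bar>real_of_rat (q n) - real_of_rat (p n)\<bar> * N (t n) \<le> \<bar>real_of_rat (q n) - real_of_rat (p n)\<bar> * b"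
      using b(1)[of n] by (intro mult_left_mono) auto
    then show ?thesis
      using dist_scale_both[of "s n" "t n" "q n" "p n"] CS_points[OF s(1)] CS_points[OF s(2)] by fastforce
  qed
  show "(\<lambda>n. d (pscale P (q n) (s n)) (pscale P (p n) (t n))) \<longlonglongrightarrow> 0"
    by (rule Lim_null_comparison[OF always_eventually lim])
      (use le dist_nonneg CS_points[OF s(1)] CS_points[OF s(2)] in auto)
qed

text \<open>The unions in \<open>banach_completion\<close> run over all representatives; each of
  them contributes the same class, and the index sets are nonempty.\<close>

lemma nadd_cls:
  assumes "s \<in> CS" "t \<in> CS"
  shows "nadd (banach_completion P) (cls s) (cls t) = cls (\<lambda>n. padd P (s n) (t n))"
proof -
  have eq: "cls (\<lambda>n. padd P (s' n) (t' n)) = cls (\<lambda>n. padd P (s n) (t n))"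
    if "s' \<in> cls s" "t' \<in> cls t" for s' t'
    using that by (intro cls_eq[symmetric] null_rel_add) auto
  have ne: "cls s \<noteq> {}" "cls t \<noteq> {}" using self_in_cls assms by blast+
  have "nadd (banach_completion P) (cls s) (cls t)
      = (\<Union>s'\<in>cls s. \<Union>t'\<in>cls t. cls (\<lambda>n. padd P (s' n) (t' n)))"
    by (simp add: banach_completion_def)
  also have "\<dots> = (\<Union>s'\<in>cls s. \<Union>t'\<in>cls t. cls (\<lambda>n. padd P (s n) (t n)))"
    by (intro SUP_cong refl eq)
  finally show ?thesis unfolding UN_constant by (simp only: ne if_False)
qed

lemma nscale_cls:
  assumes s: "s \<in> CS" and q: "(\<lambda>n. real_of_rat (q n)) \<longlonglongrightarrow> r"
  shows "nscale (banach_completion P) r (cls s) = cls (\<lambda>n. pscale P (q n) (s n))"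
proof -
  have eq: "cls (\<lambda>n. pscale P (q' n) (s' n)) = cls (\<lambda>n. pscale P (q n) (s n))"
    if "s' \<in> cls s" "(\<lambda>n. real_of_rat (q' n)) \<longlonglongrightarrow> r" for s' q'
    using that q by (intro cls_eq[symmetric] null_rel_scale) auto
  let ?A = "{q. (\<lambda>n. real_of_rat (q n)) \<longlonglongrightarrow> r}"
  have ne: "cls s \<noteq> {}" "?A \<noteq> {}" using self_in_cls[OF s] q by blast+
  have "nscale (banach_completion P) r (cls s)
      = (\<Union>s'\<in>cls s. \<Union>q'\<in>?A. cls (\<lambda>n. pscale P (q' n) (s' n)))"
    by (simp add: banach_completion_def)
  also have "\<dots> = (\<Union>s'\<in>cls s. \<Union>q'\<in>?A. cls (\<lambda>n. pscale P (q n) (s n)))"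
    by (intro SUP_cong refl eq) simp_all
  finally show ?thesis unfolding UN_constant by (simp only: ne if_False)
qed

lemma CS_norm_convergent:
  assumes s: "s \<in> CS" shows "(\<lambda>n. N (s n)) \<longlonglongrightarrow> lim (\<lambda>n. N (s n))"
proof -
  have "Cauchy (\<lambda>n. N (s n))"
  proof (rule metric_CauchyI)
    fix \<epsilon> :: real assume "\<epsilon> > 0"
    then obtain M where M: "\<And>m n. m \<ge> M \<Longrightarrow> n \<ge> M \<Longrightarrow> d (s m) (s n) < \<epsilon>"
      using CS_cauchy[OF s] by blast
    have "dist (N (s m)) (N (s n)) < \<epsilon>" if "m \<ge> M" "n \<ge> M" for m n
      using M[OF that] M[OF that(2,1)] norm_le_dist[of "s m" "s n"] norm_le_dist[of "s n" "s m"]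
        CS_points[OF s] by (fastforce simp: dist_real_def abs_less_iff)
    then show "\<exists>M. \<forall>m\<ge>M. \<forall>n\<ge>M. dist (N (s m)) (N (s n)) < \<epsilon>" by blast
  qed
  then show ?thesis by (simp add: Cauchy_convergent_iff convergent_LIMSEQ_iff)
qed

lemma nnorm_cls:
  assumes s: "s \<in> CS"
  shows "nnorm (banach_completion P) (cls s) = lim (\<lambda>n. N (s n))"
proof -
  define t where "t = (SOME t. t \<in> cls s)"
  have "t \<in> cls s" unfolding t_def using someI[of "\<lambda>t. t \<in> cls s", OF self_in_cls[OF s]] .
  then have st: "(s, t) \<in> null_rel P" by simp
  note st = null_relD[OF st]
  have "(\<lambda>n. N (t n) - N (s n)) \<longlonglongrightarrow> 0"
  proof (rule Lim_null_comparison[OF always_eventually st(3)], intro allI)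
    fix n show "norm (N (t n) - N (s n)) \<le> d (s n) (t n)"
      using norm_le_dist[of "s n" "t n"] norm_le_dist[of "t n" "s n"] dist_sym[of "s n" "t n"]
        CS_points[OF st(1)] CS_points[OF st(2)] by (simp add: abs_le_iff)
  qed
  from tendsto_add[OF this CS_norm_convergent[OF s]]
  have "(\<lambda>n. N (t n)) \<longlonglongrightarrow> lim (\<lambda>n. N (s n))" by simp
  then have "lim (\<lambda>n. N (t n)) = lim (\<lambda>n. N (s n))" by (rule limI)
  then show ?thesis by (simp add: banach_completion_def t_def)
qed

lemma ncarrier_completion: "ncarrier (banach_completion P) = CS // null_rel P"
  by (simp add: banach_completion_def)

lemma cls_in_carrier: "s \<in> CS \<Longrightarrow> cls s \<in> ncarrier (banach_completion P)"
  unfolding ncarrier_completion by (rule quotientI)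

lemma carrier_cases:
  assumes "X \<in> ncarrier (banach_completion P)" obtains s where "s \<in> CS" "X = cls s"
  using assms unfolding ncarrier_completion by (rule quotientE)

lemma const_CS: "x \<in> V \<Longrightarrow> (\<lambda>n. x) \<in> CS"
  by (rule CS_I) (auto simp: dist_self)

end

text \<open>A rational-linear isometric embedding of the presented space itself with dense image:
  the form in which the completion is eliminated. Isometry is expressed through bounds
  \<open>c\<close>, without a supremum.\<close>

locale C01_rep = normed_presentation +
  fixes J :: "nat \<Rightarrow> real \<Rightarrow> real"
  assumes J_cont: "x \<in> points P \<Longrightarrow> continuous_on {0..1} (J x)"
    and J_add: "x \<in> points P \<Longrightarrow> y \<in> points P \<Longrightarrow> t \<in> {0..1} \<Longrightarrow> J (padd P x y) t = J x t + J y t"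
    and J_scale: "x \<in> points P \<Longrightarrow> t \<in> {0..1} \<Longrightarrow> J (pscale P q x) t = real_of_rat q * J x t"
    and J_norm: "x \<in> points P \<Longrightarrow> pnorm P x \<le> c \<longleftrightarrow> (\<forall>t\<in>{0..1}. \<bar>J x t\<bar> \<le> c)"
    and J_dense: "continuous_on {0..1} F \<Longrightarrow> \<epsilon> > 0 \<Longrightarrow> \<exists>x\<in>points P. \<forall>t\<in>{0..1}. \<bar>J x t - F t\<bar> < \<epsilon>"

lemma SUP_abs_le_iff:
  fixes f :: "real \<Rightarrow> real"
  assumes "continuous_on {0..1} f"
  shows "(SUP t\<in>{0..1}. \<bar>f t\<bar>) \<le> c \<longleftrightarrow> (\<forall>t\<in>{0..1}. \<bar>f t\<bar> \<le> c)"
proof -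
  have "compact ((\<lambda>t. \<bar>f t\<bar>) ` {0..1})"
    using assms by (intro compact_continuous_image continuous_intros) auto
  then have "bdd_above ((\<lambda>t. \<bar>f t\<bar>) ` {0..1})" by (intro bounded_imp_bdd_above compact_imp_bounded)
  then show ?thesis by (subst cSUP_le_iff) auto
qed

text \<open>The isomorphism is restricted to classes of constant sequences, which are dense in the
  completion.\<close>

lemma (in normed_presentation) ex_C01_rep:
  assumes "isometrically_isomorphic (banach_completion P) C01"
  shows "\<exists>J. C01_rep P J"
proof -
  let ?X = "banach_completion P"
  obtain T where bij: "bij_betw T (ncarrier ?X) (ncarrier C01)"
    and Tadd: "\<And>x y. x \<in> ncarrier ?X \<Longrightarrow> y \<in> ncarrier ?X \<Longrightarrow> T (nadd ?X x y) = nadd C01 (T x) (T y)"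
    and Tscale: "\<And>r x. x \<in> ncarrier ?X \<Longrightarrow> T (nscale ?X r x) = nscale C01 r (T x)"
    and Tnorm: "\<And>x. x \<in> ncarrier ?X \<Longrightarrow> nnorm C01 (T x) = nnorm ?X x"
    using assms unfolding isometrically_isomorphic_def by blast
  define J where "J = (\<lambda>x. T (cls (\<lambda>n. x)))"
  have Tcont: "continuous_on {0..1} (T X)" if "X \<in> ncarrier ?X" for X
    using bij_betw_apply[OF bij that] by (simp add: C01_def)
  have le_iff: "lim (\<lambda>n. N (s n)) \<le> c \<longleftrightarrow> (\<forall>t\<in>{0..1}. \<bar>T (cls s) t\<bar> \<le> c)" if "s \<in> CS" for s c
    using Tnorm[OF cls_in_carrier[OF that]] nnorm_cls[OF that]
      SUP_abs_le_iff[OF Tcont[OF cls_in_carrier[OF that]]] by (simp add: C01_def)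
  have add: "T (cls (\<lambda>n. padd P (s n) (s' n))) t = T (cls s) t + T (cls s') t"
    if "s \<in> CS" "s' \<in> CS" "t \<in> {0..1}" for s s' t
    using Tadd[OF cls_in_carrier cls_in_carrier, of s s'] that by (simp add: nadd_cls C01_def)
  have scale: "T (cls (\<lambda>n. pscale P q (s n))) t = real_of_rat q * T (cls s) t"
    if "s \<in> CS" "t \<in> {0..1}" for s q t
    using Tscale[OF cls_in_carrier, of s "real_of_rat q"] that
      nscale_cls[OF that(1) tendsto_const[of "real_of_rat q"]] by (simp add: C01_def)
  have "C01_rep P J"
  proof unfold_locales
    show "continuous_on {0..1} (J x)" if "x \<in> V" for x
      unfolding J_def using Tcont cls_in_carrier const_CS that by blast
    show "J (padd P x y) t = J x t + J y t" if "x \<in> V" "y \<in> V" "t \<in> {0..1}" for x y t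
      unfolding J_def using add[OF const_CS const_CS] that by blast
    show "J (pscale P q x) t = real_of_rat q * J x t" if "x \<in> V" "t \<in> {0..1}" for x q t
      unfolding J_def using scale[OF const_CS] that by blast
    show "N x \<le> c \<longleftrightarrow> (\<forall>t\<in>{0..1}. \<bar>J x t\<bar> \<le> c)" if "x \<in> V" for x c
      using le_iff[OF const_CS[OF that], of c] by (simp add: J_def)
    show "\<exists>x\<in>V. \<forall>t\<in>{0..1}. \<bar>J x t - F t\<bar> < \<epsilon>"
      if F: "continuous_on {0..1} F" and \<epsilon>: "\<epsilon> > 0" for F :: "real \<Rightarrow> real" and \<epsilon> :: real
    proof -
      have "restrict F {0..1} \<in> ncarrier C01"
        using F continuous_on_cong[of "{0..1}" "{0..1}" "restrict F {0..1}" F] by (simp add: C01_def)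
      then have "restrict F {0..1} \<in> T ` ncarrier ?X" using bij_betw_imp_surj_on[OF bij] by simp
      then obtain X where X: "restrict F {0..1} = T X" "X \<in> ncarrier ?X" by (rule imageE)
      obtain s where s: "s \<in> CS" "X = cls s" using carrier_cases[OF X(2)] by blast
      \<comment> \<open>The vector \<open>s M\<close> is close to the class of \<open>s\<close>: the
        difference sequence \<open>u\<close> below has norms less than \<epsilon> / 2 from
        \<open>M\<close> on.\<close>
      obtain M where M: "\<And>m n. m \<ge> M \<Longrightarrow> n \<ge> M \<Longrightarrow> d (s m) (s n) < \<epsilon> / 2"
        using CS_cauchy[OF s(1), of "\<epsilon> / 2"] \<epsilon> by auto
      let ?x = "s M"
      have x: "?x \<in> V" using CS_points s by blast
      define u where "u = (\<lambda>n. padd P (s n) (pscale P (-1) ?x))"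
      have c1: "(\<lambda>n. pscale P (-1) ?x) \<in> CS" using const_CS x by blast
      have u: "u \<in> CS" unfolding u_def by (rule CS_add[OF s(1) c1])
      have "lim (\<lambda>n. N (u n)) \<le> \<epsilon> / 2"
      proof (rule LIMSEQ_le_const2[OF CS_norm_convergent[OF u]])
        show "\<exists>N'. \<forall>n\<ge>N'. N (u n) \<le> \<epsilon> / 2"
          using M[of _ M] by (intro exI[of _ M]) (force simp: u_def pdist_def)
      qed
      then have le: "\<forall>t\<in>{0..1}. \<bar>T (cls u) t\<bar> \<le> \<epsilon> / 2" using le_iff[OF u] by blast
      have "\<bar>J ?x t - F t\<bar> < \<epsilon>" if t: "t \<in> {0..1}" for t
      proof -
        have "T (cls u) t = T (cls s) t + T (cls (\<lambda>n. pscale P (-1) ?x)) t"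
          unfolding u_def by (rule add[OF s(1) c1 t])
        also have "\<dots> = F t - J ?x t"
          using scale[OF const_CS[OF x] t, of "-1"] X(1)[symmetric] s t by (simp add: J_def)
        finally show ?thesis using le[rule_format, OF t] \<epsilon> by linarith
      qed
      with x show ?thesis by blast
    qed
  qed
  then show ?thesis by blast
qed

section \<open>From a dense embedding to an isomorphism of the completion\<close>

context C01_rep
begin

lemma J_diff:
  assumes "x \<in> V" "y \<in> V" "t \<in> {0..1}"
  shows "J (padd P x (pscale P (-1) y)) t = J x t - J y t"
  using assms by (simp add: J_add J_scale)

lemma dist_le_iff:
  assumes "x \<in> V" "y \<in> V"
  shows "d x y \<le> c \<longleftrightarrow> (\<forall>t\<in>{0..1}. \<bar>J x t - J y t\<bar> \<le> c)"
  using assms J_norm[of "padd P x (pscale P (-1) y)" c] by (simp add: pdist_def J_diff)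

lemma J_dist: "x \<in> V \<Longrightarrow> y \<in> V \<Longrightarrow> t \<in> {0..1} \<Longrightarrow> \<bar>J x t - J y t\<bar> \<le> d x y"
  using dist_le_iff[of x y "d x y"] by blast

definition L :: "(nat \<Rightarrow> nat) \<Rightarrow> real \<Rightarrow> real" where
  "L s = (\<lambda>t\<in>{0..1}. lim (\<lambda>n. J (s n) t))"

lemma L_uniform:
  assumes s: "s \<in> CS"
  shows "uniform_limit {0..1} (\<lambda>n. J (s n)) (L s) sequentially"
proof -
  have "uniformly_Cauchy_on {0..1} (\<lambda>n. J (s n))"
    unfolding uniformly_Cauchy_on_def
  proof (intro allI impI)
    fix \<epsilon> :: real assume "\<epsilon> > 0"
    then obtain M where M: "\<And>m n. m \<ge> M \<Longrightarrow> n \<ge> M \<Longrightarrow> d (s m) (s n) < \<epsilon>"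
      using CS_cauchy[OF s] by blast
    have "dist (J (s m) t) (J (s n) t) < \<epsilon>" if "m \<ge> M" "n \<ge> M" "t \<in> {0..1}" for m n t
      using J_dist[of "s m" "s n" t] M[OF that(1,2)] CS_points[OF s] that by (fastforce simp: dist_real_def)
    then show "\<exists>M. \<forall>t\<in>{0..1}. \<forall>m\<ge>M. \<forall>n\<ge>M. dist (J (s m) t) (J (s n) t) < \<epsilon>" by blast
  qed
  then obtain l where l: "uniform_limit {0..1} (\<lambda>n. J (s n)) l sequentially"
    using Cauchy_uniformly_convergent uniformly_convergent_on_def by blast
  have "L s t = l t" if "t \<in> {0..1}" for t
    using limI[OF tendsto_uniform_limitI[OF l that]] that by (simp add: L_def)
  then show ?thesis using l by (subst uniform_limit_cong') auto
qed

lemma L_lim: "s \<in> CS \<Longrightarrow> t \<in> {0..1} \<Longrightarrow> (\<lambda>n. J (s n) t) \<longlonglongrightarrow> L s t"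
  using tendsto_uniform_limitI[OF L_uniform] .

lemma L_cont:
  assumes s: "s \<in> CS" shows "continuous_on {0..1} (L s)"
  by (rule uniform_limit_theorem[OF _ L_uniform[OF s]]) (use J_cont[OF CS_points[OF s]] in auto)

lemma L_eqI:
  assumes "s \<in> CS" "f \<in> extensional {0..1}" "\<And>t. t \<in> {0..1} \<Longrightarrow> (\<lambda>n. J (s n) t) \<longlonglongrightarrow> f t"
  shows "L s = f"
proof (rule extensionalityI[of _ "{0..1}"])
  show "L s \<in> extensional {0..1}" by (simp add: L_def)
  show "L s t = f t" if "t \<in> {0..1}" for t
    using LIMSEQ_unique[OF L_lim[OF assms(1) that] assms(3)[OF that]] .
qed (fact assms(2))

lemma L_eq_iff:
  assumes s: "s \<in> CS" and t: "t \<in> CS"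
  shows "L s = L t \<longleftrightarrow> (s, t) \<in> null_rel P"
proof
  assume "(s, t) \<in> null_rel P"
  then have lim: "(\<lambda>n. d (s n) (t n)) \<longlonglongrightarrow> 0" by (rule null_relD)
  show "L s = L t"
  proof (rule L_eqI[OF s])
    fix x :: real assume x: "x \<in> {0..1}"
    have "(\<lambda>n. J (s n) x - J (t n) x) \<longlonglongrightarrow> 0"
      by (rule Lim_null_comparison[OF always_eventually lim])
        (use J_dist CS_points s t x in auto)
    from tendsto_add[OF this L_lim[OF t x]] show "(\<lambda>n. J (s n) x) \<longlonglongrightarrow> L t x" by simp
  qed (simp add: L_def)
next
  assume eq: "L s = L t"
  show "(s, t) \<in> null_rel P"
  proof (rule null_relI[OF s t], rule LIMSEQ_I)
    fix \<epsilon> :: real assume \<epsilon>: "\<epsilon> > 0"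
    have "\<forall>\<^sub>F n in sequentially. \<forall>x\<in>{0..1}. dist (J (s n) x) (L s x) < \<epsilon> / 4"
      "\<forall>\<^sub>F n in sequentially. \<forall>x\<in>{0..1}. dist (J (t n) x) (L s x) < \<epsilon> / 4"
      using uniform_limitD[OF L_uniform[OF s], of "\<epsilon> / 4"] uniform_limitD[OF L_uniform[OF t], of "\<epsilon> / 4"] \<epsilon> eq
      by auto
    then have "\<forall>\<^sub>F n in sequentially. d (s n) (t n) \<le> \<epsilon> / 2"
    proof eventually_elim
      case (elim n)
      have "\<bar>J (s n) x - J (t n) x\<bar> \<le> \<epsilon> / 2" if "x \<in> {0..1}" for x
        using elim(1)[rule_format, OF that] elim(2)[rule_format, OF that] unfolding dist_real_def by linarith
      then show ?case using dist_le_iff CS_points s t by blast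
    qed
    then obtain M where M: "\<And>n. n \<ge> M \<Longrightarrow> d (s n) (t n) \<le> \<epsilon> / 2" by (auto simp: eventually_sequentially)
    have "norm (d (s n) (t n) - 0) < \<epsilon>" if "n \<ge> M" for n
      using M[OF that] dist_nonneg[OF CS_points[OF s] CS_points[OF t], of n n] \<epsilon> by simp
    then show "\<exists>M. \<forall>n\<ge>M. norm (d (s n) (t n) - 0) < \<epsilon>" by blast
  qed
qed

lemma L_norm:
  assumes s: "s \<in> CS"
  shows "(SUP t\<in>{0..1}. \<bar>L s t\<bar>) = lim (\<lambda>n. N (s n))"
proof (rule antisym)
  note lim = CS_norm_convergent[OF s]
  have "\<bar>L s t\<bar> \<le> lim (\<lambda>n. N (s n))" if t: "t \<in> {0..1}" for t
  proof (rule LIMSEQ_le[OF tendsto_rabs[OF L_lim[OF s t]] lim])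
    show "\<exists>M. \<forall>n\<ge>M. \<bar>J (s n) t\<bar> \<le> N (s n)"
      using J_norm[OF CS_points[OF s]] t by blast
  qed
  then show "(SUP t\<in>{0..1}. \<bar>L s t\<bar>) \<le> lim (\<lambda>n. N (s n))"
    using SUP_abs_le_iff[OF L_cont[OF s]] by blast
  show "lim (\<lambda>n. N (s n)) \<le> (SUP t\<in>{0..1}. \<bar>L s t\<bar>)"
  proof (rule field_le_epsilon)
    fix \<epsilon> :: real assume \<epsilon>: "\<epsilon> > 0"
    have b: "\<bar>L s t\<bar> \<le> (SUP t\<in>{0..1}. \<bar>L s t\<bar>)" if "t \<in> {0..1}" for t
      using SUP_abs_le_iff[OF L_cont[OF s], of "SUP t\<in>{0..1}. \<bar>L s t\<bar>"] that by blast
    have "\<forall>\<^sub>F n in sequentially. \<forall>x\<in>{0..1}. dist (J (s n) x) (L s x) < \<epsilon>"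
      by (rule uniform_limitD[OF L_uniform[OF s] \<epsilon>])
    then have "\<forall>\<^sub>F n in sequentially. N (s n) \<le> (SUP t\<in>{0..1}. \<bar>L s t\<bar>) + \<epsilon>"
    proof eventually_elim
      case (elim n)
      have "\<bar>J (s n) x\<bar> \<le> (SUP t\<in>{0..1}. \<bar>L s t\<bar>) + \<epsilon>" if "x \<in> {0..1}" for x
        using elim[rule_format, OF that] b[OF that] unfolding dist_real_def by linarith
      then show ?case using J_norm[OF CS_points[OF s]] by blast
    qed
    then show "lim (\<lambda>n. N (s n)) \<le> (SUP t\<in>{0..1}. \<bar>L s t\<bar>) + \<epsilon>"
      by (intro LIMSEQ_le_const2[OF lim]) (auto simp: eventually_sequentially)
  qed
qed

text \<open>Vectors approximating \<open>f\<close> up to \<open>1 / (n + 1)\<close> form a Cauchy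
  sequence because the embedding is isometric.\<close>

lemma L_surj:
  assumes f: "f \<in> extensional {0..1}" "continuous_on {0..1} f"
  obtains s where "s \<in> CS" "L s = f"
proof -
  have "\<exists>x\<in>V. \<forall>t\<in>{0..1}. \<bar>J x t - f t\<bar> < inverse (real (Suc n))" for n
    using J_dense[OF f(2), of "inverse (real (Suc n))"] by simp
  then obtain s where s: "\<And>n. s n \<in> V" "\<And>n t. t \<in> {0..1} \<Longrightarrow> \<bar>J (s n) t - f t\<bar> < inverse (real (Suc n))"
    by metis
  have sCS: "s \<in> CS"
  proof (rule CS_I[OF s(1)])
    fix \<epsilon> :: real assume \<epsilon>: "\<epsilon> > 0"
    obtain M where M: "inverse (real (Suc M)) < \<epsilon> / 4" using reals_Archimedean[of "\<epsilon> / 4"] \<epsilon> by auto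
    have "d (s m) (s n) < \<epsilon>" if "m \<ge> M" "n \<ge> M" for m n
    proof -
      have "inverse (real (Suc m)) \<le> inverse (real (Suc M))" "inverse (real (Suc n)) \<le> inverse (real (Suc M))"
        using that by (auto intro: le_imp_inverse_le)
      then have "\<bar>J (s m) t - J (s n) t\<bar> \<le> \<epsilon> / 2" if "t \<in> {0..1}" for t
        using s(2)[OF that, of m] s(2)[OF that, of n] M by linarith
      then have "d (s m) (s n) \<le> \<epsilon> / 2" using dist_le_iff s(1) by blast
      then show ?thesis using \<epsilon> by simp
    qed
    then show "\<exists>M. \<forall>m\<ge>M. \<forall>n\<ge>M. d (s m) (s n) < \<epsilon>" by blast
  qed
  have "L s = f"
  proof (rule L_eqI[OF sCS f(1)])
    fix t :: real assume t: "t \<in> {0..1}"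
    have "(\<lambda>n. J (s n) t - f t) \<longlonglongrightarrow> 0"
      by (rule Lim_null_comparison[OF always_eventually LIMSEQ_inverse_real_of_nat])
        (use s(2)[OF t] in \<open>auto intro: less_imp_le\<close>)
    from tendsto_add[OF this tendsto_const[of "f t"]] show "(\<lambda>n. J (s n) t) \<longlonglongrightarrow> f t" by simp
  qed
  with sCS show ?thesis using that by blast
qed

lemma completion_iso: "isometrically_isomorphic (banach_completion P) C01"
proof -
  let ?X = "banach_completion P"
  define T where "T = (\<lambda>X. L (SOME s. s \<in> X))"
  have T: "T (cls s) = L s" if "s \<in> CS" for s
  proof -
    have "(SOME t. t \<in> cls s) \<in> cls s" using someI[of "\<lambda>t. t \<in> cls s", OF self_in_cls[OF that]] .
    then have "(s, SOME t. t \<in> cls s) \<in> null_rel P" by simp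
    then show ?thesis unfolding T_def using L_eq_iff null_relD by metis
  qed
  have ext: "L s \<in> extensional {0..1}" for s by (simp add: L_def)
  have "bij_betw T (ncarrier ?X) (ncarrier C01)"
    unfolding bij_betw_def
  proof
    show "inj_on T (ncarrier ?X)"
    proof (rule inj_onI)
      fix X Y assume XY: "X \<in> ncarrier ?X" "Y \<in> ncarrier ?X" "T X = T Y"
      obtain s t where "s \<in> CS" "X = cls s" "t \<in> CS" "Y = cls t" using XY(1,2) carrier_cases by metis
      then show "X = Y" using XY(3) T L_eq_iff cls_eq by metis
    qed
    show "T ` ncarrier ?X = ncarrier C01"
    proof
      show "T ` ncarrier ?X \<subseteq> ncarrier C01"
      proof (rule image_subsetI)
        fix X assume "X \<in> ncarrier ?X"
        then obtain s where "s \<in> CS" "X = cls s" by (rule carrier_cases)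
        then show "T X \<in> ncarrier C01" using T L_cont ext by (simp add: C01_def)
      qed
      show "ncarrier C01 \<subseteq> T ` ncarrier ?X"
      proof
        fix f assume "f \<in> ncarrier C01"
        then obtain s where "s \<in> CS" "L s = f" using L_surj[of f] by (auto simp: C01_def)
        then show "f \<in> T ` ncarrier ?X" using T cls_in_carrier by (metis imageI)
      qed
    qed
  qed
  moreover have "T (nadd ?X X Y) = nadd C01 (T X) (T Y)" if XY: "X \<in> ncarrier ?X" "Y \<in> ncarrier ?X" for X Y
  proof -
    obtain s t where st: "s \<in> CS" "X = cls s" "t \<in> CS" "Y = cls t" using XY carrier_cases by metis
    have "L (\<lambda>n. padd P (s n) (t n)) = (\<lambda>x\<in>{0..1}. L s x + L t x)"
    proof (rule L_eqI[OF CS_add[OF st(1,3)]])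
      fix x :: real assume x: "x \<in> {0..1}"
      have "(\<lambda>n. J (s n) x + J (t n) x) \<longlonglongrightarrow> L s x + L t x"
        by (intro tendsto_add L_lim st x)
      then show "(\<lambda>n. J (padd P (s n) (t n)) x) \<longlonglongrightarrow> (\<lambda>x\<in>{0..1}. L s x + L t x) x"
        using x st CS_points by (simp add: J_add)
    qed simp
    then show ?thesis using st by (simp add: nadd_cls T CS_add C01_def)
  qed
  moreover have "T (nscale ?X r X) = nscale C01 r (T X)" if X: "X \<in> ncarrier ?X" for r X
  proof -
    obtain s where s: "s \<in> CS" "X = cls s" using X carrier_cases by metis
    have "\<exists>q. \<bar>real_of_rat q - r\<bar> < inverse (real (Suc n))" for n
    proof -
      obtain q where "r < real_of_rat q" "real_of_rat q < r + inverse (real (Suc n))"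
        using of_rat_dense[of r "r + inverse (real (Suc n))"] by auto
      then show ?thesis by (intro exI[of _ q]) auto
    qed
    then obtain q where q: "\<And>n. \<bar>real_of_rat (q n) - r\<bar> < inverse (real (Suc n))" by metis
    have "(\<lambda>n. real_of_rat (q n) - r) \<longlonglongrightarrow> 0"
      by (rule Lim_null_comparison[OF always_eventually LIMSEQ_inverse_real_of_nat])
        (use q in \<open>auto intro: less_imp_le\<close>)
    from tendsto_add[OF this tendsto_const[of r]] have lim: "(\<lambda>n. real_of_rat (q n)) \<longlonglongrightarrow> r" by simp
    have "L (\<lambda>n. pscale P (q n) (s n)) = (\<lambda>x\<in>{0..1}. r * L s x)"
    proof (rule L_eqI[OF CS_scale[OF s(1) lim]])
      fix x :: real assume x: "x \<in> {0..1}"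
      have "(\<lambda>n. real_of_rat (q n) * J (s n) x) \<longlonglongrightarrow> r * L s x"
        by (intro tendsto_mult lim L_lim s x)
      then show "(\<lambda>n. J (pscale P (q n) (s n)) x) \<longlonglongrightarrow> (\<lambda>x\<in>{0..1}. r * L s x) x"
        using x s CS_points by (simp add: J_scale)
    qed simp
    then show ?thesis using s by (simp add: nscale_cls[OF s(1) lim] T CS_scale[OF s(1) lim] C01_def)
  qed
  moreover have "nnorm C01 (T X) = nnorm ?X X" if X: "X \<in> ncarrier ?X" for X
  proof -
    obtain s where s: "s \<in> CS" "X = cls s" using X carrier_cases by metis
    then show ?thesis using L_norm[OF s(1)] by (simp add: T nnorm_cls C01_def)
  qed
  ultimately show ?thesis unfolding isometrically_isomorphic_def by blast
qed

end

lemma isometrically_isomorphic_iff: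
  assumes "presents_normed_space P"
  shows "isometrically_isomorphic (banach_completion P) C01 \<longleftrightarrow> (\<exists>J. C01_rep P J)"
  using normed_presentation.ex_C01_rep[OF normed_presentation.intro[OF assms]] C01_rep.completion_iso
  by blast

section \<open>Interpretation of the formula in $C[0,1]$\<close>

lemma ex_code_between: "a < b \<Longrightarrow> \<exists>c. a < real_of_rat (Q c) \<and> real_of_rat (Q c) < b"
  by (metis ex_code of_rat_dense)

lemma Q_code_minus_one: "Q code_minus_one = -1"
  unfolding code_minus_one_def using ex_code by (rule someI_ex)

context normed_presentation
begin

lemma ops: "ops_total P" and nt: "norm_total P"
  using pns by (auto simp: presents_normed_space_def)

lemma sc_eq: "x \<in> V \<Longrightarrow> sc P c x = pscale P (Q c) x"
  by (rule sc_eq_pscale[OF ops])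

lemma neg_eq: "x \<in> V \<Longrightarrow> neg P x = mns x"
  by (simp add: neg_def sc_eq Q_code_minus_one)

lemma sub_eq: "y \<in> V \<Longrightarrow> sub P x y = padd P x (mns y)"
  by (simp add: sub_def neg_eq)

lemma sc_in [simp]: "x \<in> V \<Longrightarrow> sc P c x \<in> V" and neg_in [simp]: "x \<in> V \<Longrightarrow> neg P x \<in> V"
  and sub_in [simp]: "x \<in> V \<Longrightarrow> y \<in> V \<Longrightarrow> sub P x y \<in> V"
  by (simp_all add: sc_eq neg_eq sub_eq)

lemma nlt_eq: "x \<in> V \<Longrightarrow> nlt P x q \<longleftrightarrow> N x < real_of_rat q"
  by (rule nlt_iff[OF nt])

end

context C01_rep
begin

lemma J_sc: "x \<in> V \<Longrightarrow> t \<in> {0..1} \<Longrightarrow> J (sc P c x) t = real_of_rat (Q c) * J x t"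
  and J_neg: "x \<in> V \<Longrightarrow> t \<in> {0..1} \<Longrightarrow> J (neg P x) t = - J x t"
  and J_sub: "x \<in> V \<Longrightarrow> y \<in> V \<Longrightarrow> t \<in> {0..1} \<Longrightarrow> J (sub P x y) t = J x t - J y t"
  by (simp_all add: sc_eq neg_eq sub_eq J_scale J_diff)

lemma approx:
  assumes "continuous_on {0..1} F" "\<epsilon> > 0"
  obtains x where "x \<in> V" "\<And>t. t \<in> {0..1} \<Longrightarrow> \<bar>J x t - F t\<bar> < \<epsilon>"
  using J_dense[OF assms] by auto

text \<open>The strict inequality passes from the values to the norm because the maximum is attained
  on the compact interval.\<close>

lemma nlt_iff_abs_less:
  assumes x: "x \<in> V"
  shows "nlt P x q \<longleftrightarrow> (\<forall>t\<in>{0..1}. \<bar>J x t\<bar> < real_of_rat q)"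
proof
  assume "nlt P x q"
  then have "N x < real_of_rat q" using nlt_eq[OF x] by blast
  moreover have "\<forall>t\<in>{0..1}. \<bar>J x t\<bar> \<le> N x" using J_norm[OF x, of "N x"] by blast
  ultimately show "\<forall>t\<in>{0..1}. \<bar>J x t\<bar> < real_of_rat q" by (meson le_less_trans)
next
  assume a: "\<forall>t\<in>{0..1}. \<bar>J x t\<bar> < real_of_rat q"
  have "continuous_on {0..1} (\<lambda>t. \<bar>J x t\<bar>)" using J_cont[OF x] by (intro continuous_intros)
  then obtain t0 where "t0 \<in> {0..1}" "\<And>t. t \<in> {0..1} \<Longrightarrow> \<bar>J x t\<bar> \<le> \<bar>J x t0\<bar>"
    using continuous_attains_sup[of "{0..1::real}" "\<lambda>t. \<bar>J x t\<bar>"] by auto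
  then have "N x \<le> \<bar>J x t0\<bar>" "\<bar>J x t0\<bar> < real_of_rat q" using J_norm[OF x] a by blast+
  then show "nlt P x q" using nlt_eq[OF x] by simp
qed

end

lemma positive_lower_bound:
  fixes f :: "real \<Rightarrow> real"
  assumes "continuous_on {0..1} f" "\<And>t. t \<in> {0..1} \<Longrightarrow> f t > 0"
  obtains m where "m > 0" "\<And>t. t \<in> {0..1} \<Longrightarrow> m \<le> f t"
proof -
  obtain t0 where "t0 \<in> {0..1}" "\<And>t. t \<in> {0..1} \<Longrightarrow> f t0 \<le> f t"
    using continuous_attains_inf[of "{0..1::real}" f] assms(1) by auto
  then show ?thesis using that[of "f t0"] assms(2) by blast
qed

lemma abs_upper_bound:
  fixes f :: "real \<Rightarrow> real"
  assumes "continuous_on {0..1} f"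
  obtains b where "b > 0" "\<And>t. t \<in> {0..1} \<Longrightarrow> \<bar>f t\<bar> < b"
proof -
  have "continuous_on {0..1} (\<lambda>t. \<bar>f t\<bar>)" using assms by (intro continuous_intros)
  then obtain t0 where "t0 \<in> {0..1}" "\<And>t. t \<in> {0..1} \<Longrightarrow> \<bar>f t\<bar> \<le> \<bar>f t0\<bar>"
    using continuous_attains_sup[of "{0..1::real}" "\<lambda>t. \<bar>f t\<bar>"] by auto
  then show ?thesis using that[of "\<bar>f t0\<bar> + 1"] by fastforce
qed

lemma continuous_near:
  fixes f :: "real \<Rightarrow> real"
  assumes "continuous_on {0..1} f" "t0 \<in> {0..1}" "\<epsilon> > 0"
  obtains \<rho> where "\<rho> > 0" "\<And>t. t \<in> {0..1} \<Longrightarrow> \<bar>t - t0\<bar> < \<rho> \<Longrightarrow> \<bar>f t - f t0\<bar> < \<epsilon>"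
  using assms unfolding continuous_on_iff dist_real_def by blast

section \<open>Positivity, intersection and betweenness\<close>

locale C01_frame = C01_rep +
  fixes e l r :: nat
  assumes e_in [simp]: "e \<in> points P" and l_in [simp]: "l \<in> points P" and r_in [simp]: "r \<in> points P"
    and e_pos: "t \<in> {0..1} \<Longrightarrow> J e t > 0"
    and l_ne: "\<exists>t\<in>{0..1}. J l t > 0" and r_ne: "\<exists>t\<in>{0..1}. J r t > 0"
    and l_less_r: "s \<in> {0..1} \<Longrightarrow> t \<in> {0..1} \<Longrightarrow> J l s > 0 \<Longrightarrow> J r t > 0 \<Longrightarrow> s < t"
begin

text \<open>For f > 0 every k = f + c e is at least the minimum m of f, and the larger of \<bar>k +
  y\<bar> and \<bar>k - y\<bar> is \<bar>k\<bar> + \<bar>y\<bar> pointwise. If f is not positive at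
  t0, some admissible k is almost zero at t0, and a bump there shows that adding it gains less than
  the margin required.\<close>

lemma Pos_iff:
  assumes f: "f \<in> V"
  shows "Pos P e f \<longleftrightarrow> (\<forall>t\<in>{0..1}. J f t > 0)"
proof
  assume pos: "\<forall>t\<in>{0..1}. J f t > 0"
  obtain m where m: "m > 0" "\<And>t. t \<in> {0..1} \<Longrightarrow> m \<le> J f t"
    using positive_lower_bound[OF J_cont[OF f]] pos by blast
  obtain \<delta> where \<delta>: "0 < real_of_rat (Q \<delta>)" "real_of_rat (Q \<delta>) < m" using ex_code_between[OF m(1)] by blast
  show "Pos P e f"
    unfolding Pos_def
  proof (intro exI[of _ \<delta>] conjI allI impI ballI)
    show "0 < Q \<delta>" using \<delta>(1) by simp
    fix c y a
    assume c: "0 \<le> Q c" and y: "y \<in> V"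
    let ?k = "padd P f (sc P c e)"
    assume "nlt P (padd P ?k y) (Q a) \<and> nlt P (sub P ?k y) (Q a)"
    then have a: "\<And>t. t \<in> {0..1} \<Longrightarrow> \<bar>J ?k t + J y t\<bar> < real_of_rat (Q a)"
      "\<And>t. t \<in> {0..1} \<Longrightarrow> \<bar>J ?k t - J y t\<bar> < real_of_rat (Q a)"
      using y f by (simp_all add: nlt_iff_abs_less J_add J_sub)
    have "\<bar>J y t\<bar> < real_of_rat (Q a - Q \<delta>)" if t: "t \<in> {0..1}" for t
    proof -
      have "0 \<le> real_of_rat (Q c)" using c by simp
      then have "J ?k t \<ge> m" using f t m(2)[OF t] e_pos[OF t] by (simp add: J_add J_sc add_increasing2)
      then show ?thesis using a[OF t] \<delta> unfolding of_rat_diff by linarith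
    qed
    then show "nlt P y (Q a - Q \<delta>)" using nlt_iff_abs_less[OF y] by blast
  qed
next
  assume "Pos P e f"
  then obtain \<delta> where \<delta>: "0 < Q \<delta>" and *: "\<And>c y a. 0 \<le> Q c \<Longrightarrow> y \<in> V \<Longrightarrow>
      nlt P (padd P (padd P f (sc P c e)) y) (Q a) \<Longrightarrow> nlt P (sub P (padd P f (sc P c e)) y) (Q a)
      \<Longrightarrow> nlt P y (Q a - Q \<delta>)"
    unfolding Pos_def by metis
  define D where "D = real_of_rat (Q \<delta>)"
  have D: "D > 0" using \<delta> by (simp add: D_def)
  show "\<forall>t\<in>{0..1}. J f t > 0"
  proof (rule ccontr)
    assume "\<not> ?thesis"
    then obtain t0 where t0: "t0 \<in> {0..1}" "J f t0 \<le> 0" by force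
    \<comment> \<open>The coefficient for which \<open>f + lam * e\<close> vanishes at
      \<open>t0\<close>; a rational slightly above it leaves a value below
      \<open>D / 2\<close>.\<close>
    define lam where "lam = - J f t0 / J e t0"
    have e0: "J e t0 > 0" using e_pos[OF t0(1)] .
    have "lam \<ge> 0" using t0 e0 by (simp add: lam_def divide_nonpos_pos)
    have "lam < lam + D / (2 * J e t0)" using D e0 by simp
    then obtain c where c: "lam < real_of_rat (Q c)" "real_of_rat (Q c) < lam + D / (2 * J e t0)"
      using ex_code_between by blast
    have c0: "0 \<le> Q c" using c(1) \<open>lam \<ge> 0\<close> by (metis less_eq_real_def order.strict_trans1 zero_le_of_rat_iff)
    let ?k = "padd P f (sc P c e)"
    have k_in: "?k \<in> V" using f by simp
    have "J ?k t0 = J f t0 + real_of_rat (Q c) * J e t0" using f t0 by (simp add: J_add J_sc)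
    moreover have "lam * J e t0 = - J f t0" using e0 by (simp add: lam_def)
    moreover have "lam * J e t0 < real_of_rat (Q c) * J e t0" using c(1) e0 by simp
    moreover have "real_of_rat (Q c) * J e t0 < (lam + D / (2 * J e t0)) * J e t0" using c(2) e0 by simp
    moreover have "(lam + D / (2 * J e t0)) * J e t0 = lam * J e t0 + D / 2" using e0 by (simp add: field_simps)
    ultimately have k0: "\<bar>J ?k t0\<bar> < D / 2" by linarith
    \<comment> \<open>The test bump gets height \<open>M\<close>: off its support \<open>k\<close>
      alone stays below \<open>M\<close>, and on it \<open>k\<close> is small.\<close>
    obtain M where M: "M > 0" "\<And>t. t \<in> {0..1} \<Longrightarrow> \<bar>J ?k t\<bar> < M"
      using abs_upper_bound[OF J_cont[OF k_in]] by blast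
    have "D / 8 > 0" using D by simp
    then obtain \<rho> where \<rho>: "\<rho> > 0" "\<And>t. t \<in> {0..1} \<Longrightarrow> \<bar>t - t0\<bar> < \<rho> \<Longrightarrow> \<bar>J ?k t - J ?k t0\<bar> < D / 8"
      using continuous_near[OF J_cont[OF k_in] t0(1)] by blast
    define y0 where "y0 = (\<lambda>t. M * max 0 (1 - \<bar>t - t0\<bar> / \<rho>))"
    have "continuous_on {0..1} y0" unfolding y0_def using \<rho>(1) by (intro continuous_intros) auto
    moreover have "D / 16 > 0" using D by simp
    ultimately obtain y where y: "y \<in> V" "\<And>t. t \<in> {0..1} \<Longrightarrow> \<bar>J y t - y0 t\<bar> < D / 16"
      by (rule approx) (rule that; blast)
    have y0_nonneg: "0 \<le> y0 t" for t unfolding y0_def using M(1) by simp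
    have y0_le: "y0 t \<le> M" for t
    proof -
      have "max 0 (1 - \<bar>t - t0\<bar> / \<rho>) \<le> 1" using \<rho>(1) by simp
      then have "M * max 0 (1 - \<bar>t - t0\<bar> / \<rho>) \<le> M * 1" using M(1) by (intro mult_left_mono) auto
      then show ?thesis by (simp add: y0_def)
    qed
    have bound: "\<bar>J ?k t\<bar> + y0 t \<le> M + 5 * D / 8" if t: "t \<in> {0..1}" for t
    proof (cases "\<bar>t - t0\<bar> < \<rho>")
      case True
      show ?thesis using \<rho>(2)[OF t True] k0 y0_le[of t] by linarith
    next
      case False
      then have "y0 t = 0" unfolding y0_def using \<rho>(1) by simp
      then show ?thesis using M(2)[OF t] D by linarith
    qed
    \<comment> \<open>\<open>5 / 8\<close> of \<open>D\<close> from \<open>bound\<close> and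
      \<open>1 / 16\<close> for approximating the bump make \<open>11 / 16\<close>. At
      \<open>t0\<close> the bump has height \<open>M\<close>, so \<open>y\<close> exceeds
      \<open>M - D / 16\<close> there, which is more than \<open>a - D\<close>.\<close>
    obtain a where a: "M + 11 * D / 16 < real_of_rat (Q a)" "real_of_rat (Q a) < M + 12 * D / 16"
      using ex_code_between[of "M + 11 * D / 16" "M + 12 * D / 16"] D by auto
    have "\<bar>J ?k t + J y t\<bar> < real_of_rat (Q a)" "\<bar>J ?k t - J y t\<bar> < real_of_rat (Q a)" if t: "t \<in> {0..1}" for t
      using bound[OF t] y(2)[OF t] y0_nonneg[of t] a by linarith+
    then have "nlt P (padd P ?k y) (Q a)" "nlt P (sub P ?k y) (Q a)"
      using k_in y(1) by (simp_all add: nlt_iff_abs_less J_add[OF k_in] J_sub[OF k_in])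
    then have "nlt P y (Q a - Q \<delta>)" using *[OF c0 y(1)] by blast
    then have "\<bar>J y t0\<bar> < real_of_rat (Q a) - D"
      using nlt_iff_abs_less[OF y(1)] t0(1) by (simp add: of_rat_diff D_def)
    moreover have "y0 t0 = M" by (simp add: y0_def)
    ultimately show False using y(2)[OF t0(1)] a(2) D by linarith
  qed
qed

lemma Gt_iff: "f \<in> V \<Longrightarrow> g \<in> V \<Longrightarrow> Gt P e f g \<longleftrightarrow> (\<forall>t\<in>{0..1}. J g t < J f t)"
  by (simp add: Gt_def Pos_iff J_sub)

text \<open>The minimum of f and G, lowered by m / 4 where m is its value at t0, and approximated
  within m / 8: this stays below f and G everywhere and above m / 2 at t0.\<close>

lemma shrink:
  assumes f: "f \<in> V" and t0: "t0 \<in> {0..1}" "J f t0 > 0" and G: "continuous_on {0..1} G" "G t0 > 0"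
  obtains f' where "f' \<in> V" "Gt P e f f'" "J f' t0 > 0" "J f' t0 > min (J f t0) (G t0) / 2"
    "\<And>t. t \<in> {0..1} \<Longrightarrow> J f' t > 0 \<Longrightarrow> G t > 0" "\<And>t. t \<in> {0..1} \<Longrightarrow> J f' t < G t"
proof -
  define m where "m = min (J f t0) (G t0)"
  have m: "m > 0" using assms by (simp add: m_def)
  have "continuous_on {0..1} (\<lambda>t. min (J f t) (G t) - m / 4)"
    using J_cont[OF f] G(1) by (intro continuous_intros)
  moreover have "m / 8 > 0" using m by simp
  ultimately obtain f' where f': "f' \<in> V"
    "\<And>t. t \<in> {0..1} \<Longrightarrow> \<bar>J f' t - (min (J f t) (G t) - m / 4)\<bar> < m / 8"
    by (rule approx) (rule that; blast)
  have up: "J f' t < min (J f t) (G t)" if "t \<in> {0..1}" for t using f'(2)[OF that] m by linarith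
  have "J f' t0 > m / 2" using f'(2)[OF t0(1)] m unfolding m_def by linarith
  show ?thesis
  proof (rule that[OF f'(1)])
    show "Gt P e f f'" using up f f'(1) by (simp add: Gt_iff)
    show "J f' t0 > 0" using \<open>J f' t0 > m / 2\<close> m by linarith
    show "J f' t0 > min (J f t0) (G t0) / 2" using \<open>J f' t0 > m / 2\<close> by (simp add: m_def)
    show "J f' t > 0 \<Longrightarrow> G t > 0" "J f' t < G t" if "t \<in> {0..1}" for t using up[OF that] by auto
  qed
qed

text \<open>Where a common strict lower bound \<open>w\<close> reaches the positive function
  \<open>c e\<close>, both \<open>u\<close> and \<open>v\<close> are positive.\<close>

lemma Meet_iff:
  assumes u: "u \<in> V" and v: "v \<in> V"
  shows "Meet P e u v \<longleftrightarrow> (\<exists>t\<in>{0..1}. J u t > 0 \<and> J v t > 0)"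
proof
  assume "Meet P e u v"
  then obtain w c where w: "w \<in> V" "0 < Q c" "Gt P e u w" "Gt P e v w" "\<not> Gt P e (sc P c e) w"
    unfolding Meet_def by blast
  then obtain t where t: "t \<in> {0..1}" "\<not> J w t < real_of_rat (Q c) * J e t"
    by (auto simp: Gt_iff J_sc)
  have "real_of_rat (Q c) * J e t > 0" using w(2) e_pos[OF t(1)] by simp
  moreover have "J w t < J u t" "J w t < J v t" using w t u v by (auto simp: Gt_iff)
  ultimately show "\<exists>t\<in>{0..1}. J u t > 0 \<and> J v t > 0" using t by (intro bexI[of _ t]) auto
next
  assume "\<exists>t\<in>{0..1}. J u t > 0 \<and> J v t > 0"
  then obtain t where t: "t \<in> {0..1}" "J u t > 0" "J v t > 0" by blast
  define m where "m = min (J u t) (J v t)"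
  have m: "m > 0" using t by (simp add: m_def)
  obtain w where w: "w \<in> V" "Gt P e u w" "J w t > m / 2" "\<And>x. x \<in> {0..1} \<Longrightarrow> J w x < J v x"
    using shrink[OF u t(1,2) J_cont[OF v] t(3)] unfolding m_def by metis
  have "0 < m / (2 * J e t)" using m e_pos[OF t(1)] by simp
  then obtain c where c: "0 < real_of_rat (Q c)" "real_of_rat (Q c) < m / (2 * J e t)"
    using ex_code_between by blast
  have "real_of_rat (Q c) * J e t < m / (2 * J e t) * J e t" using c(2) e_pos[OF t(1)] by (intro mult_strict_right_mono)
  also have "\<dots> = m / 2" using e_pos[OF t(1)] by simp
  finally have "\<not> J w t < real_of_rat (Q c) * J e t" using w(3) by linarith
  then have "\<not> Gt P e (sc P c e) w" using w(1) t(1) by (auto simp: Gt_iff J_sc)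
  moreover have "Gt P e v w" using w v by (simp add: Gt_iff)
  moreover have "0 < Q c" using c(1) by simp
  ultimately show "Meet P e u v" unfolding Meet_def using w by blast
qed

text \<open>The right side says that the maximum of \<bar>k\<bar> and u is positive on the compact
  interval, that is, bounded below by a positive multiple of \<open>e\<close>. That maximum need not
  belong to the space, so the strict upper bounds \<open>z\<close> of it speak in its place.\<close>

lemma Zeros_in_iff:
  assumes k: "k \<in> V" and u: "u \<in> V"
  shows "Zeros_in P e k u \<longleftrightarrow> (\<forall>t\<in>{0..1}. J k t \<noteq> 0 \<or> J u t > 0)"
proof
  assume "Zeros_in P e k u"
  then obtain c where c: "0 < Q c"
    "\<And>z. z \<in> V \<Longrightarrow> Gt P e z k \<Longrightarrow> Gt P e z (neg P k) \<Longrightarrow> Gt P e z u \<Longrightarrow> Gt P e z (sc P c e)"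
    unfolding Zeros_in_def by blast
  show "\<forall>t\<in>{0..1}. J k t \<noteq> 0 \<or> J u t > 0"
  proof (rule ccontr)
    assume "\<not> ?thesis"
    then obtain t where t: "t \<in> {0..1}" "J k t = 0" "J u t \<le> 0" by force
    define \<eta> where "\<eta> = real_of_rat (Q c) * J e t / 4"
    have \<eta>: "\<eta> > 0" using c(1) e_pos[OF t(1)] by (simp add: \<eta>_def)
    have "continuous_on {0..1} (\<lambda>t. max \<bar>J k t\<bar> (J u t) + \<eta>)"
      using J_cont[OF k] J_cont[OF u] by (intro continuous_intros)
    moreover have "\<eta> / 2 > 0" using \<eta> by simp
    ultimately obtain z where z: "z \<in> V"
      "\<And>t. t \<in> {0..1} \<Longrightarrow> \<bar>J z t - (max \<bar>J k t\<bar> (J u t) + \<eta>)\<bar> < \<eta> / 2"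
      by (rule approx) (rule that; blast)
    have gt: "J k x < J z x" "- J k x < J z x" "J u x < J z x" if "x \<in> {0..1}" for x
      using z(2)[OF that] \<eta> by linarith+
    then have "Gt P e z (sc P c e)" using z(1) k u by (intro c(2)) (simp_all add: Gt_iff J_neg)
    then have "real_of_rat (Q c) * J e t < J z t" using z(1) t(1) by (auto simp: Gt_iff J_sc)
    moreover have "J z t < 3 * \<eta> / 2" using z(2)[OF t(1)] t by linarith
    ultimately show False using \<eta> unfolding \<eta>_def by linarith
  qed
next
  assume a: "\<forall>t\<in>{0..1}. J k t \<noteq> 0 \<or> J u t > 0"
  have cont: "continuous_on {0..1} (\<lambda>t. max \<bar>J k t\<bar> (J u t))"
    using J_cont[OF k] J_cont[OF u] by (intro continuous_intros)
  have pos: "max \<bar>J k t\<bar> (J u t) > 0" if "t \<in> {0..1}" for t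
    using a[rule_format, OF that] by auto
  obtain m where m: "m > 0" "\<And>t. t \<in> {0..1} \<Longrightarrow> m \<le> max \<bar>J k t\<bar> (J u t)"
    using positive_lower_bound[OF cont pos] by blast
  obtain E where E: "E > 0" "\<And>t. t \<in> {0..1} \<Longrightarrow> \<bar>J e t\<bar> < E" using abs_upper_bound[OF J_cont[OF e_in]] by blast
  have "0 < m / E" using m E by simp
  then obtain c where c: "0 < real_of_rat (Q c)" "real_of_rat (Q c) < m / E" using ex_code_between by blast
  have small: "real_of_rat (Q c) * J e t < m" if "t \<in> {0..1}" for t
  proof -
    have "real_of_rat (Q c) * J e t < real_of_rat (Q c) * E"
      using E(2)[OF that] c(1) by (intro mult_strict_left_mono) auto
    also have "\<dots> < m / E * E" using c(2) E(1) by (intro mult_strict_right_mono) auto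
    finally show ?thesis using E(1) by simp
  qed
  show "Zeros_in P e k u"
    unfolding Zeros_in_def
  proof (intro exI[of _ c] conjI ballI impI)
    show "0 < Q c" using c(1) by simp
    fix z assume z: "z \<in> V" and "Gt P e z k \<and> Gt P e z (neg P k) \<and> Gt P e z u"
    then have gt: "J k t < J z t" "- J k t < J z t" "J u t < J z t" if "t \<in> {0..1}" for t
      using that k u by (simp_all add: Gt_iff J_neg)
    have "real_of_rat (Q c) * J e t < J z t" if "t \<in> {0..1}" for t
      using gt[OF that] m(2)[OF that] small[OF that] by linarith
    then show "Gt P e z (sc P c e)" using z by (simp add: Gt_iff J_sc)
  qed
qed

text \<open>A function changing sign between \<open>x\<close> and \<open>s\<close> has a zero in
  between. Conversely a straight line through zero at \<open>y\<close>, slightly perturbed, has all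
  its zeros near \<open>y\<close>.\<close>

lemma Btw_iff:
  assumes u: "u \<in> V" and v: "v \<in> V" and w: "w \<in> V"
  shows "Btw P e u v w \<longleftrightarrow> (\<exists>x\<in>{0..1}. \<exists>y\<in>{0..1}. \<exists>s\<in>{0..1}. J v x > 0 \<and> J u y > 0 \<and> J w s > 0 \<and>
    (x < y \<and> y < s \<or> s < y \<and> y < x))"
proof
  assume "Btw P e u v w"
  then obtain k where k: "k \<in> V" "Meet P e k v" "Meet P e (neg P k) w" "Zeros_in P e k u"
    unfolding Btw_def by blast
  obtain x where x: "x \<in> {0..1}" "J k x > 0" "J v x > 0" using k v by (auto simp: Meet_iff)
  obtain s where s: "s \<in> {0..1}" "J k s < 0" "J w s > 0" using k w by (auto simp: Meet_iff J_neg)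
  have between: "\<exists>y. min x s \<le> y \<and> y \<le> max x s \<and> J k y = 0"
  proof (cases "x \<le> s")
    case True
    have "continuous_on {x..s} (J k)" using J_cont[OF k(1)] x s by (auto intro: continuous_on_subset)
    then show ?thesis using IVT2'[of "J k" s 0 x] True x s by auto
  next
    case False
    have "continuous_on {s..x} (J k)" using J_cont[OF k(1)] x s by (auto intro: continuous_on_subset)
    then show ?thesis using IVT'[of "J k" s 0 x] False x s by auto
  qed
  then obtain y where y: "min x s \<le> y" "y \<le> max x s" "J k y = 0" by blast
  have yI: "y \<in> {0..1}" using y x s by auto
  then have "J u y > 0" using k(4) y(3) Zeros_in_iff[OF k(1) u] by auto
  moreover have "y \<noteq> x" "y \<noteq> s" using y(3) x s by auto
  ultimately show "\<exists>x\<in>{0..1}. \<exists>y\<in>{0..1}. \<exists>s\<in>{0..1}. J v x > 0 \<and> J u y > 0 \<and> J w s > 0 \<and>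
    (x < y \<and> y < s \<or> s < y \<and> y < x)"
    using x s yI y by (intro bexI[of _ x] bexI[of _ y] bexI[of _ s]) auto
next
  assume "\<exists>x\<in>{0..1}. \<exists>y\<in>{0..1}. \<exists>s\<in>{0..1}. J v x > 0 \<and> J u y > 0 \<and> J w s > 0 \<and>
    (x < y \<and> y < s \<or> s < y \<and> y < x)"
  then obtain x y s where xys: "x \<in> {0..1}" "y \<in> {0..1}" "s \<in> {0..1}" "J v x > 0" "J u y > 0" "J w s > 0"
    and ord: "x < y \<and> y < s \<or> s < y \<and> y < x" by blast
  \<comment> \<open>The sign that makes the line positive at \<open>x\<close> and negative at
    \<open>s\<close>, in either order of the points.\<close>
  define \<sigma> :: real where "\<sigma> = (if x < y then 1 else -1)"
  have \<sigma>: "\<sigma> * (y - x) > 0" "\<sigma> * (y - s) < 0" "\<sigma> = 1 \<or> \<sigma> = -1" using ord by (auto simp: \<sigma>_def)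
  obtain \<rho> where \<rho>: "\<rho> > 0" "\<And>t. t \<in> {0..1} \<Longrightarrow> \<bar>t - y\<bar> < \<rho> \<Longrightarrow> \<bar>J u t - J u y\<bar> < J u y"
    using continuous_near[OF J_cont[OF u] xys(2,5)] by blast
  \<comment> \<open>Small enough that the perturbed line keeps its signs at \<open>x\<close> and
    \<open>s\<close> and has no zero farther than \<rho> from \<open>y\<close>.\<close>
  define \<eta> where "\<eta> = min \<rho> (min (\<sigma> * (y - x)) (- \<sigma> * (y - s)))"
  have \<eta>: "\<eta> > 0" "\<eta> \<le> \<rho>" "\<eta> \<le> \<sigma> * (y - x)" "\<eta> \<le> - \<sigma> * (y - s)" using \<rho> \<sigma> by (auto simp: \<eta>_def)
  have "continuous_on {0..1} (\<lambda>t. \<sigma> * (y - t))" by (intro continuous_intros)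
  then obtain k where k: "k \<in> V" "\<And>t. t \<in> {0..1} \<Longrightarrow> \<bar>J k t - \<sigma> * (y - t)\<bar> < \<eta>"
    by (rule approx[OF _ \<eta>(1)]) (rule that; blast)
  have "J k x > 0" using k(2)[OF xys(1)] \<eta>(3) by linarith
  then have "Meet P e k v" using k v xys by (auto simp: Meet_iff)
  moreover have "J k s < 0" using k(2)[OF xys(3)] \<eta>(4) by auto
  then have "Meet P e (neg P k) w" using k w xys by (auto simp: Meet_iff J_neg)
  moreover have "J k t \<noteq> 0 \<or> J u t > 0" if t: "t \<in> {0..1}" for t
  proof (rule disjCI)
    assume "\<not> J u t > 0"
    then have "\<not> \<bar>t - y\<bar> < \<rho>" using \<rho>(2)[OF t] by fastforce
    then have "\<bar>\<sigma> * (y - t)\<bar> \<ge> \<eta>" using \<eta>(2) \<sigma>(3) by (auto simp: abs_mult abs_minus_commute)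
    then show "J k t \<noteq> 0" using k(2)[OF t] by auto
  qed
  then have "Zeros_in P e k u" using k u by (simp add: Zeros_in_iff)
  ultimately show "Btw P e u v w" unfolding Btw_def using k(1) by blast
qed

end

section \<open>Orientation of the interval\<close>

context C01_frame
begin

definition on :: "nat \<Rightarrow> real \<Rightarrow> bool" where
  "on f t \<longleftrightarrow> t \<in> {0..1} \<and> J f t > 0"

lemma Btw_on:
  assumes "u \<in> V" "v \<in> V" "w \<in> V"
  shows "Btw P e u v w \<longleftrightarrow> (\<exists>x y s. on v x \<and> on u y \<and> on w s \<and> (x < y \<and> y < s \<or> s < y \<and> y < x))"
  unfolding Btw_iff[OF assms] on_def by blast

lemma Gt_on: "f \<in> V \<Longrightarrow> g \<in> V \<Longrightarrow> Gt P e f g \<Longrightarrow> on g t \<Longrightarrow> on f t"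
  by (force simp: Gt_iff on_def)

lemma l_on_less_r: "on l s \<Longrightarrow> on r t \<Longrightarrow> s < t"
  using l_less_r by (simp add: on_def)

lemma on_near:
  assumes f: "f \<in> V" and t: "on f t"
  obtains \<rho> where "\<rho> > 0" "\<And>s. s \<in> {0..1} \<Longrightarrow> \<bar>s - t\<bar> < \<rho> \<Longrightarrow> on f s"
proof -
  have "t \<in> {0..1}" "J f t > 0" using t by (auto simp: on_def)
  from continuous_near[OF J_cont[OF f] this] obtain \<rho> where \<rho>: "\<rho> > 0"
    "\<And>s. s \<in> {0..1} \<Longrightarrow> \<bar>s - t\<bar> < \<rho> \<Longrightarrow> \<bar>J f s - J f t\<bar> < J f t" by metis
  have "on f s" if "s \<in> {0..1}" "\<bar>s - t\<bar> < \<rho>" for s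
    using \<rho>(2)[OF that] that(1) unfolding on_def by linarith
  then show ?thesis using that \<rho>(1) by blast
qed

lemma shrink_on:
  fixes G :: "real \<Rightarrow> real"
  assumes f: "f \<in> V" and t: "on f t" and G: "continuous_on {0..1} G" "G t > 0"
  obtains f' where "f' \<in> V" "Gt P e f f'" "on f' t" "\<And>s. on f' s \<Longrightarrow> G s > 0"
proof -
  have "t \<in> {0..1}" "J f t > 0" using t by (auto simp: on_def)
  from shrink[where G = G and ?t0.0 = t, OF f this G] obtain f' where "f' \<in> V" "Gt P e f f'" "J f' t > 0"
    "\<And>t. t \<in> {0..1} \<Longrightarrow> J f' t > 0 \<Longrightarrow> G t > 0" by metis
  then show ?thesis using that[of f'] \<open>t \<in> {0..1}\<close> by (simp add: on_def)
qed

lemma LT_iff: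
  assumes v: "v \<in> V" and u: "u \<in> V"
  shows "LT P e l r v u \<longleftrightarrow> (\<exists>x y. on v x \<and> on u y \<and> x < y)"
proof
  assume "LT P e l r v u"
  then obtain v' u' where vu: "v' \<in> V" "u' \<in> V" "Gt P e v v'" "Gt P e u u'"
    and cases: "\<not> Btw P e r l u' \<and> Btw P e u' v' r \<or> \<not> Btw P e l v' r \<and> Btw P e v' l u' \<or>
      Btw P e l v' r \<and> Btw P e r l u'"
    unfolding LT_def by metis
  obtain l0 where l0: "on l l0" using l_ne by (auto simp: on_def)
  obtain r0 where r0: "on r r0" using r_ne by (auto simp: on_def)
  have "\<exists>x y. on v' x \<and> on u' y \<and> x < y"
    using cases
  proof (elim disjE conjE)
    assume n: "\<not> Btw P e r l u'" and "Btw P e u' v' r"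
    then obtain x y s where xys: "on v' x" "on u' y" "on r s" "x < y \<and> y < s \<or> s < y \<and> y < x"
      using vu by (auto simp: Btw_on)
    \<comment> \<open>Otherwise \<open>l0 < s < y\<close> would witness
      \<open>Btw P e r l u'\<close>. So betweenness holds in the intended direction; the next case
      is its mirror image.\<close>
    have "\<not> s < y" using n l_on_less_r[OF l0 xys(3)] l0 xys vu by (auto simp: Btw_on)
    then show ?thesis using xys by blast
  next
    assume n: "\<not> Btw P e l v' r" and "Btw P e v' l u'"
    then obtain x y s where xys: "on l x" "on v' y" "on u' s" "x < y \<and> y < s \<or> s < y \<and> y < x"
      using vu by (auto simp: Btw_on)
    have "\<not> y < x" using n l_on_less_r[OF xys(1) r0] r0 xys vu by (auto simp: Btw_on)
    then show ?thesis using xys by blast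
  next
    assume a: "Btw P e l v' r" and b: "Btw P e r l u'"
    obtain x y s where xys: "on v' x" "on l y" "on r s" "x < y \<and> y < s \<or> s < y \<and> y < x"
      using a vu by (auto simp: Btw_on)
    obtain x' y' s' where xys': "on l x'" "on r y'" "on u' s'" "x' < y' \<and> y' < s' \<or> s' < y' \<and> y' < x'"
      using b vu by (auto simp: Btw_on)
    have "x < y" using xys l_on_less_r[OF xys(2,3)] by auto
    moreover have "y < y'" using l_on_less_r[OF xys(2) xys'(2)] .
    moreover have "y' < s'" using xys' l_on_less_r[OF xys'(1,2)] by auto
    ultimately have "x < s'" by linarith
    then show ?thesis using xys xys' by blast
  qed
  then show "\<exists>x y. on v x \<and> on u y \<and> x < y" using Gt_on vu v u by meson
next
  assume "\<exists>x y. on v x \<and> on u y \<and> x < y"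
  then obtain x y where xy: "on v x" "on u y" "x < y" by blast
  have xI: "x \<in> {0..1}" and yI: "y \<in> {0..1}" using xy by (auto simp: on_def)
  obtain l0 where l0: "on l l0" using l_ne by (auto simp: on_def)
  obtain r0 where r0: "on r r0" using r_ne by (auto simp: on_def)
  have c1: "continuous_on {0..1} (\<lambda>t::real. 1::real)" by simp
  obtain v1 where v1: "v1 \<in> V" "Gt P e v v1" "on v1 x" using shrink_on[OF v xy(1) c1] by auto
  obtain u1 where u1: "u1 \<in> V" "Gt P e u u1" "on u1 y" using shrink_on[OF u xy(2) c1] by auto
  \<comment> \<open>In case 1 \<open>u\<close> is shrunk to the left of \<open>y\<close>, so that no
    point of it lies beyond a point of {r > 0}; in case 2 \<open>v\<close> is shrunk to the right of
    \<open>x\<close>. In case 3 the points \<open>s\<close> and \<open>t\<close> satisfy the third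
    disjunct directly.\<close>
  consider "\<And>s. on r s \<Longrightarrow> y \<le> s" | s where "on r s" "s < y" "\<And>t. on l t \<Longrightarrow> t \<le> x"
    | s t where "on r s" "s < y" "on l t" "x < t"
    using not_le by metis
  then show "LT P e l r v u"
  proof cases
    case 1
    obtain \<rho> where \<rho>: "\<rho> > 0" "\<And>s. s \<in> {0..1} \<Longrightarrow> \<bar>s - y\<bar> < \<rho> \<Longrightarrow> on u s" using on_near[OF u xy(2)] by blast
    define y' where "y' = max ((x + y) / 2) (y - \<rho> / 2)"
    have "x < y'" "y' < y" "y - \<rho> / 2 \<le> y'" using xy(3) \<rho>(1) by (simp_all add: y'_def less_max_iff_disj)
    then have y': "x < y'" "y' < y" "\<bar>y' - y\<bar> < \<rho>" using \<rho>(1) by linarith+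
    then have "y' \<in> {0..1}" using xI yI by auto
    then have "on u y'" using \<rho>(2) y' by blast
    moreover have "continuous_on {0..1} (\<lambda>t. y - t)" by (intro continuous_intros)
    moreover have "y - y' > 0" using y' by simp
    ultimately obtain u' where u': "u' \<in> V" "Gt P e u u'" "on u' y'" "\<And>s. on u' s \<Longrightarrow> y - s > 0"
      using shrink_on[OF u] by metis
    have "\<not> Btw P e r l u'"
    proof
      assume "Btw P e r l u'"
      then obtain a b c where abc: "on l a" "on r b" "on u' c" "a < b \<and> b < c \<or> c < b \<and> b < a"
        using u' by (auto simp: Btw_on)
      then show False using l_on_less_r[OF abc(1,2)] 1[OF abc(2)] u'(4)[OF abc(3)] by auto
    qed
    moreover have "Btw P e u' v1 r"
      unfolding Btw_on[OF u'(1) v1(1) r_in]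
      using v1(3) u'(3) r0 y'(1,2) 1[OF r0] by (intro exI[of _ x] exI[of _ y'] exI[of _ r0]) auto
    ultimately show ?thesis unfolding LT_def using v1 u' by blast
  next
    case 2
    obtain \<rho> where \<rho>: "\<rho> > 0" "\<And>s. s \<in> {0..1} \<Longrightarrow> \<bar>s - x\<bar> < \<rho> \<Longrightarrow> on v s" using on_near[OF v xy(1)] by blast
    define x' where "x' = min ((x + y) / 2) (x + \<rho> / 2)"
    have "x < x'" "x' < y" "x' \<le> x + \<rho> / 2" using xy(3) \<rho>(1) by (simp_all add: x'_def min_less_iff_disj)
    then have x': "x < x'" "x' < y" "\<bar>x' - x\<bar> < \<rho>" using \<rho>(1) by linarith+
    then have "x' \<in> {0..1}" using xI yI by auto
    then have "on v x'" using \<rho>(2) x' by blast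
    moreover have "continuous_on {0..1} (\<lambda>t. t - x)" by (intro continuous_intros)
    moreover have "x' - x > 0" using x' by simp
    ultimately obtain v' where v': "v' \<in> V" "Gt P e v v'" "on v' x'" "\<And>s. on v' s \<Longrightarrow> s - x > 0"
      using shrink_on[OF v] by metis
    have "\<not> Btw P e l v' r"
    proof
      assume "Btw P e l v' r"
      then obtain a b c where abc: "on v' a" "on l b" "on r c" "a < b \<and> b < c \<or> c < b \<and> b < a"
        using v' by (auto simp: Btw_on)
      then show False using l_on_less_r[OF abc(2,3)] 2(3)[OF abc(2)] v'(4)[OF abc(1)] by auto
    qed
    moreover have "Btw P e v' l u1"
      unfolding Btw_on[OF v'(1) l_in u1(1)]
      using u1(3) v'(3) l0 x'(1,2) 2(3)[OF l0] by (intro exI[of _ l0] exI[of _ x'] exI[of _ y]) auto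
    ultimately show ?thesis unfolding LT_def using u1 v' by blast
  next
    case 3
    have "t < s" using l_on_less_r 3 by blast
    then have "Btw P e l v1 r" "Btw P e r l u1"
      using 3 v1 u1 by (auto simp: Btw_on)
    then show ?thesis unfolding LT_def using v1 u1 by blast
  qed
qed

lemma bumps_iff: "u \<in> bumps P e \<longleftrightarrow> u \<in> V \<and> (\<exists>t. on u t)"
  unfolding bumps_def on_def using Meet_iff[of u u] by blast

section \<open>Bumps as names of points\<close>

definition tau :: "nat \<Rightarrow> real" where
  "tau u = Sup {t. on u t}"

lemma on_bdd: "bdd_above {t. on u t}"
  by (rule bdd_aboveI[of _ 1]) (auto simp: on_def)

lemma on_le_tau: "on u t \<Longrightarrow> t \<le> tau u"
  unfolding tau_def by (rule cSup_upper[OF _ on_bdd]) simp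

lemma less_tau:
  assumes "u \<in> bumps P e" "a < tau u"
  obtains t where "on u t" "a < t"
  using assms less_cSup_iff[of "{t. on u t}" a] on_bdd unfolding tau_def bumps_iff by auto

lemma tau_le: "u \<in> bumps P e \<Longrightarrow> (\<And>t. on u t \<Longrightarrow> t \<le> a) \<Longrightarrow> tau u \<le> a"
  by (rule ccontr) (metis less_tau not_le)

text \<open>A relatively open set containing 0 contains positive points. Positivity leaves room for
  a bump to the left of the named point, as \<open>near\<close> demands.\<close>

lemma tau_in:
  assumes u: "u \<in> bumps P e" shows "tau u \<in> {0..1}" "tau u > 0"
proof -
  obtain t where t: "on u t" using u bumps_iff by blast
  have uV: "u \<in> V" using u bumps_iff by blast
  obtain \<rho> where \<rho>: "\<rho> > 0" "\<And>s. s \<in> {0..1} \<Longrightarrow> \<bar>s - t\<bar> < \<rho> \<Longrightarrow> on u s" using on_near[OF uV t] by blast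
  have "\<exists>s. on u s \<and> s > 0"
  proof (cases "t > 0")
    case False
    then have "t = 0" using t by (auto simp: on_def)
    then have "on u (min 1 (\<rho> / 2))" using \<rho> by (intro \<rho>(2)) auto
    then show ?thesis using \<rho>(1) by (intro exI[of _ "min 1 (\<rho> / 2)"]) auto
  qed (use t in blast)
  then show "tau u > 0" using on_le_tau by force
  moreover have "tau u \<le> 1" by (rule tau_le[OF u]) (simp add: on_def)
  ultimately show "tau u \<in> {0..1}" by simp
qed

lemma bump_in:
  assumes "0 \<le> a" "a < b" "b \<le> 1"
  obtains u where "u \<in> bumps P e" "\<And>t. on u t \<Longrightarrow> a < t \<and> t < b" "a < tau u" "tau u \<le> b"
proof -
  define h where "h = (b - a) / 2"
  have h: "h > 0" using assms by (simp add: h_def)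
  \<comment> \<open>Lowering the tent by \<open>h / 4\<close> absorbs the error of the
    approximation, which is then positive only inside the interval, yet still at its
    midpoint.\<close>
  have "continuous_on {0..1} (\<lambda>t. min (t - a) (b - t) - h / 4)" by (intro continuous_intros)
  moreover have "h / 4 > 0" using h by simp
  ultimately obtain u where u: "u \<in> V" "\<And>t. t \<in> {0..1} \<Longrightarrow> \<bar>J u t - (min (t - a) (b - t) - h / 4)\<bar> < h / 4"
    by (rule approx) (rule that; blast)
  have ab: "a < t \<and> t < b" if "on u t" for t
  proof -
    have "\<bar>J u t - (min (t - a) (b - t) - h / 4)\<bar> < h / 4" "J u t > 0"
      using u(2) that by (simp_all add: on_def)
    then have "min (t - a) (b - t) > 0" by linarith
    then show ?thesis by simp
  qed
  have mid: "(a + b) / 2 \<in> {0..1}" using assms by auto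
  have "min ((a + b) / 2 - a) (b - (a + b) / 2) = h" by (simp add: h_def field_simps)
  then have "J u ((a + b) / 2) > 0" using u(2)[OF mid] h by linarith
  then have "on u ((a + b) / 2)" using mid by (simp add: on_def)
  then have ub: "u \<in> bumps P e" using u(1) bumps_iff by blast
  moreover have "a < tau u" using on_le_tau[OF \<open>on u ((a + b) / 2)\<close>] assms by simp
  moreover have "tau u \<le> b" by (rule tau_le[OF ub]) (use ab in force)
  ultimately show ?thesis using that ab by blast
qed

text \<open>A bump placed strictly between the two suprema is the required witness. Conversely a
  point of \<open>w\<close> below a point of \<open>y\<close> bounds all of
  \<open>x\<close>.\<close>

lemma lt_iff:
  assumes x: "x \<in> bumps P e" and y: "y \<in> bumps P e"
  shows "lt P e l r x y \<longleftrightarrow> tau x < tau y"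
proof
  have V: "x \<in> V" "y \<in> V" using x y bumps_iff by blast+
  {
    assume "lt P e l r x y"
    then obtain w where "w \<in> bumps P e" and w2: "LT P e l r w y" "\<not> LT P e l r w x"
      unfolding lt_def by (elim bexE conjE)
    then have w1: "w \<in> V" using bumps_iff by blast
    obtain a b where ab: "on w a" "on y b" "a < b"
      using w2(1) unfolding LT_iff[OF w1 V(2)] by (elim exE conjE)
    have "c \<le> a" if "on x c" for c
      using w2(2) ab(1) that unfolding LT_iff[OF w1 V(1)] by (meson not_le)
    then have "tau x \<le> a" by (rule tau_le[OF x])
    also have "\<dots> < tau y" using ab on_le_tau by force
    finally show "tau x < tau y" .
  }
  assume "tau x < tau y"
  moreover have "tau x \<ge> 0" using tau_in[OF x] by simp
  moreover have "tau y \<le> 1" using tau_in[OF y] by simp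
  ultimately obtain w where w: "w \<in> bumps P e" "\<And>t. on w t \<Longrightarrow> tau x < t \<and> t < tau y"
    using bump_in[of "tau x" "tau y"] by blast
  have wV: "w \<in> V" using w bumps_iff by blast
  obtain a where a: "on w a" using w bumps_iff by blast
  then obtain b where "on y b" "a < b" using less_tau[OF y] w(2) by blast
  then have "LT P e l r w y" using LT_iff[OF wV V(2)] a by blast
  moreover have "\<not> LT P e l r w x"
    unfolding LT_iff[OF wV V(1)] using w(2) on_le_tau by (meson less_asym not_le order.strict_trans1)
  ultimately show "lt P e l r x y" unfolding lt_def using w(1) by blast
qed

text \<open>The strict inequality persists in a neighbourhood of the point. With \<open>w\<close>
  ending inside it, each bump ending between \<open>w\<close> and \<open>u\<close> has points
  there.\<close>

lemma near_if:
  assumes f: "f \<in> V" and u: "u \<in> bumps P e" and gt: "real_of_rat (Q c) * J e (tau u) < J f (tau u)"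
  shows "near P e l r f u c"
proof -
  define k where "k = sub P f (sc P c e)"
  have k: "k \<in> V" using f by (simp add: k_def)
  have Jk: "J k t = J f t - real_of_rat (Q c) * J e t" if "t \<in> {0..1}" for t
    using that f by (simp add: k_def J_sub J_sc)
  note tu = tau_in[OF u]
  have "on k (tau u)" using Jk[OF tu(1)] gt tu by (simp add: on_def)
  then obtain \<rho> where \<rho>: "\<rho> > 0" "\<And>s. s \<in> {0..1} \<Longrightarrow> \<bar>s - tau u\<bar> < \<rho> \<Longrightarrow> on k s"
    using on_near[OF k] by blast
  define a where "a = max 0 (tau u - \<rho>)"
  have a: "0 \<le> a" "a < tau u" "tau u - \<rho> \<le> a" using \<rho>(1) tu by (auto simp: a_def)
  define b where "b = (a + tau u) / 2"
  have b: "a < b" "b < tau u" "b \<le> 1" using a tu by (auto simp: b_def)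
  obtain w where w: "w \<in> bumps P e" "a < tau w" "tau w \<le> b" using bump_in[OF a(1) b(1,3)] by blast
  have "Meet P e v k" if v: "v \<in> bumps P e" "tau w < tau v" "\<not> tau u < tau v" for v
  proof -
    obtain t where t: "on v t" "tau w < t" using less_tau[OF v(1,2)] by blast
    have "t \<le> tau u" using on_le_tau[OF t(1)] v(3) by simp
    moreover have "tau u - \<rho> < t" using t(2) w(2) a(3) by simp
    ultimately have "\<bar>t - tau u\<bar> < \<rho>" using \<rho>(1) by auto
    then have "on k t" using \<rho>(2)[of t] t(1) by (simp add: on_def)
    moreover have "v \<in> V" using v bumps_iff by blast
    ultimately show ?thesis using t(1) k by (auto simp: Meet_iff on_def)
  qed
  then show ?thesis
    unfolding near_def k_def[symmetric] using w b(2) u by (intro bexI[of _ w]) (auto simp: lt_iff)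
qed

text \<open>If f < c e at the point, then also near it, and a bump just to its left, beyond
  \<open>w\<close>, fails to meet {f > c e}.\<close>

lemma if_near:
  assumes f: "f \<in> V" and u: "u \<in> bumps P e" and near: "near P e l r f u c"
  shows "real_of_rat (Q c) * J e (tau u) \<le> J f (tau u)"
proof (rule ccontr)
  assume less: "\<not> ?thesis"
  define k where "k = sub P (sc P c e) f"
  have k: "k \<in> V" using f by (simp add: k_def)
  have Jk: "J k t = real_of_rat (Q c) * J e t - J f t" if "t \<in> {0..1}" for t
    using that f by (simp add: k_def J_sub J_sc)
  note tu = tau_in[OF u]
  have "on k (tau u)" using Jk[OF tu(1)] less tu by (simp add: on_def)
  then obtain \<rho> where \<rho>: "\<rho> > 0" "\<And>s. s \<in> {0..1} \<Longrightarrow> \<bar>s - tau u\<bar> < \<rho> \<Longrightarrow> on k s"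
    using on_near[OF k] by blast
  obtain w where w: "w \<in> bumps P e" "lt P e l r w u"
    "\<And>v. v \<in> bumps P e \<Longrightarrow> lt P e l r w v \<Longrightarrow> \<not> lt P e l r u v \<Longrightarrow> Meet P e v (sub P f (sc P c e))"
    using near unfolding near_def by blast
  define a where "a = max (tau w) (tau u - \<rho>)"
  have a: "0 \<le> a" "a < tau u" "tau w \<le> a" "tau u - \<rho> \<le> a"
    using \<rho>(1) tu w lt_iff[OF w(1) u] tau_in[OF w(1)] by (auto simp: a_def)
  have "tau u \<le> 1" using tu by simp
  then obtain v where v: "v \<in> bumps P e" "\<And>t. on v t \<Longrightarrow> a < t \<and> t < tau u" "a < tau v" "tau v \<le> tau u"
    using bump_in[OF a(1,2)] by blast
  have "Meet P e v (sub P f (sc P c e))"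
    using v a w(1) u by (intro w(3)) (auto simp: lt_iff)
  moreover have vV: "v \<in> V" using v bumps_iff by blast
  ultimately obtain t where t: "on v t" "J (sub P f (sc P c e)) t > 0"
    using f by (auto simp: Meet_iff on_def)
  have tI: "t \<in> {0..1}" using t by (simp add: on_def)
  have "on k t" using \<rho> v(2)[OF t(1)] a(4) by (intro \<rho>(2)[OF tI]) auto
  then show False using t(2) tI f Jk[OF tI] by (simp add: on_def J_sub J_sc)
qed

section \<open>Values of f / e at the named points\<close>

definition R :: "nat \<Rightarrow> real \<Rightarrow> real" where
  "R f t = J f t / J e t"

lemma R_cont: "f \<in> V \<Longrightarrow> continuous_on {0..1} (R f)"
  unfolding R_def[abs_def] using J_cont e_in e_pos by (intro continuous_on_divide) (auto dest: e_pos)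

lemma le_R_iff: "t \<in> {0..1} \<Longrightarrow> a \<le> R f t \<longleftrightarrow> a * J e t \<le> J f t"
  unfolding R_def using e_pos by (simp add: pos_le_divide_eq)

lemma less_R_iff: "t \<in> {0..1} \<Longrightarrow> a < R f t \<longleftrightarrow> a * J e t < J f t"
  unfolding R_def using e_pos by (simp add: pos_less_divide_eq)

lemma ge_iff:
  assumes f: "f \<in> V" and u: "u \<in> bumps P e"
  shows "ge P e l r f u q \<longleftrightarrow> real_of_rat q \<le> R f (tau u)"
proof
  assume ge: "ge P e l r f u q"
  show "real_of_rat q \<le> R f (tau u)"
  proof (rule ccontr)
    assume "\<not> ?thesis"
    then obtain c where c: "R f (tau u) < real_of_rat (Q c)" "real_of_rat (Q c) < real_of_rat q"
      using ex_code_between[of "R f (tau u)" "real_of_rat q"] by auto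
    then have "Q c < q" by (simp add: of_rat_less)
    then have "near P e l r f u c" using ge unfolding ge_def by blast
    then show False using if_near[OF f u] c(1) le_R_iff[OF tau_in(1)[OF u]] by force
  qed
next
  assume le: "real_of_rat q \<le> R f (tau u)"
  show "ge P e l r f u q"
    unfolding ge_def
  proof (intro allI impI)
    fix c assume "Q c < q"
    then have "real_of_rat (Q c) < real_of_rat q" by (simp add: of_rat_less)
    then have "real_of_rat (Q c) < R f (tau u)" using le by simp
    then show "near P e l r f u c" using near_if[OF f u] less_R_iff[OF tau_in(1)[OF u]] by blast
  qed
qed

lemma close_iff:
  assumes f: "f \<in> V" and x: "x \<in> bumps P e" and y: "y \<in> bumps P e"
  shows "close P e l r f x y s \<longleftrightarrow> R f (tau x) \<le> R f (tau y) + real_of_rat s"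
proof -
  have "close P e l r f x y s \<longleftrightarrow> (\<forall>b. real_of_rat (Q b) \<le> R f (tau x) \<longrightarrow> real_of_rat (Q b) - real_of_rat s \<le> R f (tau y))"
    unfolding close_def ge_iff[OF f x] ge_iff[OF f y] of_rat_diff ..
  also have "\<dots> \<longleftrightarrow> R f (tau x) \<le> R f (tau y) + real_of_rat s"
  proof
    assume a: "\<forall>b. real_of_rat (Q b) \<le> R f (tau x) \<longrightarrow> real_of_rat (Q b) - real_of_rat s \<le> R f (tau y)"
    show "R f (tau x) \<le> R f (tau y) + real_of_rat s"
    proof (rule of_rat_le_imp_le)
      fix q assume q: "real_of_rat q \<le> R f (tau x)"
      obtain b where "Q b = q" using ex_code by blast
      then show "real_of_rat q \<le> R f (tau y) + real_of_rat s" using a q by fastforce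
    qed
  qed auto
  finally show ?thesis .
qed

lemma R_add: "f \<in> V \<Longrightarrow> g \<in> V \<Longrightarrow> t \<in> {0..1} \<Longrightarrow> R (padd P f g) t = R f t + R g t"
  and R_sc: "f \<in> V \<Longrightarrow> t \<in> {0..1} \<Longrightarrow> R (sc P c f) t = real_of_rat (Q c) * R f t"
  and R_neg: "f \<in> V \<Longrightarrow> t \<in> {0..1} \<Longrightarrow> R (neg P f) t = - R f t"
  by (simp_all add: R_def J_add J_sc J_neg add_divide_distrib)

lemma R_e: "t \<in> {0..1} \<Longrightarrow> R e t = 1"
  using e_pos[of t] by (simp add: R_def)

text \<open>Approximating \<open>F\<close> times \<open>e\<close> within \<epsilon> times the
  minimum of \<open>e\<close> survives the division by \<open>e\<close>.\<close>

lemma approx_R: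
  assumes F: "continuous_on {0..1} F" and \<epsilon>: "\<epsilon> > 0"
  obtains p where "p \<in> V" "\<And>t. t \<in> {0..1} \<Longrightarrow> \<bar>R p t - F t\<bar> < \<epsilon>"
proof -
  obtain m where m: "m > 0" "\<And>t. t \<in> {0..1} \<Longrightarrow> m \<le> J e t"
    using positive_lower_bound[OF J_cont[OF e_in] e_pos] by blast
  have "continuous_on {0..1} (\<lambda>t. F t * J e t)" by (intro continuous_intros F J_cont e_in)
  moreover have "\<epsilon> * m > 0" using \<epsilon> m by simp
  ultimately obtain p where p: "p \<in> V" "\<And>t. t \<in> {0..1} \<Longrightarrow> \<bar>J p t - F t * J e t\<bar> < \<epsilon> * m"
    by (rule approx) (rule that; blast)
  have "\<bar>R p t - F t\<bar> < \<epsilon>" if t: "t \<in> {0..1}" for t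
  proof -
    have "J p t - F t * J e t = (R p t - F t) * J e t" using e_pos[OF t] by (simp add: R_def field_simps)
    then have "\<bar>R p t - F t\<bar> * J e t = \<bar>J p t - F t * J e t\<bar>" using e_pos[OF t] by (simp add: abs_mult)
    also have "\<dots> < \<epsilon> * m" by (rule p(2)[OF t])
    also have "\<dots> \<le> \<epsilon> * J e t" using m(2)[OF t] \<epsilon> by simp
    finally show ?thesis using e_pos[OF t] by simp
  qed
  then show ?thesis using that p(1) by blast
qed

lemmas tauI = tau_in(1)

lemma R_tau:
  assumes "u \<in> bumps P e"
  shows "f \<in> V \<Longrightarrow> g \<in> V \<Longrightarrow> R (padd P f g) (tau u) = R f (tau u) + R g (tau u)"
    "f \<in> V \<Longrightarrow> R (sc P c f) (tau u) = real_of_rat (Q c) * R f (tau u)"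
    "f \<in> V \<Longrightarrow> R (neg P f) (tau u) = - R f (tau u)"
    "R e (tau u) = 1"
  by (simp_all add: R_add[OF _ _ tauI[OF assms]] R_sc[OF _ tauI[OF assms]] R_neg[OF _ tauI[OF assms]]
      R_e[OF tauI[OF assms]])

lemma tau_dense:
  assumes "t \<in> {0..1}" "\<rho> > 0"
  obtains u where "u \<in> bumps P e" "\<bar>tau u - t\<bar> < \<rho>"
proof -
  define a b where "a = max 0 (t - \<rho> / 2)" and "b = min 1 (t + \<rho> / 2)"
  have "0 \<le> a" "a < b" "b \<le> 1" using assms by (auto simp: a_def b_def)
  then obtain u where u: "u \<in> bumps P e" "a < tau u" "tau u \<le> b" using bump_in by blast
  have "\<bar>tau u - t\<bar> < \<rho>" using u(2,3) assms by (auto simp: a_def b_def)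
  with u(1) show ?thesis using that by blast
qed

section \<open>Validity of the axioms in C[0,1]\<close>

lemma eval_axioms: "eval_axioms P e l r"
proof -
  have 1: "\<exists>a. \<forall>u\<in>bumps P e. ge P e l r f u (- Q a) \<and> \<not> ge P e l r f u (Q a)" if f: "f \<in> V" for f
  proof -
    obtain b where b: "b > 0" "\<And>t. t \<in> {0..1} \<Longrightarrow> \<bar>R f t\<bar> < b" using abs_upper_bound[OF R_cont[OF f]] by blast
    obtain a where a: "b < real_of_rat (Q a)" using ex_code_between[of b "b + 1"] by auto
    have "- real_of_rat (Q a) \<le> R f (tau u) \<and> \<not> real_of_rat (Q a) \<le> R f (tau u)" if u: "u \<in> bumps P e" for u
      using b(2)[OF tauI[OF u]] a by linarith
    then show ?thesis using f by (auto simp: ge_iff of_rat_minus)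
  qed
  show ?thesis
    unfolding eval_axioms_def
    using 1 by (auto simp: ge_iff R_tau of_rat_add of_rat_minus of_rat_mult mult_left_mono add_mono)
qed

lemma order_axioms: "order_axioms P e l r"
proof -
  have 0: "\<not> (lt P e l r x y \<and> lt P e l r y x)" if "x \<in> bumps P e" "y \<in> bumps P e" for x y
    using that by (auto simp: lt_iff)
  have 1: "\<exists>x\<in>bumps P e. \<exists>y\<in>bumps P e. lt P e l r x y"
  proof -
    obtain x where x: "x \<in> bumps P e" "tau x \<le> 1 / 2" using bump_in[of 0 "1 / 2"] by auto
    obtain y where y: "y \<in> bumps P e" "1 / 2 < tau y" using bump_in[of "1 / 2" 1] by auto
    show ?thesis using x y by (intro bexI[of _ x] bexI[of _ y]) (auto simp: lt_iff)
  qed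
  have 2: "\<exists>p\<in>V. \<exists>\<delta>. 0 < Q \<delta> \<and>
      (\<forall>x\<in>bumps P e. \<forall>y\<in>bumps P e. \<not> lt P e l r y x \<longrightarrow> close P e l r p x y (Q \<delta>)) \<and>
      (\<forall>x\<in>bumps P e. \<forall>y\<in>bumps P e.
        close P e l r p x y (5 * Q \<delta>) \<and> close P e l r p y x (5 * Q \<delta>) \<longrightarrow> close P e l r f x y (Q a))"
    if f: "f \<in> V" and a: "0 < Q a" for f a
  proof -
    have "uniformly_continuous_on {0..1} (R f)"
      by (rule compact_uniformly_continuous[OF R_cont[OF f]]) simp
    moreover have "0 < real_of_rat (Q a)" using a by simp
    ultimately obtain \<rho> where \<rho>: "\<rho> > 0"
      "\<And>x y. x \<in> {0..1} \<Longrightarrow> y \<in> {0..1} \<Longrightarrow> \<bar>y - x\<bar> < \<rho> \<Longrightarrow> \<bar>R f y - R f x\<bar> < real_of_rat (Q a)"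
      unfolding uniformly_continuous_on_def dist_real_def by meson
    \<comment> \<open>With \<open>D\<close> the slack, two points whose \<open>p\<close>-values
      differ by at most \<open>5 * D\<close> are at distance at most \<open>6 * D\<close>, as
      \<open>p\<close> is within \<open>D / 2\<close> of the identity; this is below \<rho>.\<close>
    obtain \<delta> where \<delta>: "0 < real_of_rat (Q \<delta>)" "real_of_rat (Q \<delta>) < \<rho> / 7"
      using ex_code_between[of 0 "\<rho> / 7"] \<rho>(1) by auto
    define D where "D = real_of_rat (Q \<delta>)"
    have D: "D > 0" "D < \<rho> / 7" using \<delta> by (auto simp: D_def)
    have D5: "real_of_rat (5 * Q \<delta>) = 5 * D" by (simp add: D_def of_rat_mult)
    have "continuous_on {0..1} (\<lambda>t::real. t)" by (rule continuous_on_id)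
    moreover have "D / 2 > 0" using D by simp
    ultimately obtain p where p: "p \<in> V" "\<And>t. t \<in> {0..1} \<Longrightarrow> \<bar>R p t - t\<bar> < D / 2"
      by (rule approx_R) (rule that; blast)
    have "close P e l r p x y (Q \<delta>)"
      if xy: "x \<in> bumps P e" "y \<in> bumps P e" "\<not> lt P e l r y x" for x y
    proof -
      have "tau x \<le> tau y" using xy by (simp add: lt_iff)
      then have "R p (tau x) \<le> R p (tau y) + D"
        using p(2)[OF tauI[OF xy(1)]] p(2)[OF tauI[OF xy(2)]] by linarith
      then show ?thesis using close_iff[OF p(1) xy(1,2)] by (simp add: D_def)
    qed
    moreover have "close P e l r f x y (Q a)"
      if xy: "x \<in> bumps P e" "y \<in> bumps P e" "close P e l r p x y (5 * Q \<delta>)" "close P e l r p y x (5 * Q \<delta>)" for x y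
    proof -
      have "R p (tau x) \<le> R p (tau y) + 5 * D" "R p (tau y) \<le> R p (tau x) + 5 * D"
        using xy close_iff[OF p(1)] unfolding D5[symmetric] by auto
      then have "\<bar>tau x - tau y\<bar> < \<rho>"
        using p(2)[OF tauI[OF xy(1)]] p(2)[OF tauI[OF xy(2)]] D by linarith
      then have "\<bar>R f (tau x) - R f (tau y)\<bar> < real_of_rat (Q a)"
        using \<rho>(2)[OF tauI[OF xy(2)] tauI[OF xy(1)]] by blast
      then show ?thesis using close_iff[OF f xy(1,2)] by auto
    qed
    ultimately show ?thesis using p(1) \<delta>(1) by (intro bexI[of _ p] exI[of _ \<delta>]) auto
  qed
  have 3: "\<exists>z\<in>bumps P e. ge P e l r f z (Q a) \<and> \<not> ge P e l r f z (Q b)"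
    if f: "f \<in> V" and xy: "x \<in> bumps P e" "y \<in> bumps P e" and ab: "Q a < Q b" and
      "\<not> ge P e l r f x (Q a)" "ge P e l r f y (Q b)" for f x y a b
  proof -
    have ab': "real_of_rat (Q a) < real_of_rat (Q b)" using ab by (simp add: of_rat_less)
    have fx: "R f (tau x) < real_of_rat (Q a)" and fy: "real_of_rat (Q b) \<le> R f (tau y)"
      using that by (auto simp: ge_iff)
    define m where "m = (real_of_rat (Q a) + real_of_rat (Q b)) / 2"
    have m: "real_of_rat (Q a) < m" "m < real_of_rat (Q b)" using ab' by (auto simp: m_def)
    note tx = tauI[OF xy(1)] and ty = tauI[OF xy(2)]
    have "\<exists>t\<in>{0..1}. R f t = m"
    proof (cases "tau x \<le> tau y")
      case True
      have "continuous_on {tau x..tau y} (R f)" using R_cont[OF f] tx ty by (auto intro: continuous_on_subset)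
      then obtain t where "tau x \<le> t" "t \<le> tau y" "R f t = m"
        using IVT'[of "R f" "tau x" m "tau y"] True fx fy m by auto
      then show ?thesis using tx ty by (intro bexI[of _ t]) auto
    next
      case False
      have "continuous_on {tau y..tau x} (R f)" using R_cont[OF f] tx ty by (auto intro: continuous_on_subset)
      then obtain t where "tau y \<le> t" "t \<le> tau x" "R f t = m"
        using IVT2'[of "R f" "tau x" m "tau y"] False fx fy m by auto
      then show ?thesis using tx ty by (intro bexI[of _ t]) auto
    qed
    then obtain t where t: "t \<in> {0..1}" "R f t = m" by blast
    have "(real_of_rat (Q b) - real_of_rat (Q a)) / 2 > 0" using ab' by simp
    then obtain \<rho> where \<rho>: "\<rho> > 0" "\<And>s. s \<in> {0..1} \<Longrightarrow> \<bar>s - t\<bar> < \<rho> \<Longrightarrow>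
        \<bar>R f s - R f t\<bar> < (real_of_rat (Q b) - real_of_rat (Q a)) / 2"
      using continuous_near[OF R_cont[OF f] t(1)] by blast
    obtain z where z: "z \<in> bumps P e" "\<bar>tau z - t\<bar> < \<rho>" using tau_dense[OF t(1) \<rho>(1)] by blast
    have "\<bar>R f (tau z) - m\<bar> < (real_of_rat (Q b) - real_of_rat (Q a)) / 2"
      using \<rho>(2)[OF tauI[OF z(1)] z(2)] t(2) by simp
    then have "real_of_rat (Q a) \<le> R f (tau z)" "\<not> real_of_rat (Q b) \<le> R f (tau z)"
      unfolding m_def by (auto simp: abs_less_iff field_simps)
    then show ?thesis using z(1) f by (intro bexI[of _ z]) (auto simp: ge_iff)
  qed
  have 4: "\<exists>f\<in>V. \<forall>u\<in>bumps P e. (\<not> lt P e l r x u \<longrightarrow> \<not> ge P e l r f u 0) \<and> (\<not> lt P e l r u y \<longrightarrow> ge P e l r f u 1)"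
    if xy: "x \<in> bumps P e" "y \<in> bumps P e" "lt P e l r x y" for x y
  proof -
    define h where "h = tau y - tau x"
    have h: "h > 0" using xy by (simp add: h_def lt_iff)
    \<comment> \<open>A line with value -1 at \<open>tau x\<close> and 2 at \<open>tau y\<close>: an
      error below 1 leaves negative values up to \<open>tau x\<close> and values at least 1 from
      \<open>tau y\<close> on.\<close>
    define F where "F = (\<lambda>t. 3 * (t - tau x) / h - 1)"
    have "continuous_on {0..1} F" unfolding F_def using h by (intro continuous_intros) auto
    then obtain f where f: "f \<in> V" "\<And>t. t \<in> {0..1} \<Longrightarrow> \<bar>R f t - F t\<bar> < 1"
      by (rule approx_R[OF _ zero_less_one]) (rule that; blast)
    have "R f (tau u) < 0" if u: "u \<in> bumps P e" "tau u \<le> tau x" for u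
    proof -
      have "F (tau u) \<le> - 1" unfolding F_def using u h by (simp add: divide_nonpos_pos)
      then show ?thesis using f(2)[OF tauI[OF u(1)]] by linarith
    qed
    moreover have "1 \<le> R f (tau u)" if u: "u \<in> bumps P e" "tau y \<le> tau u" for u
    proof -
      have "3 * h / h \<le> 3 * (tau u - tau x) / h" using u h by (intro divide_right_mono) (auto simp: h_def)
      then have "F (tau u) \<ge> 2" unfolding F_def using h by simp
      then show ?thesis using f(2)[OF tauI[OF u(1)]] by linarith
    qed
    ultimately show ?thesis using f(1) xy by (intro bexI[of _ f]) (auto simp: ge_iff lt_iff not_less not_le)
  qed
  show ?thesis
    unfolding order_axioms_def
  proof (intro conjI ballI allI impI)
    show "\<not> (lt P e l r x y \<and> lt P e l r y x)" if "x \<in> bumps P e" "y \<in> bumps P e" for x y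
      using 0 that by blast
    show "\<exists>x\<in>bumps P e. \<exists>y\<in>bumps P e. lt P e l r x y" by (rule 1)
  qed (rule 2 3 4; (elim conjE)?; assumption)+
qed

lemma norm_axioms: "norm_axioms P e l r"
proof -
  have 1: "\<exists>k\<in>V. \<forall>u\<in>bumps P e. \<forall>b. 0 \<le> Q b \<longrightarrow>
      (ge P e l r f u (Q b) \<or> ge P e l r (neg P f) u (Q b) \<longrightarrow> ge P e l r k u (Q b * Q b - Q a)) \<and>
      (\<not> ge P e l r f u (Q b) \<and> \<not> ge P e l r (neg P f) u (Q b) \<longrightarrow> \<not> ge P e l r k u (Q b * Q b + Q a))"
    if f: "f \<in> V" and a: "0 < Q a" for f a
  proof -
    have "continuous_on {0..1} (\<lambda>t. R f t * R f t)" by (intro continuous_intros R_cont[OF f])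
    moreover have "0 < real_of_rat (Q a)" using a by simp
    ultimately obtain k where k: "k \<in> V" "\<And>t. t \<in> {0..1} \<Longrightarrow> \<bar>R k t - R f t * R f t\<bar> < real_of_rat (Q a)"
      by (rule approx_R) (rule that; blast)
    show ?thesis
    proof (intro bexI[OF _ k(1)] ballI allI impI)
      fix u b assume u: "u \<in> bumps P e" and b: "0 \<le> Q b"
      define x y where "x = R f (tau u)" and "y = real_of_rat (Q b)"
      have y: "y \<ge> 0" using b by (simp add: y_def)
      have kx: "\<bar>R k (tau u) - x * x\<bar> < real_of_rat (Q a)" using k(2)[OF tauI[OF u]] by (simp add: x_def)
      have "y * y \<le> x * x" if "y \<le> x \<or> y \<le> - x"
        using that y mult_mono[of y x y x] mult_mono[of y "- x" y "- x"] by auto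
      then have A: "y * y - real_of_rat (Q a) \<le> R k (tau u)" if "y \<le> x \<or> y \<le> - x" using that kx by linarith
      have "x * x \<le> y * y" if "\<not> y \<le> x" "\<not> y \<le> - x"
        using that y abs_mult_self_eq[of x] mult_mono[of "\<bar>x\<bar>" y "\<bar>x\<bar>" y] by auto
      then have B: "\<not> y * y + real_of_rat (Q a) \<le> R k (tau u)" if "\<not> y \<le> x" "\<not> y \<le> - x" using that kx by linarith
      show "(ge P e l r f u (Q b) \<or> ge P e l r (neg P f) u (Q b) \<longrightarrow> ge P e l r k u (Q b * Q b - Q a)) \<and>
        (\<not> ge P e l r f u (Q b) \<and> \<not> ge P e l r (neg P f) u (Q b) \<longrightarrow> \<not> ge P e l r k u (Q b * Q b + Q a))"
        using A B f u k(1) by (simp add: ge_iff R_tau of_rat_diff of_rat_add of_rat_mult x_def y_def)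
    qed
  qed
  have 2: "\<exists>h\<in>V. nlt P h 1 \<and> (\<forall>f\<in>V. nlt P f 1 \<longrightarrow>
      (\<forall>u\<in>bumps P e. \<forall>b. ge P e l r f u (Q b) \<longrightarrow> ge P e l r h u (Q b - Q a)))"
    if a: "0 < Q a" for a
  proof -
    define A where "A = real_of_rat (Q a)"
    have A: "A > 0" using a by (simp add: A_def)
    obtain m where m: "m > 0" "\<And>t. t \<in> {0..1} \<Longrightarrow> m \<le> J e t"
      using positive_lower_bound[OF J_cont[OF e_in] e_pos] by blast
    \<comment> \<open>\<open>h\<close> is nearly the constant \<open>1 - \<eta>\<close>: it lies in
      the open unit ball, and no other member exceeds it by more than \<open>2 * \<eta>\<close>,
      which after division by \<open>e\<close> is at most \<open>A\<close>.\<close>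
    define \<eta> where "\<eta> = min (1 / 2) (A * m / 2)"
    have \<eta>: "\<eta> > 0" "\<eta> \<le> 1 / 2" "2 * \<eta> \<le> A * m" using A m by (auto simp: \<eta>_def)
    have "continuous_on {0..1} (\<lambda>t::real. 1 - \<eta>)" by simp
    then obtain h where h: "h \<in> V" "\<And>t. t \<in> {0..1} \<Longrightarrow> \<bar>J h t - (1 - \<eta>)\<bar> < \<eta>"
      by (rule approx[OF _ \<eta>(1)]) (rule that; blast)
    have "\<bar>J h t\<bar> < 1" if "t \<in> {0..1}" for t using h(2)[OF that] \<eta> by linarith
    then have "nlt P h 1" using h(1) by (simp add: nlt_iff_abs_less)
    moreover have dom: "R f (tau u) \<le> R h (tau u) + A" if f: "f \<in> V" "nlt P f 1" and u: "u \<in> bumps P e" for f u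
    proof -
      let ?t = "tau u"
      note t = tauI[OF u]
      have "\<bar>J f ?t\<bar> < 1" using f t by (simp add: nlt_iff_abs_less)
      then have "J f ?t \<le> J h ?t + 2 * \<eta>" using h(2)[OF t] by linarith
      also have "\<dots> \<le> J h ?t + A * J e ?t" using \<eta>(3) mult_left_mono[OF m(2)[OF t], of A] A by linarith
      finally have "J f ?t / J e ?t \<le> (J h ?t + A * J e ?t) / J e ?t"
        using e_pos[OF t] by (intro divide_right_mono) auto
      then show ?thesis unfolding R_def using e_pos[OF t] by (simp add: add_divide_distrib)
    qed
    moreover have "ge P e l r h u (Q b - Q a)"
      if f: "f \<in> V" "nlt P f 1" and u: "u \<in> bumps P e" and b: "ge P e l r f u (Q b)" for f u b
    proof -
      have "real_of_rat (Q b) \<le> R f (tau u)" using b ge_iff[OF f(1) u] by simp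
      then have "real_of_rat (Q b) - A \<le> R h (tau u)" using dom[OF f u] by linarith
      then show ?thesis by (simp add: ge_iff[OF h(1) u] of_rat_diff A_def)
    qed
    ultimately show ?thesis using h(1) by blast
  qed
  have 3: "nlt P f (Q b)"
    if f: "f \<in> V" and h: "h \<in> V" and nl: "nlt P h (Q b)"
      and dom: "\<forall>u\<in>bumps P e. \<forall>a. ge P e l r f u (Q a) \<or> ge P e l r (neg P f) u (Q a) \<longrightarrow> ge P e l r h u (Q a)"
    for f h b
  proof -
    have tau_le: "\<bar>R f (tau u)\<bar> \<le> R h (tau u)" if u: "u \<in> bumps P e" for u
    proof (rule of_rat_le_imp_le)
      fix q assume q: "real_of_rat q \<le> \<bar>R f (tau u)\<bar>"
      obtain a where a: "Q a = q" using ex_code by blast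
      have "ge P e l r f u q \<or> ge P e l r (neg P f) u q"
        using q f u by (auto simp: ge_iff R_tau abs_if split: if_splits)
      then have "ge P e l r h u q" using dom u a by blast
      then show "real_of_rat q \<le> R h (tau u)" using h u by (simp add: ge_iff)
    qed
    have le: "\<bar>R f t\<bar> \<le> R h t" if t: "t \<in> {0..1}" for t
    proof (rule ccontr)
      assume "\<not> ?thesis"
      then have pos: "\<bar>R f t\<bar> - R h t > 0" by simp
      have "continuous_on {0..1} (\<lambda>t. \<bar>R f t\<bar> - R h t)" by (intro continuous_intros R_cont f h)
      from continuous_near[OF this t pos] obtain \<rho> where \<rho>: "\<rho> > 0"
        "\<And>s. s \<in> {0..1} \<Longrightarrow> \<bar>s - t\<bar> < \<rho> \<Longrightarrow> \<bar>\<bar>R f s\<bar> - R h s - (\<bar>R f t\<bar> - R h t)\<bar> < \<bar>R f t\<bar> - R h t" by metis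
      obtain u where u: "u \<in> bumps P e" "\<bar>tau u - t\<bar> < \<rho>" using tau_dense[OF t \<rho>(1)] by blast
      show False using \<rho>(2)[OF tauI[OF u(1)] u(2)] tau_le[OF u(1)] by linarith
    qed
    have "\<bar>J f t\<bar> < real_of_rat (Q b)" if t: "t \<in> {0..1}" for t
    proof -
      have "\<bar>J f t\<bar> = \<bar>R f t\<bar> * J e t" using e_pos[OF t] by (simp add: R_def abs_divide)
      also have "\<dots> \<le> R h t * J e t" using le[OF t] e_pos[OF t] by (intro mult_right_mono) auto
      also have "\<dots> = J h t" using e_pos[OF t] by (simp add: R_def)
      also have "\<dots> < real_of_rat (Q b)"
        using nl[unfolded nlt_iff_abs_less[OF h], rule_format, OF t] by linarith
      finally show ?thesis .
    qed
    then show ?thesis using nlt_iff_abs_less[OF f] by blast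
  qed
  show ?thesis
    unfolding norm_axioms_def by (intro conjI ballI allI impI) (rule 1 2 3; assumption)+
qed

end

lemma (in C01_rep) looks_like_C01: "looks_like_C01 P"
proof -
  \<comment> \<open>The error 1/6 keeps \<open>l\<close> nonpositive to the right of 1/2 and
    \<open>r\<close> nonpositive to the left of 1/2, while they remain positive at 0 and at 1
    respectively.\<close>
  have c: "continuous_on {0..1} (\<lambda>t::real. 1::real)" "continuous_on {0..1} (\<lambda>t::real. 1 / 3 - t)"
    "continuous_on {0..1} (\<lambda>t::real. t - 2 / 3)" by (intro continuous_intros)+
  have p: "1 / 6 > (0::real)" by simp
  obtain e where e: "e \<in> V" "\<And>t. t \<in> {0..1} \<Longrightarrow> \<bar>J e t - 1\<bar> < 1 / 6" using approx[OF c(1) p] by blast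
  obtain l where l: "l \<in> V" "\<And>t. t \<in> {0..1} \<Longrightarrow> \<bar>J l t - (1 / 3 - t)\<bar> < 1 / 6" using approx[OF c(2) p] by blast
  obtain r where r: "r \<in> V" "\<And>t. t \<in> {0..1} \<Longrightarrow> \<bar>J r t - (t - 2 / 3)\<bar> < 1 / 6" using approx[OF c(3) p] by blast
  interpret C01_frame P J e l r
  proof unfold_locales
    show "J e t > 0" if "t \<in> {0..1}" for t using e(2)[OF that] by linarith
    have "\<bar>J l 0 - (1 / 3 - 0)\<bar> < 1 / 6" by (rule l(2)) simp
    then have "J l 0 > 0" by linarith
    then show "\<exists>t\<in>{0..1}. J l t > 0" by (intro bexI[of _ 0]) auto
    have "\<bar>J r 1 - (1 - 2 / 3)\<bar> < 1 / 6" by (rule r(2)) simp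
    then have "J r 1 > 0" by linarith
    then show "\<exists>t\<in>{0..1}. J r t > 0" by (intro bexI[of _ 1]) auto
    show "s < t" if "s \<in> {0..1}" "t \<in> {0..1}" "J l s > 0" "J r t > 0" for s t
      using l(2)[OF that(1)] r(2)[OF that(2)] that(3,4) by linarith
  qed (fact e(1) l(1) r(1))+
  show ?thesis
    unfolding looks_like_C01_def using e(1) l(1) r(1) eval_axioms order_axioms norm_axioms by blast
qed

section \<open>Recovering the embedding from the formula\<close>

locale evaluation = normed_presentation +
  fixes e l r :: nat
  assumes e_in [simp]: "e \<in> points P"
    and ev: "eval_axioms P e l r" and ord: "order_axioms P e l r" and nrm: "norm_axioms P e l r"
begin

abbreviation "U \<equiv> bumps P e"
abbreviation "G \<equiv> ge P e l r"

section \<open>Evaluations as linear functionals\<close>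

definition psi :: "nat \<Rightarrow> nat \<Rightarrow> real" where
  "psi f u = Sup {real_of_rat q | q. G f u q}"

definition dn :: "nat \<Rightarrow> nat set" where
  "dn x = {w \<in> U. LT P e l r w x}"

text \<open>The existential shape of \<open>lt\<close> turns it into a failure of inclusion, so that
  the preorder is transitive at once; asymmetry of \<open>lt\<close> then makes the lower sets a
  chain.\<close>

lemma lt_iff_dn: "lt P e l r x y \<longleftrightarrow> \<not> dn y \<subseteq> dn x"
  unfolding lt_def dn_def by blast

lemmas ev_unfolded = ev[unfolded eval_axioms_def]
lemmas ev1 = ev_unfolded[THEN conjunct1, rule_format]
  and ev2 = ev_unfolded[THEN conjunct2, THEN conjunct1, rule_format, OF _ _ _ conjI]
  and ev3 = ev_unfolded[THEN conjunct2, THEN conjunct2, THEN conjunct1, rule_format, OF _ _ conjI]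
  and ev4 = ev_unfolded[THEN conjunct2, THEN conjunct2, THEN conjunct2, THEN conjunct1, rule_format]
  and ev5 = ev_unfolded[THEN conjunct2, THEN conjunct2, THEN conjunct2, THEN conjunct2, rule_format]

lemmas ord_unfolded = ord[unfolded order_axioms_def]
lemmas ord1 = ord_unfolded[THEN conjunct1, rule_format]
  and ord2 = ord_unfolded[THEN conjunct2, THEN conjunct1]
  and ord3 = ord_unfolded[THEN conjunct2, THEN conjunct2, THEN conjunct1, rule_format]
  and ord5 = ord_unfolded[THEN conjunct2, THEN conjunct2, THEN conjunct2, THEN conjunct2, rule_format]

lemmas nrm_unfolded = nrm[unfolded norm_axioms_def]
lemmas nrm1 = nrm_unfolded[THEN conjunct1, rule_format]
  and nrm2 = nrm_unfolded[THEN conjunct2, THEN conjunct1, rule_format]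
  and nrm3 = nrm_unfolded[THEN conjunct2, THEN conjunct2]

text \<open>\<open>ge\<close> at \<open>q\<close> is a condition for all rationals below
  \<open>q\<close>. Hence it is inherited by smaller rationals and by a rational supremum, and the
  first evaluation axiom bounds the cut on both sides.\<close>

lemma ge_iff_psi:
  assumes f: "f \<in> V" and u: "u \<in> U"
  shows "G f u q \<longleftrightarrow> real_of_rat q \<le> psi f u"
proof -
  let ?S = "{real_of_rat q | q. G f u q}"
  obtain a where a: "G f u (- Q a)" "\<not> G f u (Q a)" using ev1[OF f] u by blast
  have down: "G f u q'" if "G f u q" "q' \<le> q" for q q'
    using that unfolding ge_def by (meson order.strict_trans2)
  have bdd: "bdd_above ?S"
  proof (rule bdd_aboveI)
    fix s assume "s \<in> ?S"
    then obtain q where q: "s = real_of_rat q" "G f u q" by blast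
    then have "q \<le> Q a" using down a(2) by (meson linear)
    then show "s \<le> real_of_rat (Q a)" using q by (simp add: of_rat_less_eq)
  qed
  have ne: "?S \<noteq> {}" using a(1) by blast
  show ?thesis
  proof
    assume "G f u q"
    then show "real_of_rat q \<le> psi f u" unfolding psi_def by (intro cSup_upper[OF _ bdd]) blast
  next
    assume le: "real_of_rat q \<le> psi f u"
    show "G f u q" unfolding ge_def
    proof (intro allI impI)
      fix c assume "Q c < q"
      then have "real_of_rat (Q c) < psi f u" using le by (meson of_rat_less less_le_trans)
      then obtain s where "s \<in> ?S" "real_of_rat (Q c) < s"
        unfolding psi_def using less_cSup_iff[OF ne bdd] by blast
      then obtain p where p: "G f u p" "real_of_rat (Q c) < real_of_rat p" by blast
      then have "Q c < p" by (simp add: of_rat_less)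
      then show "near P e l r f u c" using p(1) unfolding ge_def by blast
    qed
  qed
qed

lemma psi_leI:
  assumes "f \<in> V" "u \<in> U" "\<And>c. G f u (Q c) \<Longrightarrow> real_of_rat (Q c) \<le> y"
  shows "psi f u \<le> y"
proof (rule of_rat_le_imp_le)
  fix q assume "real_of_rat q \<le> psi f u"
  moreover obtain c where "Q c = q" using ex_code by blast
  ultimately show "real_of_rat q \<le> y" using ge_iff_psi[OF assms(1,2)] assms(3)[of c] by simp
qed

lemma close_iff_psi:
  assumes f: "f \<in> V" and x: "x \<in> U" and y: "y \<in> U"
  shows "close P e l r f x y s \<longleftrightarrow> psi f x \<le> psi f y + real_of_rat s"
proof
  assume a: "close P e l r f x y s"
  show "psi f x \<le> psi f y + real_of_rat s"
  proof (rule psi_leI[OF f x])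
    fix c assume "G f x (Q c)"
    then have "G f y (Q c - s)" using a unfolding close_def by blast
    then show "real_of_rat (Q c) \<le> psi f y + real_of_rat s"
      unfolding ge_iff_psi[OF f y] of_rat_diff by linarith
  qed
next
  assume a: "psi f x \<le> psi f y + real_of_rat s"
  show "close P e l r f x y s"
    unfolding close_def ge_iff_psi[OF f x] ge_iff_psi[OF f y] of_rat_diff using a by auto
qed

lemma psi_bounded:
  assumes f: "f \<in> V" obtains b where "b \<ge> 0" "\<And>u. u \<in> U \<Longrightarrow> \<bar>psi f u\<bar> \<le> b"
proof -
  obtain a where a: "\<And>u. u \<in> U \<Longrightarrow> G f u (- Q a) \<and> \<not> G f u (Q a)" using ev1[OF f] by blast
  have "\<bar>psi f u\<bar> \<le> \<bar>real_of_rat (Q a)\<bar>" if "u \<in> U" for u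
    using a[OF that] unfolding ge_iff_psi[OF f that] of_rat_minus by linarith
  then show ?thesis using that[of "\<bar>real_of_rat (Q a)\<bar>"] by simp
qed

lemma psi_superadd:
  assumes f: "f \<in> V" and g: "g \<in> V" and u: "u \<in> U"
  shows "psi f u + psi g u \<le> psi (padd P f g) u"
proof -
  have fg: "padd P f g \<in> V" using f g by simp
  have "psi f u \<le> psi (padd P f g) u - psi g u"
  proof (rule psi_leI[OF f u])
    fix a assume a: "G f u (Q a)"
    have "psi g u \<le> psi (padd P f g) u - real_of_rat (Q a)"
    proof (rule psi_leI[OF g u])
      fix b assume "G g u (Q b)"
      then have "G (padd P f g) u (Q a + Q b)" using ev2[OF f g u a] by blast
      then show "real_of_rat (Q b) \<le> psi (padd P f g) u - real_of_rat (Q a)"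
        unfolding ge_iff_psi[OF fg u] of_rat_add by linarith
    qed
    then show "real_of_rat (Q a) \<le> psi (padd P f g) u - psi g u" by linarith
  qed
  then show ?thesis by linarith
qed

lemma psi_neg_ge:
  assumes f: "f \<in> V" and u: "u \<in> U"
  shows "- psi f u \<le> psi (mns f) u"
proof (rule ccontr)
  assume "\<not> ?thesis"
  then have "psi f u < - psi (mns f) u" by linarith
  then obtain c where c: "psi f u < real_of_rat (Q c)" "real_of_rat (Q c) < - psi (mns f) u"
    using ex_code_between by blast
  have "\<not> G f u (Q c)" using c(1) ge_iff_psi[OF f u] by simp
  then have "G (neg P f) u (- Q c)" using ev4[OF f u] by blast
  then have "- real_of_rat (Q c) \<le> psi (mns f) u"
    using f u neg_eq[OF f] ge_iff_psi[of "mns f" u "- Q c"] by (simp add: of_rat_minus)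
  then show False using c(2) by linarith
qed

text \<open>Superadditivity gives that the value is at most 0, the rule for negatives that it is at
  least 0.\<close>

lemma psi_zero: "u \<in> U \<Longrightarrow> psi pzero u = 0"
proof -
  assume u: "u \<in> U"
  have m: "mns pzero = pzero" using add_mns[of pzero] zero_add[of "mns pzero"] by simp
  show ?thesis
    using psi_superadd[of pzero pzero u] psi_neg_ge[of pzero u] u add_zero[of pzero] m by simp
qed

lemma psi_neg: "f \<in> V \<Longrightarrow> u \<in> U \<Longrightarrow> psi (mns f) u = - psi f u"
  using psi_neg_ge[of f u] psi_superadd[of f "mns f" u] psi_zero[of u] by (simp add: add_mns)

text \<open>The reverse inequality is superadditivity for \<open>padd P f g\<close> and
  \<open>mns g\<close>.\<close>

lemma psi_add:
  assumes f: "f \<in> V" and g: "g \<in> V" and u: "u \<in> U"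
  shows "psi (padd P f g) u = psi f u + psi g u"
proof -
  have "padd P (padd P f g) (mns g) = padd P f (padd P g (mns g))" using f g by (intro add_assoc) auto
  also have "\<dots> = f" using f g by (simp add: add_mns add_zero)
  finally have "psi (padd P f g) u + psi (mns g) u \<le> psi f u"
    using psi_superadd[of "padd P f g" "mns g" u] f g u by simp
  then show ?thesis using psi_superadd[OF f g u] psi_neg[OF g u] by linarith
qed

lemma psi_scale_pos_ge:
  assumes f: "f \<in> V" and u: "u \<in> U" and q: "q > 0"
  shows "real_of_rat q * psi f u \<le> psi (pscale P q f) u"
proof -
  obtain c where c: "Q c = q" using ex_code by blast
  have qr: "real_of_rat q > 0" using q by simp
  have sf: "pscale P q f \<in> V" using f by simp
  have "psi f u \<le> psi (pscale P q f) u / real_of_rat q"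
  proof (rule psi_leI[OF f u])
    fix a assume "G f u (Q a)"
    then have "G (sc P c f) u (Q c * Q a)" using ev3[OF f u] q c by blast
    then have "real_of_rat q * real_of_rat (Q a) \<le> psi (pscale P q f) u"
      unfolding sc_eq[OF f] c ge_iff_psi[OF sf u] of_rat_mult .
    then show "real_of_rat (Q a) \<le> psi (pscale P q f) u / real_of_rat q"
      using qr by (simp add: pos_le_divide_eq mult.commute)
  qed
  then show ?thesis using qr by (simp add: pos_le_divide_eq mult.commute)
qed

text \<open>The reverse inequality is the lower bound for the factor \<open>1 / q\<close>.\<close>

lemma psi_scale_pos:
  assumes f: "f \<in> V" and u: "u \<in> U" and q: "q > 0"
  shows "psi (pscale P q f) u = real_of_rat q * psi f u"
proof (rule antisym)
  have qr: "real_of_rat q > 0" using q by simp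
  have "pscale P (1 / q) (pscale P q f) = f" using f q by (simp add: scale_scale scale_one)
  then have "real_of_rat (1 / q) * psi (pscale P q f) u \<le> psi f u"
    using psi_scale_pos_ge[of "pscale P q f" u "1 / q"] f u q by simp
  then have "psi (pscale P q f) u / real_of_rat q \<le> psi f u" by (simp add: of_rat_divide)
  then show "psi (pscale P q f) u \<le> real_of_rat q * psi f u"
    using qr by (simp add: pos_divide_le_eq mult.commute)
qed (rule psi_scale_pos_ge[OF f u q])

lemma psi_scale:
  assumes f: "f \<in> V" and u: "u \<in> U"
  shows "psi (pscale P q f) u = real_of_rat q * psi f u"
proof (cases q "0 :: rat" rule: linorder_cases)
  case less
  then have "psi (pscale P (- q) (mns f)) u = real_of_rat (- q) * psi (mns f) u"
    using f u by (intro psi_scale_pos) auto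
  then show ?thesis using f u by (simp add: scale_scale psi_neg of_rat_minus)
next
  case equal
  then show ?thesis using f u by (simp add: scale_zero psi_zero)
next
  case greater
  then show ?thesis using f u by (intro psi_scale_pos) auto
qed

lemma psi_e: "u \<in> U \<Longrightarrow> psi e u = 1"
proof -
  assume u: "u \<in> U"
  have "G e u 1" "G (neg P e) u (- 1)" using ev5[OF u] by blast+
  then have "1 \<le> psi e u" "- 1 \<le> psi (mns e) u"
    using u neg_eq[OF e_in] ge_iff_psi[of e u 1] ge_iff_psi[of "mns e" u "- 1"] by (simp_all add: of_rat_minus)
  then show ?thesis using psi_neg[OF e_in u] by linarith
qed

section \<open>Order, squares and norm in terms of evaluations\<close>

lemma dn_total: "x \<in> U \<Longrightarrow> y \<in> U \<Longrightarrow> dn x \<subseteq> dn y \<or> dn y \<subseteq> dn x"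
  using ord1[of x y] unfolding lt_iff_dn by blast

lemma dn_nontrivial: obtains x y where "x \<in> U" "y \<in> U" "\<not> dn y \<subseteq> dn x"
  using ord2 unfolding lt_iff_dn by blast

lemma psi_control:
  assumes f: "f \<in> V" and \<epsilon>: "\<epsilon> > 0"
  obtains p \<delta> where "p \<in> V" "\<delta> > 0"
    "\<And>x y. x \<in> U \<Longrightarrow> y \<in> U \<Longrightarrow> dn x \<subseteq> dn y \<Longrightarrow> psi p x \<le> psi p y + \<delta>"
    "\<And>x y. x \<in> U \<Longrightarrow> y \<in> U \<Longrightarrow> \<bar>psi p x - psi p y\<bar> \<le> 5 * \<delta> \<Longrightarrow> \<bar>psi f x - psi f y\<bar> \<le> \<epsilon>"
proof -
  obtain a where a: "0 < real_of_rat (Q a)" "real_of_rat (Q a) < \<epsilon>" using ex_code_between[OF \<epsilon>] by blast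
  then have "0 < Q a" by simp
  obtain p c where p: "p \<in> V" "0 < Q c"
    and 1: "\<forall>x\<in>U. \<forall>y\<in>U. \<not> lt P e l r y x \<longrightarrow> close P e l r p x y (Q c)"
    and 2: "\<forall>x\<in>U. \<forall>y\<in>U. close P e l r p x y (5 * Q c) \<and> close P e l r p y x (5 * Q c)
        \<longrightarrow> close P e l r f x y (Q a)"
    using ord3[OF f \<open>0 < Q a\<close>] by (elim bexE exE conjE)
  define \<delta> where "\<delta> = real_of_rat (Q c)"
  have \<delta>5: "real_of_rat (5 * Q c) = 5 * \<delta>" by (simp add: \<delta>_def of_rat_mult)
  have "\<delta> > 0" using p by (simp add: \<delta>_def)
  moreover have "psi p x \<le> psi p y + \<delta>" if "x \<in> U" "y \<in> U" "dn x \<subseteq> dn y" for x y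
    using 1 that close_iff_psi[OF p(1)] lt_iff_dn unfolding \<delta>_def by blast
  moreover have "\<bar>psi f x - psi f y\<bar> \<le> \<epsilon>" if xy: "x \<in> U" "y \<in> U" "\<bar>psi p x - psi p y\<bar> \<le> 5 * \<delta>" for x y
  proof -
    have "close P e l r p x y (5 * Q c)" "close P e l r p y x (5 * Q c)"
      unfolding close_iff_psi[OF p(1) xy(1,2)] close_iff_psi[OF p(1) xy(2,1)] \<delta>5 using xy(3) by linarith+
    then have "close P e l r f x y (Q a)" "close P e l r f y x (Q a)" using 2 xy by blast+
    then show ?thesis
      unfolding close_iff_psi[OF f xy(1,2)] close_iff_psi[OF f xy(2,1)] using a(2) by linarith
  qed
  ultimately show ?thesis using that p(1) by blast
qed

lemma psi_ivt:
  assumes f: "f \<in> V" and xy: "x \<in> U" "y \<in> U" and a: "psi f x < a" "a < b" "b < psi f y"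
  obtains z where "z \<in> U" "a < psi f z" "psi f z < b"
proof -
  obtain c where c: "a < real_of_rat (Q c)" "real_of_rat (Q c) < b" using ex_code_between[OF a(2)] by blast
  obtain c' where c': "real_of_rat (Q c) < real_of_rat (Q c')" "real_of_rat (Q c') < b"
    using ex_code_between[OF c(2)] by blast
  have cc: "Q c < Q c'" using c'(1) by (simp add: of_rat_less)
  have "\<not> G f x (Q c)" "G f y (Q c')"
    using ge_iff_psi[OF f xy(1)] ge_iff_psi[OF f xy(2)] a c c' by auto
  then obtain z where z: "z \<in> U" "G f z (Q c)" "\<not> G f z (Q c')"
    using ord_unfolded[THEN conjunct2, THEN conjunct2, THEN conjunct2, THEN conjunct1] f xy cc by metis
  then have "a < psi f z" "psi f z < b" using ge_iff_psi[OF f z(1)] c c' by auto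
  then show ?thesis using that z(1) by blast
qed

lemma psi_step:
  assumes "x \<in> U" "y \<in> U" "\<not> dn y \<subseteq> dn x"
  obtains f where "f \<in> V" "\<And>u. u \<in> U \<Longrightarrow> dn u \<subseteq> dn x \<Longrightarrow> psi f u < 0"
    "\<And>u. u \<in> U \<Longrightarrow> dn y \<subseteq> dn u \<Longrightarrow> 1 \<le> psi f u"
proof -
  obtain f where f: "f \<in> V"
    "\<And>u. u \<in> U \<Longrightarrow> dn u \<subseteq> dn x \<Longrightarrow> \<not> G f u 0" "\<And>u. u \<in> U \<Longrightarrow> dn y \<subseteq> dn u \<Longrightarrow> G f u 1"
    using ord5[of x y] assms unfolding lt_iff_dn by blast
  show ?thesis
  proof (rule that[OF f(1)])
    show "psi f u < 0" if "u \<in> U" "dn u \<subseteq> dn x" for u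
      using f(2)[OF that] ge_iff_psi[OF f(1) that(1), of 0] by simp
    show "1 \<le> psi f u" if "u \<in> U" "dn y \<subseteq> dn u" for u
      using f(3)[OF that] ge_iff_psi[OF f(1) that(1), of 1] by simp
  qed
qed

lemma psi_square:
  assumes f: "f \<in> V" and \<epsilon>: "\<epsilon> > 0"
  obtains k where "k \<in> V" "\<And>u. u \<in> U \<Longrightarrow> \<bar>psi k u - psi f u * psi f u\<bar> \<le> \<epsilon>"
proof -
  obtain a where a: "0 < real_of_rat (Q a)" "real_of_rat (Q a) < \<epsilon>" using ex_code_between[OF \<epsilon>] by blast
  then have "0 < Q a" by simp
  obtain k where k: "k \<in> V" and k': "\<forall>u\<in>U. \<forall>b. 0 \<le> Q b \<longrightarrow>
      (G f u (Q b) \<or> G (neg P f) u (Q b) \<longrightarrow> G k u (Q b * Q b - Q a)) \<and>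
      (\<not> G f u (Q b) \<and> \<not> G (neg P f) u (Q b) \<longrightarrow> \<not> G k u (Q b * Q b + Q a))"
    using nrm1[OF f \<open>0 < Q a\<close>] by (elim bexE)
  have "\<bar>psi k u - psi f u * psi f u\<bar> \<le> \<epsilon>" if u: "u \<in> U" for u
  proof -
    define x where "x = \<bar>psi f u\<bar>"
    have xx: "psi f u * psi f u = x * x" by (simp add: x_def)
    have x0: "x \<ge> 0" by (simp add: x_def)
    have mf: "mns f \<in> V" using f by simp
    have Gn: "G (neg P f) u (Q b) \<longleftrightarrow> real_of_rat (Q b) \<le> - psi f u" for b
      using ge_iff_psi[OF mf u] psi_neg[OF f u] neg_eq[OF f] by simp
    have lo: "y * y - real_of_rat (Q a) \<le> psi k u" if y: "y = real_of_rat (Q b)" "0 \<le> y" "y \<le> x" for y b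
    proof -
      have "G f u (Q b) \<or> G (neg P f) u (Q b)"
        unfolding Gn ge_iff_psi[OF f u] using y by (auto simp: x_def)
      moreover have "0 \<le> Q b" using y by simp
      ultimately have "G k u (Q b * Q b - Q a)" using k' u by blast
      then show ?thesis using y unfolding ge_iff_psi[OF k u] of_rat_diff of_rat_mult by simp
    qed
    have hi: "psi k u < y * y + real_of_rat (Q a)" if y: "y = real_of_rat (Q b)" "x < y" for y b
    proof -
      have "\<not> G f u (Q b) \<and> \<not> G (neg P f) u (Q b)"
        unfolding Gn ge_iff_psi[OF f u] using y by (auto simp: x_def)
      moreover have "0 \<le> real_of_rat (Q b)" using y x0 by linarith
      then have "0 \<le> Q b" by simp
      ultimately have "\<not> G k u (Q b * Q b + Q a)" using k' u by blast
      then show ?thesis using y unfolding ge_iff_psi[OF k u] of_rat_add of_rat_mult by simp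
    qed
    have "psi k u \<le> x * x + \<epsilon>"
    proof (rule ccontr)
      assume "\<not> ?thesis"
      then have pos: "psi k u - real_of_rat (Q a) > x * x" using a by linarith
      \<comment> \<open>A rational between \<open>x\<close> and this root has its square too small
        for \<open>hi\<close>.\<close>
      then have "x < sqrt (psi k u - real_of_rat (Q a))" using x0 by (intro real_less_rsqrt) (simp add: power2_eq_square)
      then obtain b where b: "x < real_of_rat (Q b)" "real_of_rat (Q b) < sqrt (psi k u - real_of_rat (Q a))"
        using ex_code_between by blast
      have b0: "0 \<le> real_of_rat (Q b)" using b x0 by linarith
      have nn: "psi k u - real_of_rat (Q a) \<ge> 0" using pos zero_le_square[of x] by linarith
      have "real_of_rat (Q b) * real_of_rat (Q b) \<le> sqrt (psi k u - real_of_rat (Q a)) * sqrt (psi k u - real_of_rat (Q a))"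
        using b b0 nn by (intro mult_mono) auto
      also have "\<dots> = psi k u - real_of_rat (Q a)" using nn by simp
      finally show False using hi[OF refl b(1)] by linarith
    qed
    moreover have "x * x - \<epsilon> \<le> psi k u"
    proof (rule ccontr)
      assume "\<not> ?thesis"
      then have pos: "psi k u + real_of_rat (Q a) < x * x" using a by linarith
      \<comment> \<open>A rational between the root and \<open>x\<close> serves, except that a
        negative number calls for the bound 0 instead.\<close>
      have "\<exists>b. 0 \<le> real_of_rat (Q b) \<and> real_of_rat (Q b) \<le> x \<and> psi k u + real_of_rat (Q a) < real_of_rat (Q b) * real_of_rat (Q b)"
      proof (cases "psi k u + real_of_rat (Q a) < 0")
        case True
        obtain b where "Q b = 0" using ex_code by blast
        then show ?thesis using True x0 by (intro exI[of _ b]) auto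
      next
        case False
        let ?y = "psi k u + real_of_rat (Q a)"
        have "sqrt ?y < x" using pos x0 False by (intro real_less_lsqrt) (auto simp: power2_eq_square)
        then obtain b where b: "sqrt ?y < real_of_rat (Q b)" "real_of_rat (Q b) < x" using ex_code_between by blast
        have s0: "sqrt ?y \<ge> 0" using False by simp
        have "?y = sqrt ?y * sqrt ?y" using False by simp
        also have "\<dots> < real_of_rat (Q b) * real_of_rat (Q b)" using b s0 by (intro mult_strict_mono')
        finally have "?y < real_of_rat (Q b) * real_of_rat (Q b)" .
        moreover have "0 \<le> real_of_rat (Q b)" using b s0 by linarith
        ultimately show ?thesis using b by (intro exI[of _ b]) linarith
      qed
      then obtain b where "0 \<le> real_of_rat (Q b)" "real_of_rat (Q b) \<le> x"
        "psi k u + real_of_rat (Q a) < real_of_rat (Q b) * real_of_rat (Q b)" by blast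
      then show False using lo[OF refl, of b] by linarith
    qed
    ultimately show ?thesis unfolding xx by linarith
  qed
  then show ?thesis using that k by blast
qed

lemma psi_dominator:
  assumes \<epsilon>: "\<epsilon> > 0"
  obtains h where "h \<in> V" "N h < 1" "\<And>f u. f \<in> V \<Longrightarrow> N f < 1 \<Longrightarrow> u \<in> U \<Longrightarrow> psi f u \<le> psi h u + \<epsilon>"
proof -
  obtain a where a: "0 < real_of_rat (Q a)" "real_of_rat (Q a) < \<epsilon>" using ex_code_between[OF \<epsilon>] by blast
  then have "0 < Q a" by simp
  obtain h where h: "h \<in> V" "nlt P h 1" and h': "\<forall>f\<in>V. nlt P f 1 \<longrightarrow>
      (\<forall>u\<in>U. \<forall>b. G f u (Q b) \<longrightarrow> G h u (Q b - Q a))"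
    using nrm2[OF \<open>0 < Q a\<close>] by (elim bexE conjE)
  have "psi f u \<le> psi h u + \<epsilon>" if f: "f \<in> V" "N f < 1" and u: "u \<in> U" for f u
  proof (rule psi_leI[OF f(1) u])
    fix b assume b: "G f u (Q b)"
    have "nlt P f 1" using f nlt_eq by simp
    then have "G h u (Q b - Q a)" using h' f(1) u b by blast
    then show "real_of_rat (Q b) \<le> psi h u + \<epsilon>"
      unfolding ge_iff_psi[OF h(1) u] of_rat_diff using a(2) by linarith
  qed
  moreover have "N h < 1" using h nlt_eq by simp
  ultimately show ?thesis using that h(1) by blast
qed

lemma norm_mono:
  assumes f: "f \<in> V" and h: "h \<in> V" and le: "\<And>u. u \<in> U \<Longrightarrow> \<bar>psi f u\<bar> \<le> psi h u"
  shows "N f \<le> N h"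
proof (rule le_if_less_of_rat)
  fix q assume q: "N h < real_of_rat q"
  obtain b where b: "Q b = q" using ex_code by blast
  have mf: "mns f \<in> V" using f by simp
  have dom: "\<forall>u\<in>U. \<forall>a. G f u (Q a) \<or> G (neg P f) u (Q a) \<longrightarrow> G h u (Q a)"
  proof (intro ballI allI impI)
    fix u a assume u: "u \<in> U" and "G f u (Q a) \<or> G (neg P f) u (Q a)"
    then have "real_of_rat (Q a) \<le> psi f u \<or> real_of_rat (Q a) \<le> - psi f u"
      using ge_iff_psi[OF f u] ge_iff_psi[OF mf u] neg_eq[OF f] psi_neg[OF f u] by simp
    then show "G h u (Q a)" unfolding ge_iff_psi[OF h u] using le[OF u] by linarith
  qed
  have "nlt P h (Q b)" using q b nlt_eq[OF h] by simp
  then have "nlt P f (Q b)" using nrm3[THEN bspec, OF f, THEN bspec, OF h] dom by blast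
  then show "N f \<le> real_of_rat q" using b nlt_eq[OF f] by simp
qed

end

section \<open>A monotone map from the points to the reals\<close>

context evaluation
begin

definition bd :: "nat \<Rightarrow> real" where
  "bd f = (SOME b. b \<ge> 0 \<and> (\<forall>u\<in>U. \<bar>psi f u\<bar> \<le> b))"

lemma bd: assumes "f \<in> V" shows "bd f \<ge> 0" "u \<in> U \<Longrightarrow> \<bar>psi f u\<bar> \<le> bd f"
proof -
  have "\<exists>b. b \<ge> 0 \<and> (\<forall>u\<in>U. \<bar>psi f u\<bar> \<le> b)" using psi_bounded[OF assms] by metis
  then have "bd f \<ge> 0 \<and> (\<forall>u\<in>U. \<bar>psi f u\<bar> \<le> bd f)" unfolding bd_def by (rule someI_ex)
  then show "bd f \<ge> 0" "u \<in> U \<Longrightarrow> \<bar>psi f u\<bar> \<le> bd f" by blast+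
qed

text \<open>Normalised so that \<open>n\<close> contributes at most \<open>(1 / 2) ^ n\<close> in
  absolute value to \<open>gam\<close>. Vectors are natural numbers, so one series can run over all
  of them.\<close>

definition weight :: "nat \<Rightarrow> real" where
  "weight n = (if n \<in> V then (1 / 2) ^ n / (1 + bd n) else 0)"

text \<open>Monotone in the point for every vector. For a vector increasing up to \<delta> it
  exceeds \<open>psi n\<close> by at most \<delta>.\<close>

definition run :: "nat \<Rightarrow> nat \<Rightarrow> real" where
  "run n u = Sup (psi n ` {v \<in> U. dn v \<subseteq> dn u})"

text \<open>The vector that controls \<open>f\<close> depends on \<open>f\<close> and on the error,
  so every vector contributes with a positive weight.\<close>

definition gam :: "nat \<Rightarrow> real" where
  "gam u = (\<Sum>n. weight n * run n u)"

lemma weight_nonneg: "weight n \<ge> 0"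
  using bd(1) by (simp add: weight_def)

lemma weight_pos: "n \<in> V \<Longrightarrow> weight n > 0"
  using bd(1)[of n] by (simp add: weight_def add_pos_nonneg)

lemma weight_le: "weight n \<le> (1 / 2) ^ n"
proof (cases "n \<in> V")
  case True
  then have "(1 / 2) ^ n / (1 + bd n) \<le> (1 / 2) ^ n / (1 :: real)" using bd(1)[of n] by (intro divide_left_mono) auto
  then show ?thesis using True by (simp add: weight_def)
qed (simp add: weight_def)

lemma run_bdd:
  assumes n: "n \<in> V" shows "bdd_above (psi n ` {v \<in> U. dn v \<subseteq> dn u})"
proof (rule bdd_aboveI2)
  fix v assume "v \<in> {v \<in> U. dn v \<subseteq> dn u}"
  then show "psi n v \<le> bd n" using bd(2)[OF n, of v] by auto
qed

lemma psi_le_run: "n \<in> V \<Longrightarrow> v \<in> U \<Longrightarrow> dn v \<subseteq> dn u \<Longrightarrow> psi n v \<le> run n u"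
  unfolding run_def by (rule cSUP_upper[OF _ run_bdd]) auto

lemma run_leI:
  assumes "u \<in> U" "\<And>v. v \<in> U \<Longrightarrow> dn v \<subseteq> dn u \<Longrightarrow> psi n v \<le> c"
  shows "run n u \<le> c"
  unfolding run_def by (rule cSUP_least) (use assms in auto)

lemma run_mono: "n \<in> V \<Longrightarrow> x \<in> U \<Longrightarrow> dn x \<subseteq> dn y \<Longrightarrow> run n x \<le> run n y"
  by (rule run_leI) (auto intro: psi_le_run)

lemma run_abs:
  assumes n: "n \<in> V" and u: "u \<in> U" shows "\<bar>run n u\<bar> \<le> bd n"
proof -
  have "run n u \<le> bd n" by (rule run_leI[OF u]) (use bd(2)[OF n] in force)
  moreover have "psi n u \<le> run n u" using psi_le_run[OF n u] by simp
  moreover have "\<bar>psi n u\<bar> \<le> bd n" using bd(2)[OF n u] .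
  ultimately show ?thesis by linarith
qed

lemma term_abs:
  assumes u: "u \<in> U" shows "\<bar>weight n * run n u\<bar> \<le> (1 / 2) ^ n"
proof (cases "n \<in> V")
  case True
  have "\<bar>weight n * run n u\<bar> = weight n * \<bar>run n u\<bar>" using weight_nonneg[of n] by (simp add: abs_mult)
  also have "\<dots> \<le> weight n * (1 + bd n)"
    using run_abs[OF True u] weight_nonneg[of n] by (intro mult_left_mono) auto
  also have "\<dots> = (1 / 2) ^ n" using True bd(1)[OF True] by (simp add: weight_def)
  finally show ?thesis .
qed (simp add: weight_def)

lemma half_summable: "summable (\<lambda>n. (1 / 2 :: real) ^ n)"
  by (rule summable_geometric) simp

lemma term_summable: "u \<in> U \<Longrightarrow> summable (\<lambda>n. weight n * run n u)"
  by (rule summable_comparison_test'[OF half_summable, of 0]) (simp add: term_abs)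

lemma gam_diff:
  assumes "x \<in> U" "y \<in> U"
  shows "gam y - gam x = (\<Sum>n. weight n * (run n y - run n x))"
    "summable (\<lambda>n. weight n * (run n y - run n x))"
proof -
  show "gam y - gam x = (\<Sum>n. weight n * (run n y - run n x))"
    unfolding gam_def using suminf_diff[OF term_summable[OF assms(2)] term_summable[OF assms(1)]]
    by (simp add: right_diff_distrib)
  show "summable (\<lambda>n. weight n * (run n y - run n x))"
    using summable_diff[OF term_summable[OF assms(2)] term_summable[OF assms(1)]]
    by (simp add: right_diff_distrib)
qed

lemma diff_term_nonneg: "x \<in> U \<Longrightarrow> dn x \<subseteq> dn y \<Longrightarrow> 0 \<le> weight n * (run n y - run n x)"
  using run_mono[of n x y] by (cases "n \<in> V") (auto simp: weight_def bd(1))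

text \<open>One term of a series of nonnegative terms; this isolates the vector of interest.\<close>

lemma gam_diff_ge:
  assumes "x \<in> U" "y \<in> U" "dn x \<subseteq> dn y"
  shows "weight n * (run n y - run n x) \<le> gam y - gam x"
  using sum_le_suminf[OF gam_diff(2)[OF assms(1,2)], of "{n}"] diff_term_nonneg[OF assms(1,3)]
  unfolding gam_diff(1)[OF assms(1,2)] by simp

lemma gam_mono: "x \<in> U \<Longrightarrow> y \<in> U \<Longrightarrow> dn x \<subseteq> dn y \<Longrightarrow> gam x \<le> gam y"
  using gam_diff_ge[of x y 0] diff_term_nonneg[of x y 0] by linarith

lemma gam_less_dn: "x \<in> U \<Longrightarrow> y \<in> U \<Longrightarrow> gam x < gam y \<Longrightarrow> dn x \<subseteq> dn y"
  using gam_mono[of y x] dn_total[of x y] by force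

text \<open>The vector separating the two points already contributes at least its weight to the
  difference.\<close>

lemma gam_strict:
  assumes xy: "x \<in> U" "y \<in> U" "\<not> dn y \<subseteq> dn x" shows "gam x < gam y"
proof -
  have le: "dn x \<subseteq> dn y" using dn_total[OF xy(1,2)] xy(3) by blast
  obtain f where f: "f \<in> V" "\<And>u. u \<in> U \<Longrightarrow> dn u \<subseteq> dn x \<Longrightarrow> psi f u < 0"
    "\<And>u. u \<in> U \<Longrightarrow> dn y \<subseteq> dn u \<Longrightarrow> 1 \<le> psi f u" using psi_step[OF xy] by blast
  have "run f x \<le> 0" by (rule run_leI[OF xy(1)]) (use f(2) in force)
  moreover have "1 \<le> run f y" using f(3)[OF xy(2)] psi_le_run[OF f(1) xy(2), of y] by force
  ultimately have "1 \<le> run f y - run f x" by linarith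
  then have "weight f * 1 \<le> weight f * (run f y - run f x)" using weight_nonneg by (intro mult_left_mono) auto
  then show ?thesis using gam_diff_ge[OF xy(1,2) le, of f] weight_pos[OF f(1)] by linarith
qed

lemma psi_unif:
  assumes f: "f \<in> V" and \<epsilon>: "\<epsilon> > 0"
  obtains \<eta> where "\<eta> > 0" "\<And>x y. x \<in> U \<Longrightarrow> y \<in> U \<Longrightarrow> \<bar>gam x - gam y\<bar> < \<eta> \<Longrightarrow> \<bar>psi f x - psi f y\<bar> \<le> \<epsilon>"
proof -
  obtain p \<delta> where p: "p \<in> V" "\<delta> > 0"
    and mono: "\<And>x y. x \<in> U \<Longrightarrow> y \<in> U \<Longrightarrow> dn x \<subseteq> dn y \<Longrightarrow> psi p x \<le> psi p y + \<delta>"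
    and ctl: "\<And>x y. x \<in> U \<Longrightarrow> y \<in> U \<Longrightarrow> \<bar>psi p x - psi p y\<bar> \<le> 5 * \<delta> \<Longrightarrow> \<bar>psi f x - psi f y\<bar> \<le> \<epsilon>"
    using psi_control[OF f \<epsilon>] by metis
  \<comment> \<open>If \<open>psi p\<close> grew by more than \<open>5 * \<delta>\<close>, its
    running maximum, which exceeds it by at most \<delta>, would grow by at least
    \<open>4 * \<delta>\<close>, and \<open>gam\<close> by at least \<eta>.\<close>
  define \<eta> where "\<eta> = weight p * (4 * \<delta>)"
  have \<eta>: "\<eta> > 0" using weight_pos[OF p(1)] p(2) by (simp add: \<eta>_def)
  have key: "psi p y \<le> psi p x + 5 * \<delta>"
    if xy: "x \<in> U" "y \<in> U" "dn x \<subseteq> dn y" "\<bar>gam x - gam y\<bar> < \<eta>" for x y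
  proof (rule ccontr)
    assume a: "\<not> ?thesis"
    have "run p x \<le> psi p x + \<delta>" by (rule run_leI[OF xy(1)]) (use mono xy(1) in blast)
    moreover have "psi p y \<le> run p y" using psi_le_run[OF p(1) xy(2), of y] by simp
    ultimately have "4 * \<delta> \<le> run p y - run p x" using a by linarith
    then have "\<eta> \<le> weight p * (run p y - run p x)" unfolding \<eta>_def
      using weight_nonneg by (intro mult_left_mono) auto
    also have "\<dots> \<le> gam y - gam x" by (rule gam_diff_ge[OF xy(1-3)])
    finally show False using xy(4) by linarith
  qed
  have "\<bar>psi f x - psi f y\<bar> \<le> \<epsilon>" if xy: "x \<in> U" "y \<in> U" "\<bar>gam x - gam y\<bar> < \<eta>" for x y
  proof (rule ctl[OF xy(1,2)])
    have yx: "\<bar>gam y - gam x\<bar> < \<eta>" using xy(3) by linarith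
    show "\<bar>psi p x - psi p y\<bar> \<le> 5 * \<delta>"
    proof (cases "dn x \<subseteq> dn y")
      case True
      show ?thesis using key[OF xy(1,2) True xy(3)] mono[OF xy(1,2) True] p(2) by linarith
    next
      case False
      then have "dn y \<subseteq> dn x" using dn_total[OF xy(1,2)] by blast
      then show ?thesis using key[OF xy(2,1) _ yx] mono[OF xy(2,1)] p(2) by force
    qed
  qed
  with \<eta> show ?thesis using that by blast
qed

text \<open>
  At a Dedekind cut of the points the almost monotone function \<open>p\<close> that controls \<open>f\<close> cannot
  jump, by the intermediate value property.
\<close>

lemma cut_osc:
  assumes A: "A \<subseteq> U" "A \<noteq> {}" and B: "B \<subseteq> U" "B \<noteq> {}" and AB: "U \<subseteq> A \<union> B"
    and cut: "\<And>x y. x \<in> A \<Longrightarrow> y \<in> B \<Longrightarrow> dn x \<subseteq> dn y"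
    and f: "f \<in> V" and \<epsilon>: "\<epsilon> > 0"
  obtains x y where "x \<in> A" "y \<in> B" "\<And>v w. v \<in> U \<Longrightarrow> w \<in> U \<Longrightarrow> dn x \<subseteq> dn v \<Longrightarrow> dn v \<subseteq> dn y \<Longrightarrow>
    dn x \<subseteq> dn w \<Longrightarrow> dn w \<subseteq> dn y \<Longrightarrow> \<bar>psi f v - psi f w\<bar> \<le> \<epsilon>"
proof -
  obtain p \<delta> where p: "p \<in> V" "\<delta> > 0"
    and mono: "\<And>x y. x \<in> U \<Longrightarrow> y \<in> U \<Longrightarrow> dn x \<subseteq> dn y \<Longrightarrow> psi p x \<le> psi p y + \<delta>"
    and ctl: "\<And>x y. x \<in> U \<Longrightarrow> y \<in> U \<Longrightarrow> \<bar>psi p x - psi p y\<bar> \<le> 5 * \<delta> \<Longrightarrow> \<bar>psi f x - psi f y\<bar> \<le> \<epsilon>"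
    using psi_control[OF f \<epsilon>] by metis
  define s i where "s = Sup (psi p ` A)" and "i = Inf (psi p ` B)"
  have AU: "a \<in> U" if "a \<in> A" for a using A that by blast
  have BU: "b \<in> U" if "b \<in> B" for b using B that by blast
  have bA: "bdd_above (psi p ` A)"
  proof (rule bdd_aboveI2)
    fix v assume "v \<in> A"
    then show "psi p v \<le> bd p" using bd(2)[OF p(1) AU] by force
  qed
  have bB: "bdd_below (psi p ` B)"
  proof (rule bdd_belowI2)
    fix v assume "v \<in> B"
    then show "- bd p \<le> psi p v" using bd(2)[OF p(1) BU] by force
  qed
  have sA: "psi p a \<le> s" if "a \<in> A" for a unfolding s_def by (rule cSUP_upper[OF that bA])
  have iB: "i \<le> psi p b" if "b \<in> B" for b unfolding i_def by (rule cINF_lower[OF bB that])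
  have "\<exists>x\<in>A. s - \<delta> < psi p x"
    using less_cSup_iff[of "psi p ` A" "s - \<delta>"] bA A(2) p(2) unfolding s_def by simp
  then obtain x where x: "x \<in> A" "s - \<delta> < psi p x" by blast
  have "\<exists>y\<in>B. psi p y < i + \<delta>"
    using cInf_less_iff[of "psi p ` B" "i + \<delta>"] bB B(2) p(2) unfolding i_def by simp
  then obtain y where y: "y \<in> B" "psi p y < i + \<delta>" by blast
  have i_le_s: "i \<le> s"
  proof (rule ccontr)
    assume "\<not> i \<le> s"
    \<comment> \<open>The middle third of the supposed jump: \<open>psi_ivt\<close> yields a point
      with its value there, which can belong to neither side of the cut.\<close>
    define a b where "a = s + (i - s) / 3" and "b = s + 2 * (i - s) / 3"
    have "psi p x < a" "a < b" "b < psi p y"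
      using sA[OF x(1)] iB[OF y(1)] \<open>\<not> i \<le> s\<close> by (auto simp: a_def b_def field_simps)
    then obtain z where z: "z \<in> U" "a < psi p z" "psi p z < b"
      using psi_ivt[OF p(1) AU[OF x(1)] BU[OF y(1)]] by blast
    have "s < a" "b < i" using \<open>\<not> i \<le> s\<close> by (auto simp: a_def b_def field_simps)
    then show False using z AB sA[of z] iB[of z] by force
  qed
  \<comment> \<open>Between \<open>x\<close> and \<open>y\<close> all values of \<open>p\<close> lie
    within \<open>2 * \<delta>\<close> of \<open>s\<close>, so they differ by less than
    \<open>5 * \<delta>\<close>.\<close>
  have hi: "psi p v < s + 2 * \<delta>" if v: "v \<in> U" "dn v \<subseteq> dn y" for v
    using mono[OF v(1) BU[OF y(1)] v(2)] y(2) i_le_s by linarith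
  have lo: "s - 2 * \<delta> < psi p v" if v: "v \<in> U" "dn x \<subseteq> dn v" for v
    using mono[OF AU[OF x(1)] v] x(2) by linarith
  show ?thesis
  proof (rule that[OF x(1) y(1)])
    fix v w assume vw: "v \<in> U" "w \<in> U" "dn x \<subseteq> dn v" "dn v \<subseteq> dn y" "dn x \<subseteq> dn w" "dn w \<subseteq> dn y"
    show "\<bar>psi f v - psi f w\<bar> \<le> \<epsilon>"
      using hi[OF vw(1,4)] hi[OF vw(2,6)] lo[OF vw(1,3)] lo[OF vw(2,5)] p(2)
      by (intro ctl vw) linarith
  qed
qed

text \<open>Finitely many vectors share one neighbourhood of the cut; as the lower sets form a
  chain, two neighbourhoods contain a common smaller one.\<close>

lemma cut_osc_finite:
  fixes K :: nat
  assumes A: "A \<subseteq> U" "A \<noteq> {}" and B: "B \<subseteq> U" "B \<noteq> {}" and AB: "U \<subseteq> A \<union> B"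
    and cut: "\<And>x y. x \<in> A \<Longrightarrow> y \<in> B \<Longrightarrow> dn x \<subseteq> dn y" and \<epsilon>: "\<epsilon> > 0"
  shows "\<exists>x\<in>A. \<exists>y\<in>B. \<forall>n<K. n \<in> V \<longrightarrow> (\<forall>v\<in>U. \<forall>w\<in>U. dn x \<subseteq> dn v \<longrightarrow> dn v \<subseteq> dn y \<longrightarrow>
    dn x \<subseteq> dn w \<longrightarrow> dn w \<subseteq> dn y \<longrightarrow> \<bar>psi n v - psi n w\<bar> \<le> \<epsilon>)"
proof (induction K)
  case 0
  show ?case using A B by blast
next
  case (Suc K)
  define osc where "osc = (\<lambda>n x y. \<forall>v\<in>U. \<forall>w\<in>U. dn x \<subseteq> dn v \<longrightarrow> dn v \<subseteq> dn y \<longrightarrow>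
    dn x \<subseteq> dn w \<longrightarrow> dn w \<subseteq> dn y \<longrightarrow> \<bar>psi n v - psi n w\<bar> \<le> \<epsilon>)"
  have osc_mono: "osc n x y" if "osc n x' y'" "dn x' \<subseteq> dn x" "dn y \<subseteq> dn y'" for n x y x' y'
    using that unfolding osc_def by (meson subset_trans)
  obtain x y where xy: "x \<in> A" "y \<in> B" "\<forall>n<K. n \<in> V \<longrightarrow> osc n x y"
    using Suc.IH unfolding osc_def by blast
  have "\<exists>x'\<in>A. \<exists>y'\<in>B. K \<in> V \<longrightarrow> osc K x' y'"
  proof (cases "K \<in> V")
    case True
    obtain x' y' where "x' \<in> A" "y' \<in> B" "\<And>v w. v \<in> U \<Longrightarrow> w \<in> U \<Longrightarrow> dn x' \<subseteq> dn v \<Longrightarrow> dn v \<subseteq> dn y' \<Longrightarrow>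
      dn x' \<subseteq> dn w \<Longrightarrow> dn w \<subseteq> dn y' \<Longrightarrow> \<bar>psi K v - psi K w\<bar> \<le> \<epsilon>"
      using cut_osc[OF A B AB cut True \<epsilon>] by metis
    then show ?thesis unfolding osc_def by (intro bexI[of _ x'] bexI[of _ y']) auto
  qed (use A B in blast)
  then obtain x' y' where xy': "x' \<in> A" "y' \<in> B" "K \<in> V \<longrightarrow> osc K x' y'" by blast
  \<comment> \<open>The inner ends are kept: the later of \<open>x\<close> and \<open>x'\<close>,
    and below the earlier of \<open>y\<close> and \<open>y'\<close>.\<close>
  have "\<exists>x''\<in>A. dn x \<subseteq> dn x'' \<and> dn x' \<subseteq> dn x''"
    using dn_total[of x x'] xy(1) xy'(1) A(1) by (meson order_refl subsetD)
  then obtain x'' where x'': "x'' \<in> A" "dn x \<subseteq> dn x''" "dn x' \<subseteq> dn x''" by blast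
  have "\<exists>y''\<in>B. dn y'' \<subseteq> dn y \<and> dn y'' \<subseteq> dn y'"
    using dn_total[of y y'] xy(2) xy'(2) B(1) by (meson order_refl subsetD)
  then obtain y'' where y'': "y'' \<in> B" "dn y'' \<subseteq> dn y" "dn y'' \<subseteq> dn y'" by blast
  have "\<forall>n<Suc K. n \<in> V \<longrightarrow> osc n x'' y''"
    using xy(3) xy'(3) osc_mono x'' y'' by (metis less_Suc_eq)
  then show ?case using x''(1) y''(1) unfolding osc_def by blast
qed

text \<open>A gap in the range of \<open>gam\<close> is a cut across which each of the first
  \<open>K\<close> running maxima grows by at most \<epsilon>. These terms contribute at most
  \<open>2 * \<epsilon>\<close> and the tail at most \<open>4 * (1 / 2) ^ K\<close>, together less
  than \<eta>, whereas values on the two sides differ by at least \<open>2 * \<eta>\<close>.\<close>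

lemma gam_dense:
  assumes xy: "x0 \<in> U" "y0 \<in> U" and s: "gam x0 < s" "s < gam y0" and \<eta>: "\<eta> > 0"
  shows "\<exists>u\<in>U. \<bar>gam u - s\<bar> < \<eta>"
proof (rule ccontr)
  assume far: "\<not> ?thesis"
  define A B where "A = {u \<in> U. gam u < s}" and "B = {u \<in> U. s < gam u}"
  have AB: "U \<subseteq> A \<union> B" using far \<eta> unfolding A_def B_def by force
  have A: "A \<subseteq> U" "A \<noteq> {}" and B: "B \<subseteq> U" "B \<noteq> {}" using xy s by (auto simp: A_def B_def)
  have cut: "dn x \<subseteq> dn y" if "x \<in> A" "y \<in> B" for x y
    using that gam_less_dn[of x y] by (auto simp: A_def B_def)
  obtain K where K: "(1 / 2 :: real) ^ K < \<eta> / 8" using real_arch_pow_inv[of "\<eta> / 8" "1 / 2"] \<eta> by auto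
  define \<epsilon> where "\<epsilon> = \<eta> / 8"
  have \<epsilon>: "\<epsilon> > 0" using \<eta> by (simp add: \<epsilon>_def)
  have "\<exists>x\<in>A. \<exists>y\<in>B. \<forall>n<K. n \<in> V \<longrightarrow> (\<forall>v\<in>U. \<forall>w\<in>U. dn x \<subseteq> dn v \<longrightarrow> dn v \<subseteq> dn y \<longrightarrow>
    dn x \<subseteq> dn w \<longrightarrow> dn w \<subseteq> dn y \<longrightarrow> \<bar>psi n v - psi n w\<bar> \<le> \<epsilon>)"
    by (rule cut_osc_finite[OF A B AB _ \<epsilon>]) (rule cut)
  then obtain x y where x: "x \<in> A" and y: "y \<in> B" and osc: "\<forall>n<K. n \<in> V \<longrightarrow> (\<forall>v\<in>U. \<forall>w\<in>U. dn x \<subseteq> dn v \<longrightarrow>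
    dn v \<subseteq> dn y \<longrightarrow> dn x \<subseteq> dn w \<longrightarrow> dn w \<subseteq> dn y \<longrightarrow> \<bar>psi n v - psi n w\<bar> \<le> \<epsilon>)"
    by (elim bexE)
  have xU: "x \<in> U" and yU: "y \<in> U" using x y by (auto simp: A_def B_def)
  have dxy: "dn x \<subseteq> dn y" using cut[OF x y] .
  have run: "run n y \<le> run n x + \<epsilon>" if n: "n < K" "n \<in> V" for n
  proof (rule run_leI[OF yU])
    fix v assume v: "v \<in> U" "dn v \<subseteq> dn y"
    show "psi n v \<le> run n x + \<epsilon>"
    proof (cases "dn v \<subseteq> dn x")
      case True
      show ?thesis using psi_le_run[OF n(2) v(1) True] \<epsilon> by linarith
    next
      case False
      then have "dn x \<subseteq> dn v" using dn_total[OF v(1) xU] by blast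
      then have "\<bar>psi n v - psi n x\<bar> \<le> \<epsilon>" using osc n v xU dxy by blast
      moreover have "psi n x \<le> run n x" using psi_le_run[OF n(2) xU, of x] by simp
      ultimately show ?thesis by linarith
    qed
  qed
  let ?t = "\<lambda>n. weight n * (run n y - run n x)"
  have t1: "?t n \<le> (1 / 2) ^ n * \<epsilon>" if "n < K" for n
  proof (cases "n \<in> V")
    case True
    have "?t n \<le> weight n * \<epsilon>" using run[OF that True] weight_nonneg by (intro mult_left_mono) auto
    also have "\<dots> \<le> (1 / 2) ^ n * \<epsilon>" using weight_le \<epsilon> by (intro mult_right_mono) auto
    finally show ?thesis .
  qed (use \<epsilon> in \<open>simp add: weight_def\<close>)
  have t2: "?t n \<le> 2 * (1 / 2) ^ n" for n
    using term_abs[OF xU, of n] term_abs[OF yU, of n] by (simp add: right_diff_distrib)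
  have geo: "(\<Sum>n. (1 / 2 :: real) ^ n) = 2" using suminf_geometric[of "1 / 2 :: real"] by simp
  have "gam y - gam x = (\<Sum>n. ?t (n + K)) + (\<Sum>n<K. ?t n)"
    unfolding gam_diff(1)[OF xU yU] by (rule suminf_split_initial_segment[OF gam_diff(2)[OF xU yU]])
  moreover have "(\<Sum>n<K. ?t n) \<le> (\<Sum>n<K. (1 / 2) ^ n * \<epsilon>)" by (rule sum_mono) (use t1 in auto)
  moreover have "(\<Sum>n<K. (1 / 2) ^ n * \<epsilon>) = (\<Sum>n<K. (1 / 2) ^ n) * \<epsilon>" by (simp add: sum_distrib_right)
  moreover have "(\<Sum>n<K. (1 / 2 :: real) ^ n) \<le> 2"
    using sum_le_suminf[OF half_summable, of "{..<K}"] geo by simp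
  then have "(\<Sum>n<K. (1 / 2) ^ n) * \<epsilon> \<le> 2 * \<epsilon>" using \<epsilon> by (intro mult_right_mono) auto
  moreover have "(\<Sum>n. ?t (n + K)) \<le> (\<Sum>n. 2 * (1 / 2) ^ K * (1 / 2) ^ n)"
  proof (rule suminf_le)
    show "?t (n + K) \<le> 2 * (1 / 2) ^ K * (1 / 2) ^ n" for n using t2[of "n + K"] by (simp add: power_add mult_ac)
    show "summable (\<lambda>n. ?t (n + K))" using summable_ignore_initial_segment[OF gam_diff(2)[OF xU yU], of K] .
    show "summable (\<lambda>n. 2 * (1 / 2 :: real) ^ K * (1 / 2) ^ n)" by (intro summable_mult half_summable)
  qed
  moreover have "(\<Sum>n. 2 * (1 / 2 :: real) ^ K * (1 / 2) ^ n) = 4 * (1 / 2) ^ K"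
    using suminf_mult[OF half_summable, of "2 * (1 / 2) ^ K"] geo by simp
  ultimately have "gam y - gam x < \<eta>" using K \<eta> unfolding \<epsilon>_def by linarith
  moreover have "\<bar>gam x - s\<bar> \<ge> \<eta>" "\<bar>gam y - s\<bar> \<ge> \<eta>" using far xU yU by force+
  ultimately show False using x y \<eta> unfolding A_def B_def by force
qed

section \<open>The interval spanned by the points, and extension to it\<close>

definition lo :: real where "lo = Inf (gam ` U)"
definition hi :: real where "hi = Sup (gam ` U)"

lemma gam_abs: "u \<in> U \<Longrightarrow> \<bar>gam u\<bar> \<le> 2"
proof -
  assume u: "u \<in> U"
  have "norm (\<Sum>n. weight n * run n u) \<le> (\<Sum>n. (1 / 2) ^ n)"
    by (rule norm_suminf_le[OF _ half_summable]) (simp add: term_abs[OF u])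
  moreover have "(\<Sum>n. (1 / 2 :: real) ^ n) = 2" using suminf_geometric[of "1 / 2 :: real"] by simp
  ultimately show ?thesis by (simp add: gam_def)
qed

lemma gam_in: "u \<in> U \<Longrightarrow> gam u \<in> {lo..hi}"
proof -
  assume u: "u \<in> U"
  have "bdd_below (gam ` U)"
    by (rule bdd_belowI2[of _ "- 2"]) (use gam_abs in force)
  moreover have "bdd_above (gam ` U)"
    by (rule bdd_aboveI2[of _ _ 2]) (use gam_abs in force)
  ultimately show ?thesis unfolding lo_def hi_def using u by (auto intro: cInf_lower cSup_upper)
qed

lemma lo_approx: "\<eta> > 0 \<Longrightarrow> \<exists>u\<in>U. gam u < lo + \<eta>"
proof -
  assume "\<eta> > 0"
  have "bdd_below (gam ` U)" by (rule bdd_belowI2[of _ "- 2"]) (use gam_abs in force)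
  moreover have "U \<noteq> {}" using dn_nontrivial by blast
  ultimately show ?thesis using cInf_less_iff[of "gam ` U" "lo + \<eta>"] \<open>\<eta> > 0\<close> unfolding lo_def by simp
qed

lemma hi_approx: "\<eta> > 0 \<Longrightarrow> \<exists>u\<in>U. hi - \<eta> < gam u"
proof -
  assume "\<eta> > 0"
  have "bdd_above (gam ` U)" by (rule bdd_aboveI2[of _ _ 2]) (use gam_abs in force)
  moreover have "U \<noteq> {}" using dn_nontrivial by blast
  ultimately show ?thesis using less_cSup_iff[of "gam ` U" "hi - \<eta>"] \<open>\<eta> > 0\<close> unfolding hi_def by simp
qed

lemma lo_less_hi: "lo < hi"
proof -
  obtain x y where xy: "x \<in> U" "y \<in> U" "\<not> dn y \<subseteq> dn x" using dn_nontrivial by blast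
  then show ?thesis using gam_strict[OF xy] gam_in[OF xy(1)] gam_in[OF xy(2)] by auto
qed

lemma dense_I:
  assumes s: "s \<in> {lo..hi}" and \<eta>: "\<eta> > 0"
  obtains u where "u \<in> U" "\<bar>gam u - s\<bar> < \<eta>"
proof -
  obtain x where x: "x \<in> U" "gam x < lo + \<eta>" using lo_approx[OF \<eta>] by blast
  obtain y where y: "y \<in> U" "hi - \<eta> < gam y" using hi_approx[OF \<eta>] by blast
  consider "s \<le> gam x" | "gam y \<le> s" | "gam x < s" "s < gam y" by linarith
  then show ?thesis
  proof cases
    case 1
    have "\<bar>gam x - s\<bar> < \<eta>" using 1 x s by auto
    then show ?thesis using that x(1) by blast
  next
    case 2
    have "\<bar>gam y - s\<bar> < \<eta>" using 2 y s by auto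
    then show ?thesis using that y(1) by blast
  next
    case 3
    then show ?thesis using gam_dense[OF x(1) y(1) 3 \<eta>] that by blast
  qed
qed

text \<open>Continuity reduces the bound at \<open>s\<close> to points near \<open>s\<close>. Being
  local, this also serves at the ends of the interval, which need not be attained.\<close>

lemma dense_le:
  fixes g :: "real \<Rightarrow> real"
  assumes g: "continuous_on {lo..hi} g" and s: "s \<in> {lo..hi}" and \<rho>: "\<rho> > 0"
    and le: "\<And>u. u \<in> U \<Longrightarrow> \<bar>gam u - s\<bar> < \<rho> \<Longrightarrow> g (gam u) \<le> c"
  shows "g s \<le> c"
proof (rule ccontr)
  assume "\<not> ?thesis"
  then have "g s - c > 0" by simp
  then obtain \<delta> where \<delta>: "\<delta> > 0" "\<And>x. x \<in> {lo..hi} \<Longrightarrow> dist x s < \<delta> \<Longrightarrow> dist (g x) (g s) < g s - c"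
    using g s unfolding continuous_on_iff by metis
  obtain u where u: "u \<in> U" "\<bar>gam u - s\<bar> < min \<delta> \<rho>" using dense_I[OF s, of "min \<delta> \<rho>"] \<delta>(1) \<rho> by auto
  have "dist (g (gam u)) (g s) < g s - c" using \<delta>(2)[OF gam_in[OF u(1)]] u(2) by (simp add: dist_real_def)
  moreover have "g (gam u) \<le> c" using le u by simp
  ultimately show False unfolding dist_real_def by linarith
qed

lemma dense_le_all:
  fixes g :: "real \<Rightarrow> real"
  assumes "continuous_on {lo..hi} g" "\<And>u. u \<in> U \<Longrightarrow> g (gam u) \<le> c" "s \<in> {lo..hi}"
  shows "g s \<le> c"
  by (rule dense_le[OF assms(1,3) zero_less_one]) (rule assms(2))

text \<open>Points with the same \<open>gam\<close> have the same value under \<open>h\<close>, so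
  \<open>h\<close> factors through \<open>gam\<close>; the factor is uniformly continuous on a dense
  set.\<close>

lemma extension:
  fixes h :: "nat \<Rightarrow> real"
  assumes "\<And>\<epsilon>. \<epsilon> > 0 \<Longrightarrow> \<exists>\<eta>>0. \<forall>x\<in>U. \<forall>y\<in>U. \<bar>gam x - gam y\<bar> < \<eta> \<longrightarrow> \<bar>h x - h y\<bar> \<le> \<epsilon>"
  obtains g :: "real \<Rightarrow> real" where "continuous_on {lo..hi} g" "\<And>u. u \<in> U \<Longrightarrow> g (gam u) = h u"
proof -
  have wd: "h x = h y" if "x \<in> U" "y \<in> U" "gam x = gam y" for x y
  proof -
    have "\<bar>h x - h y\<bar> \<le> 0 + \<epsilon>" if "\<epsilon> > 0" for \<epsilon>
      using assms[OF that] \<open>x \<in> U\<close> \<open>y \<in> U\<close> \<open>gam x = gam y\<close> by auto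
    then have "\<bar>h x - h y\<bar> \<le> 0" by (rule field_le_epsilon)
    then show ?thesis by simp
  qed
  define h' where "h' = (\<lambda>t. h (inv_into U gam t))"
  have h': "h' (gam u) = h u" if "u \<in> U" for u
    unfolding h'_def using that by (intro wd) (auto intro: inv_into_into f_inv_into_f)
  have "uniformly_continuous_on (gam ` U) h'"
    unfolding uniformly_continuous_on_def
  proof (intro allI impI)
    fix \<epsilon> :: real assume \<epsilon>: "\<epsilon> > 0"
    obtain \<eta> where \<eta>: "\<eta> > 0" "\<forall>x\<in>U. \<forall>y\<in>U. \<bar>gam x - gam y\<bar> < \<eta> \<longrightarrow> \<bar>h x - h y\<bar> \<le> \<epsilon> / 2"
      using assms[of "\<epsilon> / 2"] \<epsilon> by auto
    have "dist (h' t) (h' s) < \<epsilon>" if st: "s \<in> gam ` U" "t \<in> gam ` U" "dist t s < \<eta>" for s t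
    proof -
      obtain x y where xy: "x \<in> U" "s = gam x" "y \<in> U" "t = gam y" using st by blast
      then have "\<bar>h y - h x\<bar> \<le> \<epsilon> / 2" using \<eta>(2) st(3) by (simp add: dist_real_def)
      then show ?thesis using xy h' \<epsilon> by (simp add: dist_real_def)
    qed
    then show "\<exists>d>0. \<forall>x\<in>gam ` U. \<forall>x'\<in>gam ` U. dist x' x < d \<longrightarrow> dist (h' x') (h' x) < \<epsilon>"
      using \<eta>(1) by blast
  qed
  then obtain g where g: "uniformly_continuous_on (closure (gam ` U)) g" "\<And>t. t \<in> gam ` U \<Longrightarrow> h' t = g t"
    using uniformly_continuous_on_extension_on_closure by metis
  have "{lo..hi} \<subseteq> closure (gam ` U)"
  proof
    fix s assume s: "s \<in> {lo..hi}"
    show "s \<in> closure (gam ` U)" unfolding closure_approachable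
    proof (intro allI impI)
      fix \<eta> :: real assume "\<eta> > 0"
      then obtain u where "u \<in> U" "\<bar>gam u - s\<bar> < \<eta>" using dense_I[OF s] by blast
      then show "\<exists>y\<in>gam ` U. dist y s < \<eta>" by (auto simp: dist_real_def)
    qed
  qed
  then have "continuous_on {lo..hi} g"
    using uniformly_continuous_imp_continuous[OF g(1)] continuous_on_subset by blast
  moreover have "g (gam u) = h u" if "u \<in> U" for u using g(2)[of "gam u"] h'[OF that] that by simp
  ultimately show ?thesis using that by blast
qed

end

section \<open>Continuous extension of the evaluations\<close>

context evaluation
begin

definition T :: "nat \<Rightarrow> real \<Rightarrow> real" where
  "T f = (SOME g. continuous_on {lo..hi} g \<and> (\<forall>u\<in>U. g (gam u) = psi f u))"

lemma T_exists: "f \<in> V \<Longrightarrow> \<exists>g. continuous_on {lo..hi} g \<and> (\<forall>u\<in>U. g (gam u) = psi f u)"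
proof -
  assume f: "f \<in> V"
  have "\<exists>\<eta>>0. \<forall>x\<in>U. \<forall>y\<in>U. \<bar>gam x - gam y\<bar> < \<eta> \<longrightarrow> \<bar>psi f x - psi f y\<bar> \<le> \<epsilon>" if "\<epsilon> > 0" for \<epsilon>
    using psi_unif[OF f that] by metis
  from extension[OF this] show ?thesis by metis
qed

lemma T_cont: "f \<in> V \<Longrightarrow> continuous_on {lo..hi} (T f)"
  and T_gam: "f \<in> V \<Longrightarrow> u \<in> U \<Longrightarrow> T f (gam u) = psi f u"
  using someI_ex[OF T_exists[of f]] unfolding T_def by blast+

lemma eq_if_eq_gam:
  fixes g h :: "real \<Rightarrow> real"
  assumes "continuous_on {lo..hi} g" "continuous_on {lo..hi} h" "\<And>u. u \<in> U \<Longrightarrow> g (gam u) = h (gam u)"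
    "s \<in> {lo..hi}"
  shows "g s = h s"
proof -
  have "(\<lambda>s. \<bar>g s - h s\<bar>) s \<le> 0"
    by (rule dense_le_all[OF _ _ assms(4)]) (use assms in \<open>auto intro!: continuous_intros\<close>)
  then show ?thesis by simp
qed

lemma T_add:
  assumes f: "f \<in> V" and g: "g \<in> V" and s: "s \<in> {lo..hi}"
  shows "T (padd P f g) s = T f s + T g s"
proof (rule eq_if_eq_gam[OF _ _ _ s])
  show "continuous_on {lo..hi} (T (padd P f g))" using f g by (intro T_cont) simp
  show "continuous_on {lo..hi} (\<lambda>s. T f s + T g s)" by (intro continuous_intros T_cont f g)
  show "T (padd P f g) (gam u) = T f (gam u) + T g (gam u)" if "u \<in> U" for u
    using that f g by (simp add: T_gam psi_add)
qed

lemma T_scale: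
  assumes f: "f \<in> V" and s: "s \<in> {lo..hi}"
  shows "T (pscale P q f) s = real_of_rat q * T f s"
proof (rule eq_if_eq_gam[OF _ _ _ s])
  show "continuous_on {lo..hi} (T (pscale P q f))" using f by (intro T_cont) simp
  show "continuous_on {lo..hi} (\<lambda>s. real_of_rat q * T f s)" by (intro continuous_intros T_cont f)
  show "T (pscale P q f) (gam u) = real_of_rat q * T f (gam u)" if "u \<in> U" for u
    using that f by (simp add: T_gam psi_scale)
qed

lemma T_e: "s \<in> {lo..hi} \<Longrightarrow> T e s = 1"
  by (rule eq_if_eq_gam[OF T_cont[OF e_in] continuous_on_const]) (simp_all add: T_gam psi_e)

lemma T_mono:
  assumes f: "f \<in> V" and g: "continuous_on {lo..hi} g" and le: "\<And>u. u \<in> U \<Longrightarrow> psi f u \<le> g (gam u)"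
    and s: "s \<in> {lo..hi}"
  shows "T f s \<le> g s"
proof -
  have "(\<lambda>s. T f s - g s) s \<le> 0"
    by (rule dense_le_all[OF _ _ s]) (use f g le in \<open>auto intro!: continuous_intros T_cont simp: T_gam\<close>)
  then show ?thesis by simp
qed

section \<open>Recovering the norm from the unit ball\<close>

definition omega :: "nat \<Rightarrow> real" where
  "omega u = Sup {psi f u | f. f \<in> V \<and> N f < 1}"

text \<open>In C[0,1] the supremum \<open>omega u\<close> is \<open>1 / e\<close> at the point. One
  \<open>h\<close> nearly attains it at all points simultaneously, so \<open>omega\<close> is a
  uniform limit of evaluations and inherits their uniform continuity.\<close>

lemma omega_bounds:
  assumes \<epsilon>: "\<epsilon> > 0"
  obtains h where "h \<in> V" "N h < 1" "\<And>u. u \<in> U \<Longrightarrow> psi h u \<le> omega u \<and> omega u \<le> psi h u + \<epsilon>"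
proof -
  obtain h where h: "h \<in> V" "N h < 1" "\<And>f u. f \<in> V \<Longrightarrow> N f < 1 \<Longrightarrow> u \<in> U \<Longrightarrow> psi f u \<le> psi h u + \<epsilon>"
    using psi_dominator[OF \<epsilon>] by metis
  have "psi h u \<le> omega u \<and> omega u \<le> psi h u + \<epsilon>" if u: "u \<in> U" for u
  proof
    have bdd: "bdd_above {psi f u | f. f \<in> V \<and> N f < 1}"
      by (rule bdd_aboveI[of _ "psi h u + \<epsilon>"]) (use h(3) u in blast)
    show "psi h u \<le> omega u" unfolding omega_def by (rule cSup_upper[OF _ bdd]) (use h in blast)
    show "omega u \<le> psi h u + \<epsilon>" unfolding omega_def by (rule cSup_least) (use h u in blast)+
  qed
  then show ?thesis using that h by blast
qed

lemma psi_le_omega: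
  assumes "f \<in> V" "N f < 1" "u \<in> U" shows "psi f u \<le> omega u"
proof -
  obtain h where h: "h \<in> V" "N h < 1" "\<And>f u. f \<in> V \<Longrightarrow> N f < 1 \<Longrightarrow> u \<in> U \<Longrightarrow> psi f u \<le> psi h u + 1"
    using psi_dominator[of 1] by auto
  have "bdd_above {psi f u | f. f \<in> V \<and> N f < 1}"
    by (rule bdd_aboveI[of _ "psi h u + 1"]) (use h(3) assms in blast)
  then show ?thesis unfolding omega_def by (rule cSup_upper[rotated]) (use assms in blast)
qed

lemma psi_le_scaled_omega:
  assumes f: "f \<in> V" "N f < real_of_rat q" and u: "u \<in> U"
  shows "\<bar>psi f u\<bar> \<le> real_of_rat q * omega u"
proof -
  have q: "real_of_rat q > 0" using f norm_nonneg[OF f(1)] by linarith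
  have "psi g u \<le> real_of_rat q * omega u" if g: "g \<in> V" "N g < real_of_rat q" for g
  proof -
    have "N (pscale P (1 / q) g) = N g / real_of_rat q"
      using norm_scale[OF g(1), of "1 / q"] q by (simp add: of_rat_divide)
    also have "\<dots> < 1" using g(2) q by simp
    finally have "psi (pscale P (1 / q) g) u \<le> omega u" using g(1) u by (intro psi_le_omega) auto
    then have "psi g u / real_of_rat q \<le> omega u" using g(1) u by (simp add: psi_scale of_rat_divide)
    then show ?thesis using q by (simp add: pos_divide_le_eq mult.commute)
  qed
  from this[OF f] this[of "mns f"] show ?thesis
    using f u norm_scale[OF f(1), of "-1"] psi_neg[OF f(1) u] by (auto simp: abs_le_iff)
qed

text \<open>A positive lower bound for \<open>omega\<close>: \<open>e\<close> divided by a rational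
  above its norm lies in the unit ball and is constant under all evaluations. Adding 1 leaves room
  for that rational.\<close>

definition floor_omega :: real where
  "floor_omega = 1 / (N e + 1)"

lemma floor_omega_pos: "floor_omega > 0"
  using norm_nonneg[OF e_in] by (simp add: floor_omega_def add_nonneg_pos)

lemma omega_ge: assumes u: "u \<in> U" shows "floor_omega \<le> omega u"
proof -
  obtain q where q: "N e < real_of_rat q" "real_of_rat q < N e + 1" using of_rat_dense[of "N e" "N e + 1"] by auto
  have q0: "real_of_rat q > 0" using q norm_nonneg[OF e_in] by linarith
  have "1 \<le> real_of_rat q * omega u" using psi_le_scaled_omega[OF e_in q(1) u] psi_e[OF u] by simp
  then have "1 / real_of_rat q \<le> omega u" using q0 by (simp add: pos_divide_le_eq mult.commute)
  moreover have "floor_omega \<le> 1 / real_of_rat q"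
    unfolding floor_omega_def using q q0 norm_nonneg[OF e_in] by (intro divide_left_mono) (auto intro!: mult_pos_pos)
  ultimately show ?thesis by linarith
qed

definition W :: "real \<Rightarrow> real" where
  "W = (SOME g. continuous_on {lo..hi} g \<and> (\<forall>u\<in>U. g (gam u) = omega u))"

lemma W_exists: "\<exists>g. continuous_on {lo..hi} g \<and> (\<forall>u\<in>U. g (gam u) = omega u)"
proof -
  have "\<exists>\<eta>>0. \<forall>x\<in>U. \<forall>y\<in>U. \<bar>gam x - gam y\<bar> < \<eta> \<longrightarrow> \<bar>omega x - omega y\<bar> \<le> \<epsilon>"
    if \<epsilon>: "\<epsilon> > 0" for \<epsilon>
  proof -
    have e3: "\<epsilon> / 3 > 0" using \<epsilon> by simp
    obtain h where h: "h \<in> V" "\<And>u. u \<in> U \<Longrightarrow> psi h u \<le> omega u \<and> omega u \<le> psi h u + \<epsilon> / 3"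
      using omega_bounds[OF e3] by metis
    obtain \<eta> where \<eta>: "\<eta> > 0"
      "\<And>x y. x \<in> U \<Longrightarrow> y \<in> U \<Longrightarrow> \<bar>gam x - gam y\<bar> < \<eta> \<Longrightarrow> \<bar>psi h x - psi h y\<bar> \<le> \<epsilon> / 3"
      using psi_unif[OF h(1) e3] by metis
    have "\<bar>omega x - omega y\<bar> \<le> \<epsilon>" if "x \<in> U" "y \<in> U" "\<bar>gam x - gam y\<bar> < \<eta>" for x y
      using \<eta>(2)[OF that] h(2)[OF that(1)] h(2)[OF that(2)] by linarith
    then show ?thesis using \<eta>(1) by blast
  qed
  from extension[OF this] show ?thesis by metis
qed

lemma W_cont: "continuous_on {lo..hi} W"
  and W_gam: "u \<in> U \<Longrightarrow> W (gam u) = omega u"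
  using someI_ex[OF W_exists] unfolding W_def by blast+

lemma W_ge: "s \<in> {lo..hi} \<Longrightarrow> floor_omega \<le> W s"
proof -
  assume s: "s \<in> {lo..hi}"
  have "(\<lambda>s. - W s) s \<le> - floor_omega"
    by (rule dense_le_all[OF _ _ s]) (auto intro!: continuous_intros W_cont simp: W_gam omega_ge)
  then show ?thesis by simp
qed

lemma T_neg: "f \<in> V \<Longrightarrow> s \<in> {lo..hi} \<Longrightarrow> T (mns f) s = - T f s"
  by (simp add: T_scale of_rat_minus)

text \<open>One direction rescales \<open>f\<close> into the unit ball. For the other, \<bar>f\<bar>
  \<le> c W is dominated by a slightly larger multiple of an almost extremal \<open>h\<close> with
  \<open>N h < 1\<close>, and the norm is monotone.\<close>

lemma T_abs_le_iff:
  assumes f: "f \<in> V" and c: "c \<ge> 0"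
  shows "N f \<le> c \<longleftrightarrow> (\<forall>s\<in>{lo..hi}. \<bar>T f s\<bar> \<le> c * W s)"
proof
  assume le: "N f \<le> c"
  show "\<forall>s\<in>{lo..hi}. \<bar>T f s\<bar> \<le> c * W s"
  proof
    fix s assume s: "s \<in> {lo..hi}"
    have Ws: "W s > 0" using W_ge[OF s] floor_omega_pos by linarith
    have "\<bar>T f s\<bar> / W s \<le> c"
    proof (rule le_if_less_of_rat)
      fix q assume "c < real_of_rat q"
      then have Nq: "N f < real_of_rat q" using le by simp
      have cont: "continuous_on {lo..hi} (\<lambda>s. real_of_rat q * W s)" by (intro continuous_intros W_cont)
      have "psi f u \<le> real_of_rat q * W (gam u)" "psi (mns f) u \<le> real_of_rat q * W (gam u)" if u: "u \<in> U" for u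
        using psi_le_scaled_omega[OF f Nq u] W_gam[OF u] psi_neg[OF f u] by auto
      then have "T f s \<le> real_of_rat q * W s" "T (mns f) s \<le> real_of_rat q * W s"
        using T_mono[OF _ cont _ s] f by auto
      then have "\<bar>T f s\<bar> \<le> real_of_rat q * W s" using T_neg[OF f s] by simp
      then show "\<bar>T f s\<bar> / W s \<le> real_of_rat q" using Ws by (simp add: pos_divide_le_eq)
    qed
    then show "\<bar>T f s\<bar> \<le> c * W s" using Ws by (simp add: pos_divide_le_eq)
  qed
next
  assume le: "\<forall>s\<in>{lo..hi}. \<bar>T f s\<bar> \<le> c * W s"
  show "N f \<le> c"
  proof (rule le_if_less_of_rat)
    fix q assume q: "c < real_of_rat q"
    define y where "y = real_of_rat q"
    have "c < y" using q by (simp add: y_def)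
    then have y: "c < y" "y > 0" using c by linarith+
    \<comment> \<open>Chosen so that \<open>y * \<epsilon>\<close> is at most
      \<open>(y - c) * omega u\<close>: the excess of \<open>y\<close> over \<open>c\<close> pays
      for \<open>h\<close> falling short of \<open>omega\<close> by \<epsilon>.\<close>
    define \<epsilon> where "\<epsilon> = (y - c) * floor_omega / y"
    have \<epsilon>: "\<epsilon> > 0" using y floor_omega_pos by (simp add: \<epsilon>_def)
    obtain h where h: "h \<in> V" "N h < 1" "\<And>u. u \<in> U \<Longrightarrow> psi h u \<le> omega u \<and> omega u \<le> psi h u + \<epsilon>"
      using omega_bounds[OF \<epsilon>] by metis
    have "\<bar>psi f u\<bar> \<le> psi (pscale P q h) u" if u: "u \<in> U" for u
    proof -
      have "\<bar>psi f u\<bar> \<le> c * omega u" using le[rule_format, OF gam_in[OF u]] T_gam[OF f u] W_gam[OF u] by simp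
      moreover have "(y - c) * floor_omega \<le> (y - c) * omega u"
        using omega_ge[OF u] y by (intro mult_left_mono) auto
      moreover have "y * \<epsilon> = (y - c) * floor_omega" using y by (simp add: \<epsilon>_def)
      moreover have "y * (omega u - \<epsilon>) \<le> y * psi h u" using h(3)[OF u] y by (intro mult_left_mono) auto
      moreover have "psi (pscale P q h) u = y * psi h u" using psi_scale[OF h(1) u] by (simp add: y_def)
      ultimately show ?thesis by (simp add: algebra_simps)
    qed
    then have "N f \<le> N (pscale P q h)" using h(1) by (intro norm_mono[OF f]) auto
    also have "\<dots> = y * N h" using norm_scale[OF h(1), of q] y unfolding y_def by (simp del: abs_of_rat add: abs_of_pos)
    also have "\<dots> \<le> y * 1" using h(2) y by (intro mult_left_mono) auto
    finally show "N f \<le> real_of_rat q" by (simp add: y_def)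
  qed
qed

section \<open>Density of the image by Stone-Weierstrass\<close>

definition Ring :: "(real \<Rightarrow> real) set" where
  "Ring = {g. continuous_on {lo..hi} g \<and> (\<forall>\<epsilon>>0. \<exists>f\<in>V. \<forall>s\<in>{lo..hi}. \<bar>T f s - g s\<bar> < \<epsilon>)}"

lemma Ring_cont: "g \<in> Ring \<Longrightarrow> continuous_on {lo..hi} g"
  by (simp add: Ring_def)

lemma Ring_approx:
  assumes "g \<in> Ring" "\<epsilon> > 0"
  obtains f where "f \<in> V" "\<And>s. s \<in> {lo..hi} \<Longrightarrow> \<bar>T f s - g s\<bar> < \<epsilon>"
  using assms unfolding Ring_def by auto

lemma RingI:
  assumes "continuous_on {lo..hi} g" "\<And>\<epsilon>. \<epsilon> > 0 \<Longrightarrow> \<exists>f\<in>V. \<forall>s\<in>{lo..hi}. \<bar>T f s - g s\<bar> < \<epsilon>"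
  shows "g \<in> Ring"
  using assms unfolding Ring_def by simp

lemma T_in_Ring: "f \<in> V \<Longrightarrow> T f \<in> Ring"
  by (rule RingI) (auto intro: T_cont bexI[of _ f])

lemma Ring_add:
  assumes g: "g \<in> Ring" and h: "h \<in> Ring" shows "(\<lambda>s. g s + h s) \<in> Ring"
proof (rule RingI)
  show "continuous_on {lo..hi} (\<lambda>s. g s + h s)" by (intro continuous_intros Ring_cont g h)
  fix \<epsilon> :: real assume "\<epsilon> > 0"
  then have e2: "\<epsilon> / 2 > 0" by simp
  obtain f where f: "f \<in> V" "\<And>s. s \<in> {lo..hi} \<Longrightarrow> \<bar>T f s - g s\<bar> < \<epsilon> / 2" using Ring_approx[OF g e2] by metis
  obtain k where k: "k \<in> V" "\<And>s. s \<in> {lo..hi} \<Longrightarrow> \<bar>T k s - h s\<bar> < \<epsilon> / 2" using Ring_approx[OF h e2] by metis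
  have "\<bar>T (padd P f k) s - (g s + h s)\<bar> < \<epsilon>" if s: "s \<in> {lo..hi}" for s
    using f(2)[OF s] k(2)[OF s] T_add[OF f(1) k(1) s] by linarith
  then show "\<exists>f\<in>V. \<forall>s\<in>{lo..hi}. \<bar>T f s - (g s + h s)\<bar> < \<epsilon>" using f(1) k(1) by (intro bexI[of _ "padd P f k"]) auto
qed

lemma cont_bounded:
  fixes g :: "real \<Rightarrow> real"
  assumes "continuous_on {lo..hi} g" obtains b where "b > 0" "\<And>s. s \<in> {lo..hi} \<Longrightarrow> \<bar>g s\<bar> \<le> b"
proof -
  have "bounded (g ` {lo..hi})" using assms by (intro compact_imp_bounded compact_continuous_image) auto
  then obtain b where "b > 0" "\<forall>x\<in>g ` {lo..hi}. norm x \<le> b" unfolding bounded_pos by blast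
  then show ?thesis using that[of b] by simp
qed

text \<open>The image of \<open>T\<close> is given as a rational space only; its uniform closure
  admits real factors, approximated by rational ones.\<close>

lemma Ring_scale:
  assumes g: "g \<in> Ring" shows "(\<lambda>s. c * g s) \<in> Ring"
proof (rule RingI)
  show "continuous_on {lo..hi} (\<lambda>s. c * g s)" by (intro continuous_intros Ring_cont g)
  fix \<epsilon> :: real assume \<epsilon>: "\<epsilon> > 0"
  obtain b where b: "b > 0" "\<And>s. s \<in> {lo..hi} \<Longrightarrow> \<bar>g s\<bar> \<le> b" using cont_bounded[OF Ring_cont[OF g]] by metis
  have "c < c + \<epsilon> / (2 * b)" using \<epsilon> b by simp
  then obtain q where q: "c < real_of_rat q" "real_of_rat q < c + \<epsilon> / (2 * b)" using of_rat_dense by blast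
  have "\<epsilon> / (2 * (\<bar>real_of_rat q\<bar> + 1)) > 0"
    using \<epsilon> by (intro divide_pos_pos mult_pos_pos add_nonneg_pos) auto
  then obtain f where f: "f \<in> V" "\<And>s. s \<in> {lo..hi} \<Longrightarrow> \<bar>T f s - g s\<bar> < \<epsilon> / (2 * (\<bar>real_of_rat q\<bar> + 1))"
    using Ring_approx[OF g] by metis
  have "\<bar>T (pscale P q f) s - c * g s\<bar> < \<epsilon>" if s: "s \<in> {lo..hi}" for s
  proof -
    define r where "r = real_of_rat q"
    have "\<bar>r - c\<bar> * \<bar>g s\<bar> \<le> \<epsilon> / (2 * b) * b"
      using q b b(2)[OF s] unfolding r_def by (intro mult_mono) auto
    then have 1: "\<bar>r - c\<bar> * \<bar>g s\<bar> \<le> \<epsilon> / 2" using b by simp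
    have "\<bar>r\<bar> * \<bar>T f s - g s\<bar> \<le> \<bar>r\<bar> * (\<epsilon> / (2 * (\<bar>r\<bar> + 1)))"
      using f(2)[OF s] unfolding r_def by (intro mult_left_mono) auto
    also have "\<dots> < (\<bar>r\<bar> + 1) * (\<epsilon> / (2 * (\<bar>r\<bar> + 1)))"
      using \<epsilon> by (intro mult_strict_right_mono) auto
    also have "\<dots> = \<epsilon> / 2" by (simp add: field_simps)
    finally have 2: "\<bar>r\<bar> * \<bar>T f s - g s\<bar> < \<epsilon> / 2" .
    have "T (pscale P q f) s - c * g s = r * (T f s - g s) + (r - c) * g s"
      using T_scale[OF f(1) s] by (simp add: r_def algebra_simps)
    then have "\<bar>T (pscale P q f) s - c * g s\<bar> \<le> \<bar>r\<bar> * \<bar>T f s - g s\<bar> + \<bar>r - c\<bar> * \<bar>g s\<bar>"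
      using abs_triangle_ineq[of "r * (T f s - g s)" "(r - c) * g s"] by (simp add: abs_mult)
    then show ?thesis using 1 2 by linarith
  qed
  then show "\<exists>f\<in>V. \<forall>s\<in>{lo..hi}. \<bar>T f s - c * g s\<bar> < \<epsilon>" using f(1) by (intro bexI[of _ "pscale P q f"]) auto
qed

lemma Ring_square:
  assumes g: "g \<in> Ring" shows "(\<lambda>s. g s * g s) \<in> Ring"
proof (rule RingI)
  show "continuous_on {lo..hi} (\<lambda>s. g s * g s)" by (intro continuous_intros Ring_cont g)
  fix \<epsilon> :: real assume \<epsilon>: "\<epsilon> > 0"
  obtain b where b: "b > 0" "\<And>s. s \<in> {lo..hi} \<Longrightarrow> \<bar>g s\<bar> \<le> b" using cont_bounded[OF Ring_cont[OF g]] by metis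
  \<comment> \<open>The minimum with 1 gives \<bar>T f\<bar> \<le> b + 1, so the squares of
    \<open>T f\<close> and \<open>g\<close> differ by at most \<open>\<eta> * (2 * b + 1)\<close>,
    hence by at most \<epsilon> / 4.\<close>
  define \<eta> where "\<eta> = min 1 (\<epsilon> / (4 * (2 * b + 1)))"
  have \<eta>: "\<eta> > 0" "\<eta> \<le> 1" using \<epsilon> b by (auto simp: \<eta>_def)
  have "\<eta> * (2 * b + 1) \<le> \<epsilon> / (4 * (2 * b + 1)) * (2 * b + 1)" using b by (intro mult_right_mono) (auto simp: \<eta>_def)
  also have "\<dots> = \<epsilon> / 4" using b by (simp add: field_simps)
  finally have \<eta>b: "\<eta> * (2 * b + 1) \<le> \<epsilon> / 4" .
  obtain f where f: "f \<in> V" "\<And>s. s \<in> {lo..hi} \<Longrightarrow> \<bar>T f s - g s\<bar> < \<eta>" using Ring_approx[OF g \<eta>(1)] by metis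
  have "\<epsilon> / 4 > 0" using \<epsilon> by simp
  then obtain k where k: "k \<in> V" "\<And>u. u \<in> U \<Longrightarrow> \<bar>psi k u - psi f u * psi f u\<bar> \<le> \<epsilon> / 4"
    using psi_square[OF f(1)] by metis
  have Tk: "\<bar>T k s - T f s * T f s\<bar> \<le> \<epsilon> / 4" if s: "s \<in> {lo..hi}" for s
  proof -
    have "(\<lambda>s. \<bar>T k s - T f s * T f s\<bar>) s \<le> \<epsilon> / 4"
      by (rule dense_le_all[OF _ _ s]) (use k f in \<open>auto intro!: continuous_intros T_cont simp: T_gam\<close>)
    then show ?thesis by simp
  qed
  have "\<bar>T k s - g s * g s\<bar> < \<epsilon>" if s: "s \<in> {lo..hi}" for s
  proof -
    have "T f s * T f s - g s * g s = (T f s - g s) * (T f s + g s)" by (simp add: algebra_simps)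
    moreover have "\<bar>T f s - g s\<bar> * \<bar>T f s + g s\<bar> \<le> \<eta> * (2 * b + 1)"
      using f(2)[OF s] b(2)[OF s] \<eta> by (intro mult_mono) linarith+
    ultimately have "\<bar>T f s * T f s - g s * g s\<bar> \<le> \<epsilon> / 4" using \<eta>b by (simp add: abs_mult)
    then show ?thesis using Tk[OF s] \<epsilon> by linarith
  qed
  then show "\<exists>f\<in>V. \<forall>s\<in>{lo..hi}. \<bar>T f s - g s * g s\<bar> < \<epsilon>" using k(1) by blast
qed

lemma Ring_separates:
  assumes "s \<in> {lo..hi}" "t \<in> {lo..hi}" "s < t"
  shows "\<exists>g\<in>Ring. g s \<noteq> g t"
proof -
  \<comment> \<open>Six steps from \<open>s\<close> to \<open>t\<close>: points within
    \<open>h\<close> of \<open>s\<close> lie before \<open>x\<close>, which is within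
    \<open>h\<close> of \<open>s + 2 * h\<close>; points within \<open>h\<close> of \<open>t\<close>
    lie after \<open>y\<close>, which is within \<open>h\<close> of
    \<open>s + 4 * h\<close>.\<close>
  define h where "h = (t - s) / 6"
  have h: "h > 0" using assms by (simp add: h_def)
  have pts: "s + 2 * h \<in> {lo..hi}" "s + 4 * h \<in> {lo..hi}" using assms by (auto simp: h_def field_simps)
  obtain x where x: "x \<in> U" "\<bar>gam x - (s + 2 * h)\<bar> < h" using dense_I[OF pts(1) h] by metis
  obtain y where y: "y \<in> U" "\<bar>gam y - (s + 4 * h)\<bar> < h" using dense_I[OF pts(2) h] by metis
  have xy: "gam x < gam y" using x y by linarith
  then have "\<not> dn y \<subseteq> dn x" using gam_mono[OF y(1) x(1)] by force
  then obtain f where f: "f \<in> V" "\<And>u. u \<in> U \<Longrightarrow> dn u \<subseteq> dn x \<Longrightarrow> psi f u < 0"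
    "\<And>u. u \<in> U \<Longrightarrow> dn y \<subseteq> dn u \<Longrightarrow> 1 \<le> psi f u" using psi_step[OF x(1) y(1)] by metis
  have "T f s \<le> 0"
  proof (rule dense_le[OF T_cont[OF f(1)] assms(1) h])
    fix u assume u: "u \<in> U" "\<bar>gam u - s\<bar> < h"
    have "gam u < gam x" using u x by linarith
    then have "dn u \<subseteq> dn x" using gam_less_dn u x by blast
    then show "T f (gam u) \<le> 0" using f(2)[OF u(1)] T_gam[OF f(1) u(1)] by simp
  qed
  moreover have "(\<lambda>s. - T f s) t \<le> - 1"
  proof (rule dense_le[OF _ assms(2) h])
    show "continuous_on {lo..hi} (\<lambda>s. - T f s)" by (intro continuous_intros T_cont f)
    fix u assume u: "u \<in> U" "\<bar>gam u - t\<bar> < h"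
    have "t = s + 6 * h" by (simp add: h_def field_simps)
    then have "gam y < gam u" using u y by linarith
    then have "dn y \<subseteq> dn u" using gam_less_dn u y by blast
    then show "- T f (gam u) \<le> - 1" using f(3)[OF u(1)] T_gam[OF f(1) u(1)] by simp
  qed
  ultimately have "T f s \<noteq> T f t" by simp
  then show ?thesis using T_in_Ring[OF f(1)] by blast
qed

lemma Ring_function_ring: "function_ring_on Ring {lo..hi}"
proof
  show "compact {lo..hi}" by simp
  show "continuous_on {lo..hi} f" if "f \<in> Ring" for f using Ring_cont that .
  show "(\<lambda>x. f x + g x) \<in> Ring" if "f \<in> Ring" "g \<in> Ring" for f g using Ring_add that .
  show "(\<lambda>x. f x * g x) \<in> Ring" if f: "f \<in> Ring" and g: "g \<in> Ring" for f g
  proof -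
    \<comment> \<open>Polarisation: products are combinations of three squares.\<close>
    have "(\<lambda>s. 1 / 2 * ((f s + g s) * (f s + g s)) + - 1 / 2 * (f s * f s) + - 1 / 2 * (g s * g s)) \<in> Ring"
      by (intro Ring_add[where h = "\<lambda>s. - 1 / 2 * (g s * g s)"] Ring_add[where h = "\<lambda>s. - 1 / 2 * (f s * f s)"]
          Ring_scale Ring_square Ring_square[of "\<lambda>s. f s + g s"] Ring_add[OF f g] f g)
    moreover have "(\<lambda>s. 1 / 2 * ((f s + g s) * (f s + g s)) + - 1 / 2 * (f s * f s) + - 1 / 2 * (g s * g s))
      = (\<lambda>s. f s * g s)" by (auto simp: algebra_simps)
    ultimately show ?thesis by simp
  qed
  show "(\<lambda>_. c) \<in> Ring" for c
  proof (rule RingI)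
    fix \<epsilon> :: real assume \<epsilon>: "\<epsilon> > 0"
    have "(\<lambda>s. c * T e s) \<in> Ring" by (intro Ring_scale T_in_Ring e_in)
    then obtain f where "f \<in> V" "\<And>s. s \<in> {lo..hi} \<Longrightarrow> \<bar>T f s - c * T e s\<bar> < \<epsilon>" using Ring_approx[OF _ \<epsilon>] by metis
    then show "\<exists>f\<in>V. \<forall>s\<in>{lo..hi}. \<bar>T f s - c\<bar> < \<epsilon>" using T_e by (intro bexI[of _ f]) auto
  qed (rule continuous_on_const)
  show "\<exists>f\<in>Ring. f x \<noteq> f y" if "x \<in> {lo..hi}" "y \<in> {lo..hi}" "x \<noteq> y" for x y
    using Ring_separates[OF that(1,2)] Ring_separates[OF that(2,1)] that(3) by (metis linorder_neqE)
qed

lemma T_dense: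
  assumes F: "continuous_on {lo..hi} F" and \<epsilon>: "\<epsilon> > 0"
  obtains f where "f \<in> V" "\<And>s. s \<in> {lo..hi} \<Longrightarrow> \<bar>T f s - F s\<bar> < \<epsilon>"
proof -
  have e2: "\<epsilon> / 2 > 0" using \<epsilon> by simp
  obtain g where g: "g \<in> Ring" "\<And>s. s \<in> {lo..hi} \<Longrightarrow> \<bar>F s - g s\<bar> < \<epsilon> / 2"
    using function_ring_on.Stone_Weierstrass_basic[OF Ring_function_ring F e2] by metis
  obtain f where f: "f \<in> V" "\<And>s. s \<in> {lo..hi} \<Longrightarrow> \<bar>T f s - g s\<bar> < \<epsilon> / 2" using Ring_approx[OF g(1) e2] by metis
  have "\<bar>T f s - F s\<bar> < \<epsilon>" if "s \<in> {lo..hi}" for s using g(2)[OF that] f(2)[OF that] by linarith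
  then show ?thesis using that f(1) by blast
qed

section \<open>Transport to the unit interval\<close>

definition chart :: "real \<Rightarrow> real" where
  "chart t = lo + (hi - lo) * t"

lemma chart_in: "t \<in> {0..1} \<Longrightarrow> chart t \<in> {lo..hi}"
proof -
  assume t: "t \<in> {0..1}"
  have "0 \<le> (hi - lo) * t" using lo_less_hi t by simp
  moreover have "(hi - lo) * t \<le> (hi - lo) * 1" using lo_less_hi t by (intro mult_left_mono) auto
  ultimately show ?thesis by (simp add: chart_def)
qed

lemma chart_surj:
  assumes "s \<in> {lo..hi}" obtains t where "t \<in> {0..1}" "chart t = s"
proof (rule that)
  show "(s - lo) / (hi - lo) \<in> {0..1}" using assms lo_less_hi by (simp add: divide_le_eq)
  show "chart ((s - lo) / (hi - lo)) = s" using lo_less_hi by (simp add: chart_def)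
qed

lemma chart_cont: "continuous_on {0..1} chart"
  unfolding chart_def[abs_def] by (intro continuous_intros)

lemma C01_rep_quotient: "C01_rep P (\<lambda>f t. T f (chart t) / W (chart t))"
proof unfold_locales
  have Wpos: "W (chart t) > 0" if "t \<in> {0..1}" for t
    using W_ge[OF chart_in[OF that]] floor_omega_pos by linarith
  have comp: "continuous_on {0..1} (\<lambda>t. g (chart t))" if "continuous_on {lo..hi} g" for g :: "real \<Rightarrow> real"
    by (rule continuous_on_compose2[OF that chart_cont]) (use chart_in in blast)
  show "continuous_on {0..1} (\<lambda>t. T f (chart t) / W (chart t))" if "f \<in> V" for f
    by (intro continuous_on_divide comp T_cont W_cont that) (use Wpos in force)
  show "T (padd P x y) (chart t) / W (chart t) = T x (chart t) / W (chart t) + T y (chart t) / W (chart t)"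
    if "x \<in> V" "y \<in> V" "t \<in> {0..1}" for x y t
    using T_add[OF that(1,2) chart_in[OF that(3)]] by (simp add: add_divide_distrib)
  show "T (pscale P q x) (chart t) / W (chart t) = real_of_rat q * (T x (chart t) / W (chart t))"
    if "x \<in> V" "t \<in> {0..1}" for x t q
    using T_scale[OF that(1) chart_in[OF that(2)]] by simp
  show "N f \<le> c \<longleftrightarrow> (\<forall>t\<in>{0..1}. \<bar>T f (chart t) / W (chart t)\<bar> \<le> c)" if f: "f \<in> V" for f c
  proof (cases "c \<ge> 0")
    case True
    have "(\<forall>t\<in>{0..1}. \<bar>T f (chart t) / W (chart t)\<bar> \<le> c) \<longleftrightarrow> (\<forall>t\<in>{0..1}. \<bar>T f (chart t)\<bar> \<le> c * W (chart t))"
    proof (intro ball_cong refl)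
      fix t :: real assume "t \<in> {0..1}"
      from Wpos[OF this] show "\<bar>T f (chart t) / W (chart t)\<bar> \<le> c \<longleftrightarrow> \<bar>T f (chart t)\<bar> \<le> c * W (chart t)"
        by (simp add: abs_divide pos_divide_le_eq)
    qed
    also have "\<dots> \<longleftrightarrow> (\<forall>s\<in>{lo..hi}. \<bar>T f s\<bar> \<le> c * W s)" using chart_in chart_surj by metis
    finally show ?thesis using T_abs_le_iff[OF f True] by simp
  next
    case False
    \<comment> \<open>For negative \<open>c\<close> both sides are false, the right one already at
      0.\<close>
    have "\<not> N f \<le> c" using False norm_nonneg[OF f] by linarith
    moreover have "\<not> \<bar>T f (chart 0) / W (chart 0)\<bar> \<le> c" using False by linarith
    ultimately show ?thesis by auto
  qed
  show "\<exists>x\<in>V. \<forall>t\<in>{0..1}. \<bar>T x (chart t) / W (chart t) - F t\<bar> < \<epsilon>"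
    if F: "continuous_on {0..1} F" and \<epsilon>: "\<epsilon> > 0" for F :: "real \<Rightarrow> real" and \<epsilon> :: real
  proof -
    let ?inv = "\<lambda>s. (s - lo) / (hi - lo)"
    have "continuous_on {lo..hi} ?inv" using lo_less_hi by (intro continuous_intros) auto
    moreover have "?inv ` {lo..hi} \<subseteq> {0..1}" using lo_less_hi by (auto simp: divide_le_eq)
    ultimately have "continuous_on {lo..hi} (\<lambda>s. F (?inv s))" by (rule continuous_on_compose2[OF F])
    then have "continuous_on {lo..hi} (\<lambda>s. F (?inv s) * W s)" by (intro continuous_intros W_cont)
    \<comment> \<open>Since \<open>W\<close> is at least \<open>floor_omega\<close>, dividing by
      \<open>W\<close> turns this error into one below \<epsilon>.\<close>
    moreover have "\<epsilon> * floor_omega > 0" using \<epsilon> floor_omega_pos by simp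
    ultimately obtain f where f: "f \<in> V" "\<And>s. s \<in> {lo..hi} \<Longrightarrow> \<bar>T f s - F (?inv s) * W s\<bar> < \<epsilon> * floor_omega"
      using T_dense[of "\<lambda>s. F (?inv s) * W s"] by metis
    have "\<bar>T f (chart t) / W (chart t) - F t\<bar> < \<epsilon>" if t: "t \<in> {0..1}" for t
    proof -
      have "?inv (chart t) = t" using lo_less_hi by (simp add: chart_def)
      then have "\<bar>T f (chart t) - F t * W (chart t)\<bar> < \<epsilon> * floor_omega" using f(2)[OF chart_in[OF t]] by simp
      also have "\<dots> \<le> \<epsilon> * W (chart t)" using W_ge[OF chart_in[OF t]] \<epsilon> by simp
      finally have "\<bar>T f (chart t) - F t * W (chart t)\<bar> / W (chart t) < \<epsilon>" using Wpos[OF t] by (simp add: pos_divide_less_eq)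
      moreover have "T f (chart t) / W (chart t) - F t = (T f (chart t) - F t * W (chart t)) / W (chart t)"
        using Wpos[OF t] by (simp add: diff_divide_distrib)
      ultimately show ?thesis using Wpos[OF t] by (simp add: abs_divide)
    qed
    then show ?thesis using f(1) by blast
  qed
qed

end

lemma looks_like_C01_iff:
  assumes "presents_normed_space P"
  shows "looks_like_C01 P \<longleftrightarrow> (\<exists>J. C01_rep P J)"
proof
  assume "looks_like_C01 P"
  then obtain e l r where e: "e \<in> points P" "eval_axioms P e l r" "order_axioms P e l r" "norm_axioms P e l r"
    unfolding looks_like_C01_def by (elim bexE conjE)
  interpret evaluation P e l r
    by (rule evaluation.intro[OF normed_presentation.intro[OF assms]], unfold_locales) (fact e)+
  show "\<exists>J. C01_rep P J" using C01_rep_quotient by blast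
next
  assume "\<exists>J. C01_rep P J"
  then show "looks_like_C01 P" using C01_rep.looks_like_C01 by blast
qed

theorem theorem1p4:
  fixes B :: "nat \<Rightarrow> presentation"
  assumes "uniformly_computable B"
    and "enumerates_all B"
  shows "arithmetical
    {i. presents_normed_space (B i) \<and> isometrically_isomorphic (banach_completion (B i)) C01}"
proof -
  interpret uniform_presentation B by unfold_locales (rule assms(1))
  have eq: "presents_normed_space (B i) \<and> isometrically_isomorphic (banach_completion (B i)) C01
      \<longleftrightarrow> valid (B i) \<and> looks_like_C01 (B i)" for i
    using isometrically_isomorphic_iff[of "B i"] looks_like_C01_iff[of "B i"]
      presents_normed_space_iff[of "B i"] by blast
  show ?thesis
    unfolding eq by (rule arithmetical_if_Ar) (simp add: Ar_conj Ar_valid Ar_looks_like_C01)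
qed

end
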